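(* There is an algorithm that, given an instance of \textsc{Object Reachability} in which the social network is a path and all preferences are strict, together with an agent $k$ and an object $o_l$, decides whether $o_l$ is reachable for agent $k$ in $O(n^4)$ time, where $n$ is the number of agents.
   Context: An instance consists of a set $N=\{1,\dots,n\}$ of agents, a set $O=\{o_1,\dots,o_n\}$ of objects, a strict preference (a linear order $\succ_i$ on $O$) for each agent $i$, a social network graph $G=(N,E)$, and the initial assignment $\sigma_0$ with $\sigma_0(i)=o_i$. An assignment is a bijection $\sigma:N\to O$. A swap transforms $\sigma$ into $\sigma'$ by exchanging the objects of two agents $i,j$ that are adjacent in $G$, and is allowed only if it is individually rational: $\sigma(j)\succeq_i\sigma(i)$ and $\sigma(i)\succeq_j\sigma(j)$ (with strict preferences this means both agents strictly improve). An object $o$ is reachable for agent $i$ if there is a sequence of swaps $\sigma_0,\sigma_1,\dots,\sigma_t$ (each obtained from the previous one by a swap) with $\sigma_t(i)=o$. Here $G$ is a path. *)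

theory Defs
  imports Complex_Main "HOL-Library.Landau_Symbols"
begin

section \<open>Object reachability\<close>

text \<open>
  Agents are \<open>1, \<dots>, n\<close>, and the object \<open>o\<^sub>j\<close> is represented by its index \<open>j\<close>.
  \<open>(a, b) \<in> pref I i\<close> means that agent \<open>i\<close> strictly prefers object \<open>a\<close> to object \<open>b\<close>.
\<close>

record swap_instance =
  num :: nat
  pref :: "nat \<Rightarrow> (nat \<times> nat) set"
  edges :: "nat set set"

definition agents :: "swap_instance \<Rightarrow> nat set" where
  "agents I = {1..num I}"

definition objects :: "swap_instance \<Rightarrow> nat set" where
  "objects I = {1..num I}"

definition strict_preferences :: "swap_instance \<Rightarrow> bool" where
  "strict_preferences I \<longleftrightarrow>
     (\<forall>i\<in>agents I. pref I i \<subseteq> objects I \<times> objects I \<and> strict_linear_order_on (objects I) (pref I i))"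

definition path_network :: "swap_instance \<Rightarrow> bool" where
  "path_network I \<longleftrightarrow>
     (\<exists>xs. distinct xs \<and> set xs = agents I \<and>
        edges I = {{xs ! i, xs ! Suc i} | i. Suc i < length xs})"

definition weakly_prefers :: "swap_instance \<Rightarrow> nat \<Rightarrow> nat \<Rightarrow> nat \<Rightarrow> bool" where
  "weakly_prefers I i a b \<longleftrightarrow> a = b \<or> (a, b) \<in> pref I i"

definition assignment :: "swap_instance \<Rightarrow> (nat \<Rightarrow> nat) \<Rightarrow> bool" where
  "assignment I \<sigma> \<longleftrightarrow> bij_betw \<sigma> (agents I) (objects I)"

definition initial_assignment :: "nat \<Rightarrow> nat" where
  "initial_assignment i = i"

definition swap :: "swap_instance \<Rightarrow> (nat \<Rightarrow> nat) \<Rightarrow> (nat \<Rightarrow> nat) \<Rightarrow> bool" where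
  "swap I \<sigma> \<sigma>' \<longleftrightarrow> assignment I \<sigma> \<and>
     (\<exists>i\<in>agents I. \<exists>j\<in>agents I. i \<noteq> j \<and> {i, j} \<in> edges I \<and>
        weakly_prefers I i (\<sigma> j) (\<sigma> i) \<and> weakly_prefers I j (\<sigma> i) (\<sigma> j) \<and>
        \<sigma>' = \<sigma>(i := \<sigma> j, j := \<sigma> i))"

definition reachable :: "swap_instance \<Rightarrow> nat \<Rightarrow> nat \<Rightarrow> bool" where
  "reachable I i x \<longleftrightarrow> (\<exists>\<sigma>. (swap I)\<^sup>*\<^sup>* initial_assignment \<sigma> \<and> \<sigma> i = x)"


section \<open>Word RAM programs\<close>

text \<open>
  The model of computation is a word RAM, programmed in a structured language with finitely many
  scalar registers and (indirectly addressed) arrays of natural numbers. Every operation has unit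
  cost. The semantics is parametrised by a word length \<open>w\<close>: an execution in which some
  (intermediate) value does not fit into \<open>w\<close> bits gets stuck, i.e. it has no derivation.
  This also bounds the addresses, and it keeps unit-cost multiplication honest.
  Subtraction is truncated at 0.
\<close>

record ram_state =
  reg :: "string \<Rightarrow> nat"
  arr :: "string \<Rightarrow> nat \<Rightarrow> nat"

datatype aexp =
    Const nat
  | Reg string
  | Read string aexp
  | Add aexp aexp
  | Sub aexp aexp
  | Mul aexp aexp

datatype bexp =
    Less aexp aexp
  | Equal aexp aexp
  | Neg bexp
  | Conj bexp bexp

datatype com =
    Skip
  | Assign string aexp
  | Store string aexp aexp
  | Seq com com
  | If bexp com com
  | While bexp com

fun aval :: "aexp \<Rightarrow> ram_state \<Rightarrow> nat" where
  "aval (Const c) s = c"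
| "aval (Reg x) s = reg s x"
| "aval (Read x a) s = arr s x (aval a s)"
| "aval (Add a b) s = aval a s + aval b s"
| "aval (Sub a b) s = aval a s - aval b s"
| "aval (Mul a b) s = aval a s * aval b s"

fun afits :: "nat \<Rightarrow> aexp \<Rightarrow> ram_state \<Rightarrow> bool" where
  "afits w (Const c) s \<longleftrightarrow> c < 2 ^ w"
| "afits w (Reg x) s \<longleftrightarrow> reg s x < 2 ^ w"
| "afits w (Read x a) s \<longleftrightarrow> afits w a s \<and> arr s x (aval a s) < 2 ^ w"
| "afits w (Add a b) s \<longleftrightarrow> afits w a s \<and> afits w b s \<and> aval a s + aval b s < 2 ^ w"
| "afits w (Sub a b) s \<longleftrightarrow> afits w a s \<and> afits w b s"
| "afits w (Mul a b) s \<longleftrightarrow> afits w a s \<and> afits w b s \<and> aval a s * aval b s < 2 ^ w"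

fun acost :: "aexp \<Rightarrow> nat" where
  "acost (Const c) = 1"
| "acost (Reg x) = 1"
| "acost (Read x a) = acost a + 1"
| "acost (Add a b) = acost a + acost b + 1"
| "acost (Sub a b) = acost a + acost b + 1"
| "acost (Mul a b) = acost a + acost b + 1"

fun bval :: "bexp \<Rightarrow> ram_state \<Rightarrow> bool" where
  "bval (Less a b) s \<longleftrightarrow> aval a s < aval b s"
| "bval (Equal a b) s \<longleftrightarrow> aval a s = aval b s"
| "bval (Neg p) s \<longleftrightarrow> \<not> bval p s"
| "bval (Conj p q) s \<longleftrightarrow> bval p s \<and> bval q s"

fun bfits :: "nat \<Rightarrow> bexp \<Rightarrow> ram_state \<Rightarrow> bool" where
  "bfits w (Less a b) s \<longleftrightarrow> afits w a s \<and> afits w b s"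
| "bfits w (Equal a b) s \<longleftrightarrow> afits w a s \<and> afits w b s"
| "bfits w (Neg p) s \<longleftrightarrow> bfits w p s"
| "bfits w (Conj p q) s \<longleftrightarrow> bfits w p s \<and> bfits w q s"

fun bcost :: "bexp \<Rightarrow> nat" where
  "bcost (Less a b) = acost a + acost b + 1"
| "bcost (Equal a b) = acost a + acost b + 1"
| "bcost (Neg p) = bcost p + 1"
| "bcost (Conj p q) = bcost p + bcost q + 1"

text \<open>\<open>exec w c s t s'\<close>: with word length \<open>w\<close>, program \<open>c\<close> started in \<open>s\<close> halts in \<open>s'\<close> after \<open>t\<close> steps.\<close>

inductive exec :: "nat \<Rightarrow> com \<Rightarrow> ram_state \<Rightarrow> nat \<Rightarrow> ram_state \<Rightarrow> bool" for w where
  Skip: "exec w Skip s 1 s"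
| Assign: "afits w a s \<Longrightarrow>
    exec w (Assign x a) s (acost a + 1) (s\<lparr>reg := (reg s)(x := aval a s)\<rparr>)"
| Store: "afits w i s \<Longrightarrow> afits w a s \<Longrightarrow>
    exec w (Store x i a) s (acost i + acost a + 1)
      (s\<lparr>arr := (arr s)(x := (arr s x)(aval i s := aval a s))\<rparr>)"
| Seq: "exec w c s t s' \<Longrightarrow> exec w d s' u s'' \<Longrightarrow> exec w (Seq c d) s (t + u) s''"
| IfTrue: "bfits w b s \<Longrightarrow> bval b s \<Longrightarrow> exec w c s t s' \<Longrightarrow>
    exec w (If b c d) s (bcost b + 1 + t) s'"
| IfFalse: "bfits w b s \<Longrightarrow> \<not> bval b s \<Longrightarrow> exec w d s t s' \<Longrightarrow>
    exec w (If b c d) s (bcost b + 1 + t) s'"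
| WhileFalse: "bfits w b s \<Longrightarrow> \<not> bval b s \<Longrightarrow> exec w (While b c) s (bcost b + 1) s"
| WhileTrue: "bfits w b s \<Longrightarrow> bval b s \<Longrightarrow> exec w c s t s' \<Longrightarrow> exec w (While b c) s' u s'' \<Longrightarrow>
    exec w (While b c) s (bcost b + 1 + t + u) s''"

inductive_cases exec_SkipE: "exec w Skip s t s'"
  and exec_AssignE: "exec w (Assign x a) s t s'"
  and exec_StoreE: "exec w (Store x i a) s t s'"
  and exec_SeqE: "exec w (Seq c d) s t s'"
  and exec_IfE: "exec w (If b c d) s t s'"
  and exec_WhileE: "exec w (While b c) s t s'"

lemma exec_deterministic:
  "exec w c s t s' \<Longrightarrow> exec w c s u s'' \<Longrightarrow> u = t \<and> s'' = s'"
proof (induction arbitrary: u s'' rule: exec.induct)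
  case (Skip s)
  from Skip.prems show ?case by (rule exec_SkipE) simp
next
  case (Assign a s x)
  from Assign.prems show ?case by (rule exec_AssignE) simp
next
  case (Store i s a x)
  from Store.prems show ?case by (rule exec_StoreE) simp
next
  case (Seq c s t s' d v r)
  from Seq.prems show ?case
    by (rule exec_SeqE) (use Seq.IH in blast)
next
  case (IfTrue b s c t s' d)
  from IfTrue.prems \<open>bval b s\<close> obtain t1 where "exec w c s t1 s''" "u = bcost b + 1 + t1"
    by cases simp_all
  then show ?case using IfTrue.IH[of t1 s''] by simp
next
  case (IfFalse b s d t s' c)
  from IfFalse.prems \<open>\<not> bval b s\<close> obtain t1 where "exec w d s t1 s''" "u = bcost b + 1 + t1"
    by cases simp_all
  then show ?case using IfFalse.IH[of t1 s''] by simp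
next
  case (WhileFalse b s c)
  from WhileFalse.prems \<open>\<not> bval b s\<close> show ?case by cases simp_all
next
  case (WhileTrue b s c t s' v r)
  from WhileTrue.prems \<open>bval b s\<close> obtain t1 u1 s1 where
    "exec w c s t1 s1" "exec w (While b c) s1 u1 s''" "u = bcost b + 1 + t1 + u1"
    by cases simp_all
  then show ?case using WhileTrue.IH(1)[of t1 s1] WhileTrue.IH(2)[of u1 s''] by simp
qed


section \<open>Input encoding\<close>

text \<open>
  The preference lists are stored row by row, most preferred object first: cell \<open>i * n + r\<close> of
  the array \<open>pref\<close> holds the object of agent \<open>i \<in> {1..n}\<close> with rank \<open>r \<in> {0..<n}\<close>. Cell
  \<open>i * n + (j - 1)\<close> of the array \<open>adj\<close> holds the entry \<open>(i, j)\<close> of the adjacency matrix,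
  \<open>i, j \<in> {1..n}\<close>.
  All other cells and registers are 0.
\<close>

definition object_at_rank :: "swap_instance \<Rightarrow> nat \<Rightarrow> nat \<Rightarrow> nat" where
  "object_at_rank I i r =
     (THE x. x \<in> objects I \<and> card {y \<in> objects I. (y, x) \<in> pref I i} = r)"

definition pref_array :: "swap_instance \<Rightarrow> nat \<Rightarrow> nat" where
  "pref_array I p =
     (if p div num I \<in> agents I then object_at_rank I (p div num I) (p mod num I) else 0)"

definition adj_array :: "swap_instance \<Rightarrow> nat \<Rightarrow> nat" where
  "adj_array I p =
     (if p div num I \<in> agents I \<and> {p div num I, Suc (p mod num I)} \<in> edges I then 1 else 0)"

definition input_state :: "swap_instance \<Rightarrow> nat \<Rightarrow> nat \<Rightarrow> ram_state" where
  "input_state I k l =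
     \<lparr>reg = (\<lambda>_. 0)(''n'' := num I, ''k'' := k, ''l'' := l),
      arr = (\<lambda>_ _. 0)(''pref'' := pref_array I, ''adj'' := adj_array I)\<rparr>"

end

theory Submission
  imports Defs "HOL-Combinatorics.Transposition" "HOL-Real_Asymp.Real_Asymp"
begin

text \<open>
  Number agents and objects by their positions on the path and suppose that object \<open>l\<close> has to move
  right to agent \<open>k\<close>. An agent never gets back an object that it gave away, so every object moves in
  one direction only. Let \<open>b\<close> be the last object that \<open>l\<close> passes. Only the objects in \<open>{l..b}\<close> matter,
  every one of them moves left or right, and the set of left movers determines at which edge a right
  mover \<open>a\<close> and a left mover \<open>c > a\<close> cross. Conversely, if both agents involved agree to every such
  crossing, then the crossings can be carried out one after the other.

  The preferences of the agents between \<open>c\<close> and \<open>l\<close> leave only one possible final position for a left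
  mover \<open>c\<close>, and those between \<open>a\<close> and \<open>b\<close> only one for a right mover \<open>a\<close>; the edge where they
  cross is a function of these two positions. For fixed \<open>b\<close> the choice of directions is therefore an
  instance of 2-SAT with \<open>n\<close> variables, which is solved by computing the transitive closure of its
  implication graph in time \<open>O(n\<^sup>3)\<close>. There are at most \<open>n\<close> candidates for \<open>b\<close>.
\<close>

section \<open>Crossing plans\<close>

text \<open>Why a final position is forced: within \<open>{l..b}\<close>, the last object that a
  left mover \<open>c\<close> crosses is \<open>l\<close>, the leftmost right mover. Agents below
  \<open>k\<close> strictly between that crossing and \<open>c\<close> hold \<open>c\<close> before
  it and \<open>l\<close> after it, so they prefer \<open>l\<close>; the agent that receives
  \<open>c\<close> at the crossing prefers \<open>c\<close>. Hence the position is a maximum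
  determined by preferences alone. \<open>b\<close> does for right movers what \<open>l\<close> does
  for left movers, which is why \<open>b\<close> has to be fixed first. If \<open>L\<close> is the
  set of left movers, the final positions of \<open>c\<close> and \<open>a\<close> are
  \<open>l + cnt L c\<close> and \<open>a + card L - cnt L a\<close>. As
  \<open>k = l + card L\<close>, their sum minus \<open>k\<close> is
  \<open>a + cnt L c - cnt L a\<close>, the left end of the edge where \<open>a\<close> and
  \<open>c\<close> cross. A condition on this edge thus no longer mentions the rest of
  \<open>L\<close>; this makes all clauses binary. For the program, loops are bounded by registers,
  so that it denotes a total function on states. Running time and word length then follow once and
  for all from syntactic conditions, independently of functional correctness.\<close>

definition cnt :: "nat set \<Rightarrow> nat \<Rightarrow> nat" where
  "cnt L x = card (L \<inter> {..<x})"

lemma cnt_Suc: "cnt L (Suc x) = cnt L x + (if x \<in> L then 1 else 0)"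
proof -
  have "L \<inter> {..<Suc x} = (if x \<in> L then insert x (L \<inter> {..<x}) else L \<inter> {..<x})"
    by (auto simp: less_Suc_eq)
  then show ?thesis by (simp add: cnt_def)
qed

lemma cnt_mono: "x \<le> y \<Longrightarrow> cnt L x \<le> cnt L y"
  by (auto simp: cnt_def intro!: card_mono)

lemma cnt_le_add: "x \<le> y \<Longrightarrow> cnt L y \<le> cnt L x + (y - x)"
  by (induction rule: dec_induct) (auto simp: cnt_Suc)

lemma cnt_less: "x \<in> L \<Longrightarrow> x < y \<Longrightarrow> cnt L x < cnt L y"
  using cnt_mono[of "Suc x" y L] by (simp add: cnt_Suc)

lemma cnt_less_add: "x \<notin> L \<Longrightarrow> x < y \<Longrightarrow> cnt L y < cnt L x + (y - x)"
  using cnt_le_add[of "Suc x" y L] by (simp add: cnt_Suc)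

lemma card_between: "x \<le> y \<Longrightarrow> card (L \<inter> {x..<y}) = cnt L y - cnt L x"
proof -
  assume "x \<le> y"
  then have "L \<inter> {x..<y} = L \<inter> {..<y} - L \<inter> {..<x}" "L \<inter> {..<x} \<subseteq> L \<inter> {..<y}" by auto
  then show ?thesis unfolding cnt_def by (metis card_Diff_subset finite_Int finite_lessThan)
qed

lemma cnt_Diff_interval:
  assumes "L \<subseteq> {l..}" "l \<le> x" "x \<le> Suc b"
  shows "cnt ({l..b} - L) x = x - l - cnt L x"
proof -
  have "({l..b} - L) \<inter> {..<x} = {l..<x} - (L \<inter> {..<x})" using assms by auto
  moreover have "L \<inter> {..<x} \<subseteq> {l..<x}" using assms by auto
  ultimately show ?thesis unfolding cnt_def by (simp add: card_Diff_subset)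
qed

text \<open>A swap moves an object by at most one position. This lemma therefore shows that an
  object visits every agent between two of its positions; the last assumption covers both directions
  of travel.\<close>

lemma nat_intermediate_value:
  fixes f :: "nat \<Rightarrow> nat"
  assumes "s \<le> t" "\<And>u. s \<le> u \<Longrightarrow> u < t \<Longrightarrow> f (Suc u) \<le> Suc (f u) \<and> f u \<le> Suc (f (Suc u))"
    and "f s \<le> v \<and> v \<le> f t \<or> f t \<le> v \<and> v \<le> f s"
  shows "\<exists>u\<ge>s. u \<le> t \<and> f u = v"
  using assms
proof (induction arbitrary: v rule: dec_induct)
  case base
  from base.prems(2) have "f s = v" by linarith
  then show ?case by (intro exI[of _ s]) simp
next
  case (step m)
  show ?case
  proof (cases "f (Suc m) = v")
    case True
    then show ?thesis using step.hyps by (intro exI[of _ "Suc m"]) auto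
  next
    case False
    have "f (Suc m) \<le> Suc (f m) \<and> f m \<le> Suc (f (Suc m))" by (rule step.prems(1)) (use step.hyps in auto)
    then have "f s \<le> v \<and> v \<le> f m \<or> f m \<le> v \<and> v \<le> f s" using step.prems(2) False by linarith
    then have "\<exists>u\<ge>s. u \<le> m \<and> f u = v"
      by (intro step.IH step.prems(1)) auto
    then obtain u where "u \<ge> s" "u \<le> m" "f u = v" by blast
    then show ?thesis by (intro exI[of _ u]) auto
  qed
qed

text \<open>Agents and objects alike are numbered from 0 by position along the path, so the initial
  assignment becomes \<open>id\<close>. Keeping \<open>P\<close> abstract permits an instance that
  compares rank entries in memory.\<close>

locale line_market =
  fixes n :: nat and P :: "nat \<Rightarrow> nat \<Rightarrow> nat \<Rightarrow> bool"
  assumes P_irrefl: "i < n \<Longrightarrow> \<not> P i x x"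
    and P_trans: "i < n \<Longrightarrow> P i x y \<Longrightarrow> P i y z \<Longrightarrow> P i x z"
begin

lemma P_asym: "i < n \<Longrightarrow> P i x y \<Longrightarrow> \<not> P i y x"
  using P_irrefl P_trans by blast

definition line_step :: "(nat \<Rightarrow> nat) \<Rightarrow> (nat \<Rightarrow> nat) \<Rightarrow> bool" where
  "line_step \<sigma> \<sigma>' \<longleftrightarrow> (\<exists>p. Suc p < n \<and> P p (\<sigma> (Suc p)) (\<sigma> p) \<and> P (Suc p) (\<sigma> p) (\<sigma> (Suc p)) \<and>
     \<sigma>' = \<sigma>(p := \<sigma> (Suc p), Suc p := \<sigma> p))"

definition line_reachable :: "nat \<Rightarrow> nat \<Rightarrow> bool" where
  "line_reachable k l \<longleftrightarrow> (\<exists>\<sigma>. line_step\<^sup>*\<^sup>* id \<sigma> \<and> \<sigma> k = l)"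

definition crossing_ok :: "nat \<Rightarrow> nat \<Rightarrow> nat \<Rightarrow> bool" where
  "crossing_ok p a c \<longleftrightarrow> P p c a \<and> P (Suc p) a c"

text \<open>Every left mover shifts \<open>l\<close> by one, hence \<open>k = l + card L\<close>.
  Before meeting \<open>c\<close>, the right mover \<open>a\<close> has crossed exactly the left
  movers strictly between them, which puts it at \<open>a + cnt L c - cnt L a\<close>.\<close>

definition crossing_plan :: "nat \<Rightarrow> nat \<Rightarrow> nat \<Rightarrow> nat set \<Rightarrow> bool" where
  "crossing_plan k l b L \<longleftrightarrow> b < n \<and> L \<subseteq> {l<..b} \<and> b \<in> L \<and> k = l + card L \<and>
     (\<forall>a\<in>{l..b} - L. \<forall>c\<in>L. a < c \<longrightarrow> crossing_ok (a + cnt L c - cnt L a) a c)"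

subsection \<open>Executing a crossing plan\<close>

text \<open>\<open>X\<close> holds pairs (right mover, left mover) that have already crossed; each
  pair shifts its first component right and its second one left.\<close>

definition displaced :: "(nat \<times> nat) set \<Rightarrow> nat \<Rightarrow> nat" where
  "displaced X x = x + card {y. (x, y) \<in> X} - card {z. (z, x) \<in> X}"

text \<open>The schedule: left movers in increasing order, each meeting right movers from the
  nearest to the farthest. At this stage all left movers below \<open>c\<close> are finished and
  \<open>c\<close> has met the right movers from \<open>h\<close> on.\<close>

definition crossed :: "nat set \<Rightarrow> nat set \<Rightarrow> nat \<Rightarrow> nat \<Rightarrow> (nat \<times> nat) set" where
  "crossed R L c h = {(x, y). x \<in> R \<and> y \<in> L \<and> x < y \<and> (y < c \<or> y = c \<and> h \<le> x)}"

text \<open>In the order given by \<open>crossed\<close>, the pair whose turn it is occupies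
  neighbouring positions, and these form the edge at which the plan guarantees consent.\<close>

lemma crossing_plan_execute:
  assumes plan: "crossing_plan k l b L"
  shows "line_reachable k l"
proof -
  define R where "R = {l..b} - L"
  from plan have b: "b < n" "L \<subseteq> {l<..b}" "b \<in> L" "k = l + card L"
    and ok: "\<And>a c. a \<in> R \<Longrightarrow> c \<in> L \<Longrightarrow> a < c \<Longrightarrow> crossing_ok (a + cnt L c - cnt L a) a c"
    by (auto simp: crossing_plan_def R_def)
  define good where "good X \<longleftrightarrow> (\<exists>\<sigma>. line_step\<^sup>*\<^sup>* id \<sigma> \<and> (\<forall>x. \<sigma> (displaced X x) = x))" for X
  have finL: "finite L" using b(2) finite_subset by blast
  have finR: "finite R" by (simp add: R_def)
  have disj: "\<And>x. x \<in> R \<Longrightarrow> x \<in> L \<Longrightarrow> False" by (auto simp: R_def)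
  have cross: "good (crossed R L c h)"
    if g: "good (crossed R L c (Suc h))" and c: "c \<in> L" and hc: "h < c" for c h
  proof (cases "h \<in> R")
    case False
    then have "crossed R L c h = crossed R L c (Suc h)"
      by (auto simp: crossed_def Suc_le_eq le_less)
    then show ?thesis using g by simp
  next
    case h: True
    let ?X = "crossed R L c (Suc h)" and ?Y = "crossed R L c h"
    have Y: "?Y = insert (h, c) ?X"
      using h c hc by (auto simp: crossed_def Suc_le_eq le_less)
    have hl: "l \<le> h" using h by (auto simp: R_def)
    have "{y. (h, y) \<in> ?X} = L \<inter> {Suc h..<c}" "{z. (z, h) \<in> ?X} = {}"
      using h disj by (auto simp: crossed_def)
    then have ph: "displaced ?X h = h + cnt L c - cnt L h"
      using hc disj[OF h] card_between[of "Suc h" c L] cnt_mono[of h c L]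
      by (auto simp: displaced_def cnt_Suc)
    \<comment> \<open>An object strictly between \<open>h\<close> and \<open>c\<close> is either a
      left mover that \<open>h\<close> has passed or a right mover that \<open>c\<close> has passed.
      Counting both kinds shows that \<open>h\<close> and \<open>c\<close> are now
      neighbours.\<close>
    have "{y. (c, y) \<in> ?X} = {}" "{z. (z, c) \<in> ?X} = R \<inter> {Suc h..<c}"
      using c disj by (auto simp: crossed_def)
    moreover have "cnt R c = c - l - cnt L c" "cnt R h = h - l - cnt L h"
      using b c hc hl unfolding R_def by (intro cnt_Diff_interval; auto)+
    moreover have "cnt L l = 0" using b(2) by (auto simp: cnt_def)
    then have "cnt L h \<le> h - l" using cnt_le_add[OF hl, of L] by simp
    moreover have "cnt L c < cnt L h + (c - h)" using disj[OF h] hc by (intro cnt_less_add) auto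
    ultimately have "displaced ?X c = Suc (h + cnt L c - cnt L h)"
      using hc h hl card_between[of "Suc h" c R] cnt_mono[of h c L]
      unfolding displaced_def by (simp add: cnt_Suc)
    then have pc: "displaced ?X c = Suc (displaced ?X h)" by (simp add: ph)
    have Xh: "displaced ?Y h = Suc (displaced ?X h)"
    proof -
      have "{y. (h, y) \<in> ?Y} = insert c {y. (h, y) \<in> ?X}" "{z. (z, h) \<in> ?Y} = {}" "{z. (z, h) \<in> ?X} = {}"
        using Y h disj by (auto simp: crossed_def)
      moreover have "c \<notin> {y. (h, y) \<in> ?X}" by (auto simp: crossed_def)
      moreover have "finite {y. (h, y) \<in> ?X}" by (rule finite_subset[OF _ finL]) (auto simp: crossed_def)
      ultimately show ?thesis by (simp add: displaced_def)
    qed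
    have Xc: "displaced ?Y c = displaced ?X h"
    proof -
      have "{z. (z, c) \<in> ?Y} = insert h {z. (z, c) \<in> ?X}" "{y. (c, y) \<in> ?Y} = {}" "{y. (c, y) \<in> ?X} = {}"
        using Y c disj by (auto simp: crossed_def)
      moreover have "h \<notin> {z. (z, c) \<in> ?X}" by (auto simp: crossed_def)
      moreover have "finite {z. (z, c) \<in> ?X}" by (rule finite_subset[OF _ finR]) (auto simp: crossed_def)
      ultimately have "Suc (displaced ?Y c) = displaced ?X c \<or> displaced ?X c = 0"
        by (auto simp: displaced_def)
      then show ?thesis using pc by simp
    qed
    have Xo: "displaced ?Y x = displaced ?X x" if "x \<noteq> h" "x \<noteq> c" for x
    proof -
      have "{y. (x, y) \<in> ?Y} = {y. (x, y) \<in> ?X}" "{z. (z, x) \<in> ?Y} = {z. (z, x) \<in> ?X}"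
        using Y that by auto
      then show ?thesis by (simp add: displaced_def)
    qed
    obtain \<sigma> where \<sigma>: "line_step\<^sup>*\<^sup>* id \<sigma>" "\<And>x. \<sigma> (displaced ?X x) = x"
      using g by (auto simp: good_def)
    define p where "p = displaced ?X h"
    have s1: "\<sigma> p = h" "\<sigma> (Suc p) = c" using \<sigma>(2)[of h] \<sigma>(2)[of c] pc by (auto simp: p_def)
    have "h \<notin> L" using disj[OF h] by blast
    then have "Suc p \<le> c" using hc ph cnt_mono[of h c L] cnt_less_add[of h L c] by (simp add: p_def)
    then have pn: "Suc p < n" using c b by auto
    have "crossing_ok p h c" using ok[OF h c hc] ph by (simp add: p_def)
    then have "line_step \<sigma> (\<sigma>(p := c, Suc p := h))"
      unfolding line_step_def crossing_ok_def using s1 pn by (intro exI[of _ p]) auto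
    with \<sigma>(1) have "line_step\<^sup>*\<^sup>* id (\<sigma>(p := c, Suc p := h))" by simp
    moreover have "(\<sigma>(p := c, Suc p := h)) (displaced ?Y x) = x" for x
    proof (cases "x = h \<or> x = c")
      case True
      then show ?thesis using Xh Xc hc by (auto simp: p_def)
    next
      case False
      then have "displaced ?X x \<noteq> p" "displaced ?X x \<noteq> Suc p" using \<sigma>(2)[of x] s1 by auto
      then show ?thesis using False Xo \<sigma>(2) by simp
    qed
    ultimately show ?thesis by (auto simp: good_def)
  qed
  \<comment> \<open>The bound \<open>h\<close> runs downwards from \<open>c\<close> to 0, hence the
    induction on the difference \<open>j\<close>.\<close>
  have inner: "good (crossed R L c (c - j))" if "good (crossed R L c c)" "c \<in> L" for c j
  proof (induction j)
    case 0
    then show ?case using that by simp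
  next
    case (Suc j)
    show ?case
    proof (cases "j < c")
      case True
      then have "Suc (c - Suc j) = c - j" by simp
      then show ?thesis using cross[of c "c - Suc j"] Suc that(2) True by simp
    next
      case False
      then show ?thesis using Suc by simp
    qed
  qed
  have outer: "good (crossed R L c c)" for c
  proof (induction c)
    case 0
    have "crossed R L 0 0 = {}" by (auto simp: crossed_def)
    then show ?case by (auto simp: good_def displaced_def intro!: exI[of _ id])
  next
    case (Suc c)
    have e: "crossed R L (Suc c) (Suc c) = crossed R L c 0"
      by (auto simp: crossed_def less_Suc_eq)
    show ?case
    proof (cases "c \<in> L")
      case True
      then show ?thesis using inner[OF Suc, of c] e by simp
    next
      case False
      then have "crossed R L c 0 = crossed R L c c" by (auto simp: crossed_def)
      then show ?thesis using Suc e by simp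
    qed
  qed
  have "{y. (l, y) \<in> crossed R L (Suc b) (Suc b)} = L" "{z. (z, l) \<in> crossed R L (Suc b) (Suc b)} = {}"
    using b by (auto simp: crossed_def R_def less_Suc_eq_le)
  then have "displaced (crossed R L (Suc b) (Suc b)) l = k" by (simp add: displaced_def b)
  then show ?thesis using outer[of "Suc b"] unfolding good_def line_reachable_def by metis
qed

subsection \<open>Extracting a crossing plan\<close>

text \<open>\<open>L\<close> consists of the objects that start right of \<open>l\<close> and end
  left of \<open>k\<close>. The last two conclusions, about the agents passed before the crossings
  with \<open>l\<close> and \<open>b\<close>, are what makes the goals extremal later on.\<close>

lemma run_crossing_plan:
  fixes f :: "nat \<Rightarrow> nat \<Rightarrow> nat"
  assumes f0: "f 0 = id" and step: "\<And>t. t < T \<Longrightarrow> line_step (f t) (f (Suc t))"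
    and fT: "f T k = l" and lk: "l < k" and kn: "k < n"
  obtains b L where "k \<le> b" "crossing_plan k l b L"
    "\<And>c i. c \<in> L \<Longrightarrow> l + cnt L c < i \<Longrightarrow> i < c \<Longrightarrow> i < k \<Longrightarrow> P i l c"
    "\<And>a i. a \<in> {l..b} - L \<Longrightarrow> a < i \<Longrightarrow> k \<le> i \<Longrightarrow> i \<le> a + cnt L b - cnt L a \<Longrightarrow> P i b a"
proof -
  \<comment> \<open>Written as composition with a transposition, a swap visibly preserves
    bijectivity on all naturals, so \<open>f t\<close> can be inverted to give the positions of
    objects.\<close>
  have "\<exists>p. Suc p < n \<and> P p (f t (Suc p)) (f t p) \<and> P (Suc p) (f t p) (f t (Suc p)) \<and>
        f (Suc t) = f t \<circ> transpose p (Suc p)" if "t < T" for t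
    using step[OF that] unfolding line_step_def
    by (force simp: fun_eq_iff transpose_def)
  then obtain e where e: "\<And>t. t < T \<Longrightarrow> Suc (e t) < n"
    "\<And>t. t < T \<Longrightarrow> P (e t) (f t (Suc (e t))) (f t (e t))"
    "\<And>t. t < T \<Longrightarrow> P (Suc (e t)) (f t (e t)) (f t (Suc (e t)))"
    "\<And>t. t < T \<Longrightarrow> f (Suc t) = f t \<circ> transpose (e t) (Suc (e t))"
    by metis
  have bij: "bij (f t)" if "t \<le> T" for t
    using that by (induction t) (auto simp: f0 e(4) intro!: bij_comp)
  define pos where "pos t x = inv (f t) x" for t x
  have pos_f: "pos t x = i \<longleftrightarrow> f t i = x" if "t \<le> T" for t x i
    using bij[OF that] unfolding pos_def by (metis bij_inv_eq_iff)
  have f_pos: "f t (pos t x) = x" if "t \<le> T" for t x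
    using pos_f[OF that] by blast
  have pos0: "pos 0 x = x" for x using pos_f[of 0] by (simp add: f0)
  have pos_Suc: "pos (Suc t) x = transpose (e t) (Suc (e t)) (pos t x)" if "t < T" for t x
    using that by (subst pos_f) (auto simp: e(4) f_pos)
  have pos_inj: "pos t x = pos t y \<longleftrightarrow> x = y" if "t \<le> T" for t x y
    using f_pos[OF that] by metis
  have pos_step: "pos (Suc t) x \<le> Suc (pos t x) \<and> pos t x \<le> Suc (pos (Suc t) x)" if "t < T" for t x
    by (auto simp: pos_Suc[OF that] transpose_def)
  have pos_out: "pos t x = x" if "t \<le> T" "n \<le> x" for t x
    using that(1)
  proof (induction t)
    case (Suc t)
    then show ?case using e(1)[of t] that(2) by (simp add: pos_Suc transpose_def)
  qed (simp add: pos0)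
  have hold: "f t i = f s i \<or> P i (f t i) (f s i)" if "s \<le> t" "t \<le> T" "i < n" for s t i
    using that(1,2)
  proof (induction rule: dec_induct)
    case (step m)
    have "f (Suc m) i = f m i \<or> P i (f (Suc m) i) (f m i)"
      using e(2,3)[of m] step by (auto simp: e(4) transpose_def)
    then show ?case using step P_trans[OF that(3)] by (metis Suc_leD)
  qed simp
  have ivt: "\<exists>u\<ge>s. u \<le> t \<and> f u i = x"
    if "s \<le> t" "t \<le> T" "pos s x \<le> i \<and> i \<le> pos t x \<or> pos t x \<le> i \<and> i \<le> pos s x" for s t x i
  proof -
    have "\<exists>u\<ge>s. u \<le> t \<and> pos u x = i"
      using that pos_step by (intro nat_intermediate_value) auto
    then show ?thesis using pos_f that(2) by (metis le_trans)
  qed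
  \<comment> \<open>Agent \<open>i\<close> can only improve, from \<open>x\<close> to the object
    held at \<open>u\<close> and from there back to \<open>x\<close>; asymmetry excludes a genuine
    change.\<close>
  have convex: "f u i = x" if "f s i = x" "f t i = x" "s \<le> u" "u \<le> t" "t \<le> T" "i < n" for s t u i x
  proof -
    have "f u i = x \<or> P i (f u i) x" "x = f u i \<or> P i x (f u i)"
      using hold[of s u i] hold[of u t i] that by simp_all
    then show ?thesis using P_asym[OF that(6)] by blast
  qed
  define up where "up x t \<longleftrightarrow> (\<forall>s u. s \<le> u \<longrightarrow> u \<le> t \<longrightarrow> pos s x \<le> pos u x)" for x t
  define down where "down x t \<longleftrightarrow> (\<forall>s u. s \<le> u \<longrightarrow> u \<le> t \<longrightarrow> pos u x \<le> pos s x)" for x t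
  \<comment> \<open>Induction on time. If the direction were reversed in the step to
    \<open>Suc t\<close>, the new position \<open>?j\<close> would have been visited earlier by
    \<open>ivt\<close>, so agent \<open>?j\<close> would get back an object it gave away.\<close>
  have updown: "up x t \<or> down x t" if "t \<le> T" for x t
    using that
  proof (induction t)
    case 0
    then show ?case by (auto simp: up_def)
  next
    case (Suc t)
    let ?j = "pos (Suc t) x"
    have noback: "\<not> (s \<le> t \<and> f s ?j = x \<and> ?j \<noteq> pos t x)" for s
    proof
      assume s: "s \<le> t \<and> f s ?j = x \<and> ?j \<noteq> pos t x"
      then have "?j < n" using pos_Suc[of t x] e(1)[of t] Suc.prems by (auto simp: transpose_def split: if_splits)
      then have "f t ?j = x" using convex[of s ?j x "Suc t" t] s f_pos Suc.prems by auto
      then show False using s pos_f[of t x ?j] Suc.prems by simp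
    qed
    have up_Suc: "up x (Suc t)" if "up x t" "pos t x \<le> ?j"
      using that unfolding up_def by (metis le_Suc_eq le_trans order_refl)
    have down_Suc: "down x (Suc t)" if "down x t" "?j \<le> pos t x"
      using that unfolding down_def by (metis le_Suc_eq le_trans order_refl)
    \<comment> \<open>A monotone trajectory that is back at its start is constant, so an object that
      has not yet moved counts as \<open>up\<close> and as \<open>down\<close> and is free to move
      either way.\<close>
    have flat: "pos 0 x = pos t x \<Longrightarrow> up x t \<longleftrightarrow> down x t"
    proof -
      assume flat: "pos 0 x = pos t x"
      have "pos s x = pos t x" if "s \<le> t" "up x t \<or> down x t" for s
        using that flat unfolding up_def down_def by (metis le0 le_antisym order_refl)
      then have eq: "pos s x = pos u x" if "s \<le> u" "u \<le> t" "up x t \<or> down x t" for s u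
        using that le_trans by metis
      show "up x t \<longleftrightarrow> down x t"
      proof
        assume "up x t"
        then have "pos u x \<le> pos s x" if "s \<le> u" "u \<le> t" for s u using eq[OF that] by simp
        then show "down x t" unfolding down_def by blast
      next
        assume "down x t"
        then have "pos s x \<le> pos u x" if "s \<le> u" "u \<le> t" for s u using eq[OF that] by simp
        then show "up x t" unfolding up_def by blast
      qed
    qed
    consider "?j = pos t x" | "?j < pos t x" | "pos t x < ?j" by linarith
    then show ?case
    proof cases
      case 1
      then show ?thesis using Suc up_Suc down_Suc by auto
    next
      case 2
      have "down x t"
      proof (rule ccontr)
        assume "\<not> down x t"
        then have "up x t" "pos 0 x \<noteq> pos t x" using Suc flat by auto
        then have "pos 0 x < pos t x" unfolding up_def by (simp add: order.strict_iff_order)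
        then have "pos 0 x \<le> ?j" "?j \<le> pos t x" using pos_step[of t x] 2 Suc.prems by auto
        then obtain u where "u \<le> t" "f u ?j = x" using ivt[of 0 t x ?j] Suc.prems by auto
        then show False using noback[of u] 2 by auto
      qed
      then show ?thesis using down_Suc 2 by auto
    next
      case 3
      have "up x t"
      proof (rule ccontr)
        assume "\<not> up x t"
        then have "down x t" "pos 0 x \<noteq> pos t x" using Suc flat by auto
        then have "pos t x < pos 0 x" unfolding down_def by (simp add: order.strict_iff_order)
        then have "?j \<le> pos 0 x" "pos t x \<le> ?j" using pos_step[of t x] 3 Suc.prems by auto
        then obtain u where "u \<le> t" "f u ?j = x" using ivt[of 0 t x ?j] Suc.prems by auto
        then show False using noback[of u] 3 by auto
      qed
      then show ?thesis using up_Suc 3 by auto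
    qed
  qed
  \<comment> \<open>Two objects can pass each other only if the left one moves right and the right
    one moves left; the disjunction in the assumptions excludes this.\<close>
  have keep: "pos t x < pos t y" if "x < y" "up y T \<or> down x T" "t \<le> T" for t x y
    using that(3)
  proof (induction t)
    case 0
    then show ?case using that by (simp add: pos0)
  next
    case (Suc t)
    then have lt: "pos t x < pos t y" by simp
    have "pos t y \<le> pos (Suc t) y \<or> pos (Suc t) x \<le> pos t x"
      using that(2) Suc.prems unfolding up_def down_def by (meson le_Suc_eq order_refl)
    moreover have "pos (Suc t) x \<noteq> pos (Suc t) y" using pos_inj[of "Suc t"] Suc.prems that by auto
    ultimately show ?case using lt Suc.prems by (auto simp: pos_Suc transpose_def split: if_splits)
  qed
  have posT: "pos T l = k" using pos_f[of T] fT by simp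
  have "\<not> down l T" using posT lk pos0 unfolding down_def by (metis le0 not_le order_refl)
  then have upl: "up l T" using updown[of T l] by simp
  define L where "L = {c. l < c \<and> pos T c < k}"
  have Ldown: "down c T" if "c \<in> L" for c
  proof -
    have "\<not> up c T" using keep[of l c T] that posT by (auto simp: L_def)
    then show ?thesis using updown[of T c] by simp
  qed
  have Ln: "c < n" if "c \<in> L" for c
  proof (rule ccontr)
    assume "\<not> c < n"
    then show False using that pos_out[of T c] kn by (simp add: L_def)
  qed
  have finL: "finite L" by (rule finite_subset[of _ "{..<n}"]) (use Ln in auto)
  \<comment> \<open>At any time exactly \<open>p\<close> objects are left of position
    \<open>p\<close>. This turns the order information from \<open>keep\<close> into exact
    positions.\<close>
  have card_pos: "card {x. pos t x < p} = p" if "t \<le> T" for t p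
  proof -
    have "{x. pos t x < p} = f t ` {..<p}"
    proof (intro set_eqI iffI)
      fix x assume "x \<in> {x. pos t x < p}"
      then show "x \<in> f t ` {..<p}" using f_pos[OF that, of x] by (intro image_eqI[of _ _ "pos t x"]) auto
    next
      fix x assume "x \<in> f t ` {..<p}"
      then obtain i where "i < p" "f t i = x" by auto
      then show "x \<in> {x. pos t x < p}" using pos_f[OF that, of x i] by simp
    qed
    moreover have "inj_on (f t) {..<p}" using bij[OF that] by (metis bij_def inj_on_subset top_greatest)
    ultimately show ?thesis by (simp add: card_image)
  qed
  have "{x. pos T x < k} = {..<l} \<union> L"
  proof -
    have "pos T x < k" if "x < l" for x using keep[of x l T] that upl posT by auto
    then show ?thesis using posT by (auto simp: L_def) (metis linorder_neqE_nat less_irrefl)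
  qed
  moreover have "{..<l} \<inter> L = {}" by (auto simp: L_def)
  ultimately have kL: "k = l + card L"
    using card_pos[of T k] finL by (simp add: card_Un_disjoint)
  then have "L \<noteq> {}" using lk by auto
  define b where "b = Max L"
  have bL: "b \<in> L" using finL \<open>L \<noteq> {}\<close> by (simp add: b_def)
  have Lsub: "L \<subseteq> {l<..b}" using finL by (auto simp: b_def L_def)
  have "card L \<le> card {l<..b}" using Lsub by (intro card_mono) auto
  then have kb: "k \<le> b" using kL bL Lsub by auto
  \<comment> \<open>Such an object ends at \<open>k\<close> or beyond, whereas \<open>b\<close> ends
    left of \<open>k\<close>. Starting left of \<open>b\<close>, it has to pass \<open>b\<close> and
    hence cannot be moving left.\<close>
  have Rup: "up a T" if a: "a \<in> {l..b} - L" for a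
  proof (cases "a = l")
    case False
    then have "a < b" "l < a" "k \<le> pos T a" using a bL by (auto simp: L_def le_less)
    moreover have "pos T b < k" using bL by (simp add: L_def)
    ultimately have "\<not> down a T" using keep[of a b T] by auto
    then show ?thesis using updown[of T a] by simp
  qed (use upl in simp)
  have Rpos: "k \<le> pos T a" if a: "a \<in> {l..b} - L" for a
    using a posT by (cases "a = l") (auto simp: L_def)
  have crossing: "\<exists>t<T. pos t a = a + cnt L c - cnt L a \<and> pos t c = Suc (a + cnt L c - cnt L a) \<and>
      crossing_ok (a + cnt L c - cnt L a) a c"
    if a: "a \<in> {l..b} - L" and c: "c \<in> L" and ac: "a < c" for a c
  proof -
    have "pos T c < pos T a" using Rpos[OF a] c by (simp add: L_def)
    moreover have "pos 0 a < pos 0 c" using ac pos0 by simp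
    ultimately have "\<exists>t<T. pos t a < pos t c \<and> \<not> pos (Suc t) a < pos (Suc t) c"
      using inc_induct[of 0 T "\<lambda>t. \<not> pos t a < pos t c"] by (meson le0 not_less_iff_gr_or_eq)
    then obtain t where t: "t < T" "pos t a < pos t c" "\<not> pos (Suc t) a < pos (Suc t) c" by blast
    then have pt: "pos t a = e t" "pos t c = Suc (e t)"
      by (auto simp: pos_Suc transpose_def split: if_splits)
    have "f t (e t) = a" "f t (Suc (e t)) = c" using pt f_pos[of t] t(1) by (metis less_imp_le)+
    then have ok: "crossing_ok (e t) a c" using e(2,3)[OF t(1)] by (simp add: crossing_ok_def)
    have tT: "t \<le> T" using t(1) by simp
    \<comment> \<open>Objects below \<open>a\<close> never overtake \<open>a\<close>, which moves
      right; left movers between \<open>a\<close> and \<open>c\<close> stay left of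
      \<open>c\<close>. Right movers in between stay right of \<open>a\<close>, and objects beyond
      \<open>c\<close> stay right of \<open>c\<close>, which moves left.\<close>
    have "{x. pos t x < e t} = {..<a} \<union> (L \<inter> {Suc a..<c})"
    proof (intro set_eqI)
      fix x
      consider "x < a" | "x = a" | "a < x" "x < c" "x \<in> L" | "a < x" "x < c" "x \<notin> L" | "x = c" | "c < x"
        by linarith
      then show "x \<in> {x. pos t x < e t} \<longleftrightarrow> x \<in> {..<a} \<union> (L \<inter> {Suc a..<c})"
      proof cases
        case 1
        then show ?thesis using keep[of x a t] Rup[OF a] tT pt by auto
      next
        case 2
        then show ?thesis using pt by auto
      next
        case 3
        then have "pos t x < Suc (e t)" using keep[of x c t] Ldown tT pt by auto
        moreover have "pos t x \<noteq> e t" using 3 pos_inj[OF tT, of x a] pt by auto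
        ultimately show ?thesis using 3 by auto
      next
        case 4
        then have "x \<in> {l..b} - L" using a c Lsub by auto
        then have "pos t a < pos t x" using keep[of a x t] Rup 4 tT by auto
        then show ?thesis using 4 pt by auto
      next
        case 5
        then show ?thesis using pt ac by auto
      next
        case 6
        then show ?thesis using keep[of c x t] Ldown[OF c] tT pt ac by auto
      qed
    qed
    then have "e t = card ({..<a} \<union> (L \<inter> {Suc a..<c}))" using card_pos[OF tT, of "e t"] by simp
    also have "\<dots> = a + card (L \<inter> {Suc a..<c})" by (subst card_Un_disjoint) auto
    also have "\<dots> = a + cnt L c - cnt L a"
      using card_between[of "Suc a" c L] a ac cnt_mono[of a c L] by (simp add: cnt_Suc)
    finally show ?thesis using ok pt t(1) by auto
  qed
  have cntl: "cnt L l = 0" using Lsub by (auto simp: cnt_def)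
  have lR: "l \<in> {l..b} - L" using Lsub kb lk by auto
  show thesis
  proof (rule that[OF kb])
    show "crossing_plan k l b L"
      unfolding crossing_plan_def using Ln[OF bL] Lsub bL kL crossing by blast
  next
    fix c i
    assume c: "c \<in> L" and i: "l + cnt L c < i" "i < c" "i < k"
    have "l < c" using c by (simp add: L_def)
    then obtain t where t: "t < T" "pos t l = l + cnt L c" "pos t c = Suc (l + cnt L c)"
      using crossing[OF lR c] cntl by auto
    \<comment> \<open>Agent \<open>i\<close> holds \<open>c\<close> before the crossing with
      \<open>l\<close>, and afterwards holds \<open>l\<close> on its way to \<open>k\<close>; the
      second visit relies on \<open>i < k\<close>.\<close>
    obtain u where u: "u \<le> t" "f u i = c" using ivt[of 0 t c i] t i by (auto simp: pos0)
    obtain v where v: "t \<le> v" "v \<le> T" "f v i = l" using ivt[of t T l i] t i by (auto simp: posT)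
    have "f v i = f u i \<or> P i (f v i) (f u i)" by (rule hold) (use u v i kn in auto)
    then show "P i l c" using u v \<open>l < c\<close> by auto
  next
    fix a i
    assume a: "a \<in> {l..b} - L" and i: "a < i" "k \<le> i" "i \<le> a + cnt L b - cnt L a"
    have ab: "a < b" using a bL by (auto simp: le_less)
    obtain t where t: "t < T" "pos t a = a + cnt L b - cnt L a" "pos t b = Suc (a + cnt L b - cnt L a)"
      using crossing[OF a bL ab] by auto
    have pTb: "pos T b < k" using bL by (simp add: L_def)
    \<comment> \<open>The mirror image: \<open>i\<close> holds \<open>a\<close> before the crossing
      with \<open>b\<close>, and afterwards \<open>b\<close> passes \<open>i\<close> because it ends
      left of \<open>k \<le> i\<close>.\<close>
    obtain u where u: "u \<le> t" "f u i = a" using ivt[of 0 t a i] t i by (auto simp: pos0)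
    obtain v where v: "t \<le> v" "v \<le> T" "f v i = b" using ivt[of t T b i] t i pTb by auto
    have "i < n"
    proof (rule ccontr)
      assume "\<not> i < n"
      then have "pos v i = i" using pos_out[of v i] v by simp
      then have "f v i = i" using pos_f[of v i i] v by simp
      then show False using v Ln[OF bL] \<open>\<not> i < n\<close> by simp
    qed
    then have "f v i = f u i \<or> P i (f v i) (f u i)" using u v by (intro hold) auto
    then show "P i b a" using u v ab by auto
  qed
qed

end

text \<open>Pigeonhole from both sides: elements below \<open>x\<close> need distinct values in
  \<open>{u..<g x}\<close>, the others in \<open>{g x..<v}\<close>. Without slack in total, both
  bounds are tight.\<close>

lemma strict_mono_counting:
  fixes g :: "nat \<Rightarrow> nat"
  assumes mono: "\<And>x y. x \<in> S \<Longrightarrow> y \<in> S \<Longrightarrow> x < y \<Longrightarrow> g x < g y"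
    and range: "g ` S \<subseteq> {u..<v}" and fin: "finite S"
  shows "card S \<le> v - u" and "card S = v - u \<Longrightarrow> x \<in> S \<Longrightarrow> g x = u + cnt S x"
proof -
  have inj: "inj_on g S" using mono by (intro inj_onI) (metis linorder_neqE_nat less_irrefl)
  then show "card S \<le> v - u" using card_inj_on_le[OF inj range] by simp
  assume c: "card S = v - u" and x: "x \<in> S"
  have "g ` (S \<inter> {..<x}) \<subseteq> {u..<g x}" using mono range x by auto
  then have "cnt S x \<le> g x - u"
    using card_inj_on_le[of g "S \<inter> {..<x}" "{u..<g x}"] inj_on_subset[OF inj] by (auto simp: cnt_def)
  moreover have "g ` (S - {..<x}) \<subseteq> {g x..<v}"
  proof (intro image_subsetI)
    fix y assume y: "y \<in> S - {..<x}"
    then have "g x \<le> g y" using mono[of x y] x by (cases "y = x") auto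
    then show "g y \<in> {g x..<v}" using y range by auto
  qed
  then have "card (S - {..<x}) \<le> v - g x"
    using card_inj_on_le[of g "S - {..<x}" "{g x..<v}"] inj_on_subset[OF inj] by auto
  moreover have "card (S - {..<x}) = card S - cnt S x" "cnt S x \<le> card S"
    using fin by (auto simp: cnt_def card_Diff_subset_Int intro!: card_mono)
  moreover have "u \<le> g x" "g x < v" using range x by auto
  ultimately show "g x = u + cnt S x" using c by linarith
qed

section \<open>Forced final positions and the choice of directions\<close>

context line_market begin

text \<open>The only final position that the preferences leave for an object moving left (right); the
  defaults \<open>k\<close> and \<open>0\<close>, returned if there is none, violate the unary constraints in
  \<open>direction_choice\<close>.\<close>

definition left_goal :: "nat \<Rightarrow> nat \<Rightarrow> nat \<Rightarrow> nat" where
  "left_goal k l c = (let I = {i. l \<le> i \<and> i < c \<and> i < k \<and> P i c l} in if I = {} then k else Max I)"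

definition right_goal :: "nat \<Rightarrow> nat \<Rightarrow> nat \<Rightarrow> nat" where
  "right_goal k b a = (let I = {i. a < i \<and> k \<le> i \<and> i \<le> b \<and> P i a b} in if I = {} then 0 else Min I)"

text \<open>\<open>A c\<close> says that \<open>c\<close> moves left. In the last clause the sum of
  the goals minus \<open>k\<close> is the crossing edge; the subtraction is exact, since the unary
  part makes the right goal at least \<open>k\<close>.\<close>

definition direction_choice :: "nat \<Rightarrow> nat \<Rightarrow> nat \<Rightarrow> (nat \<Rightarrow> bool) \<Rightarrow> bool" where
  "direction_choice k l b A \<longleftrightarrow>
     (\<forall>c\<in>{l..b}. (A c \<longrightarrow> left_goal k l c < k) \<and> (\<not> A c \<longrightarrow> k \<le> right_goal k b c)) \<and>
     (\<forall>c\<in>{l..b}. \<forall>d\<in>{l..b}. c < d \<longrightarrow>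
        (A c \<and> A d \<longrightarrow> left_goal k l c < left_goal k l d) \<and>
        (\<not> A c \<and> \<not> A d \<longrightarrow> right_goal k b c < right_goal k b d) \<and>
        (\<not> A c \<and> A d \<longrightarrow> crossing_ok (left_goal k l d + right_goal k b c - k) c d))"

lemma left_goal_eqI:
  assumes "l \<le> i" "i < c" "i < k" "P i c l" "\<And>j. i < j \<Longrightarrow> j < c \<Longrightarrow> j < k \<Longrightarrow> \<not> P j c l"
  shows "left_goal k l c = i"
proof -
  have "Max {i. l \<le> i \<and> i < c \<and> i < k \<and> P i c l} = i"
    using assms by (intro Max_eqI) (auto simp: not_less[symmetric])
  moreover have "i \<in> {i. l \<le> i \<and> i < c \<and> i < k \<and> P i c l}" using assms by simp
  ultimately show ?thesis unfolding left_goal_def Let_def by (metis empty_iff)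
qed

lemma right_goal_eqI:
  assumes "a < i" "k \<le> i" "i \<le> b" "P i a b" "\<And>j. a < j \<Longrightarrow> k \<le> j \<Longrightarrow> j < i \<Longrightarrow> \<not> P j a b"
  shows "right_goal k b a = i"
proof -
  have "finite {i. a < i \<and> k \<le> i \<and> i \<le> b \<and> P i a b}"
    by (rule finite_subset[of _ "{..b}"]) auto
  then have "Min {i. a < i \<and> k \<le> i \<and> i \<le> b \<and> P i a b} = i"
    using assms by (intro Min_eqI) (auto simp: not_less[symmetric])
  moreover have "i \<in> {i. a < i \<and> k \<le> i \<and> i \<le> b \<and> P i a b}" using assms by simp
  ultimately show ?thesis unfolding right_goal_def Let_def by (metis empty_iff)
qed

lemma left_goal_range: "left_goal k l c < k \<Longrightarrow> l \<le> left_goal k l c \<and> left_goal k l c < c"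
proof -
  let ?I = "{i. l \<le> i \<and> i < c \<and> i < k \<and> P i c l}"
  assume *: "left_goal k l c < k"
  then have I: "?I \<noteq> {}" unfolding left_goal_def Let_def by (rule_tac notI) (simp only: simp_thms if_True less_irrefl)
  then have "Max ?I \<in> ?I" by (intro Max_in) auto
  moreover have "left_goal k l c = Max ?I" using I unfolding left_goal_def Let_def by metis
  ultimately show ?thesis by simp
qed

lemma right_goal_range: "0 < right_goal k b a \<Longrightarrow> a < right_goal k b a \<and> right_goal k b a \<le> b"
proof -
  let ?I = "{i. a < i \<and> k \<le> i \<and> i \<le> b \<and> P i a b}"
  assume *: "0 < right_goal k b a"
  then have I: "?I \<noteq> {}" unfolding right_goal_def Let_def by (rule_tac notI) (simp only: simp_thms if_True less_irrefl)
  moreover have "finite ?I" by (rule finite_subset[of _ "{..b}"]) auto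
  ultimately have "Min ?I \<in> ?I" by (intro Min_in)
  moreover have "right_goal k b a = Min ?I" using I unfolding right_goal_def Let_def by metis
  ultimately show ?thesis by simp
qed

text \<open>Both goal maps are injective into ranges whose sizes add up to the number of objects, so they
  are onto and give the ranks of the objects among the left and right movers.\<close>

lemma direction_choice_crossing_plan:
  assumes "l < k" "k \<le> b" "b < n" and ch: "direction_choice k l b A"
  shows "crossing_plan k l b {c \<in> {l..b}. A c}"
proof -
  define L where "L = {c \<in> {l..b}. A c}"
  define R where "R = {l..b} - L"
  let ?q = "left_goal k l" and ?s = "right_goal k b"
  have unary: "\<And>c. c \<in> L \<Longrightarrow> ?q c < k" "\<And>a. a \<in> R \<Longrightarrow> k \<le> ?s a"
    and binary: "\<And>c d. c \<in> L \<Longrightarrow> d \<in> L \<Longrightarrow> c < d \<Longrightarrow> ?q c < ?q d"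
      "\<And>c d. c \<in> R \<Longrightarrow> d \<in> R \<Longrightarrow> c < d \<Longrightarrow> ?s c < ?s d"
      "\<And>a c. a \<in> R \<Longrightarrow> c \<in> L \<Longrightarrow> a < c \<Longrightarrow> crossing_ok (?q c + ?s a - k) a c"
    using ch by (auto simp: direction_choice_def L_def R_def)
  have "finite L" "finite R" by (auto simp: L_def R_def)
  have "b \<in> {l..b}" "l \<in> {l..b}" using assms by auto
  \<comment> \<open>A right goal of \<open>b\<close> would have to be both above \<open>b\<close>
    and at most \<open>b\<close>, so the unary constraint forces \<open>b\<close> to move left;
    similarly \<open>l\<close> must move right.\<close>
  have "b \<notin> R" using unary(2)[of b] right_goal_range[of k b b] assms by auto
  then have "b \<in> L" using \<open>b \<in> {l..b}\<close> by (auto simp: R_def)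
  have "l \<notin> L" using unary(1)[of l] left_goal_range[of k l l] by auto
  have qr: "?q ` L \<subseteq> {l..<k}" using unary(1) left_goal_range by auto
  have sr: "?s ` R \<subseteq> {k..<Suc b}"
  proof (intro image_subsetI)
    fix a assume "a \<in> R"
    then have "k \<le> ?s a" by (rule unary)
    then show "?s a \<in> {k..<Suc b}" using right_goal_range[of k b a] assms by auto
  qed
  have q: "card L \<le> k - l" "card L = k - l \<Longrightarrow> c \<in> L \<Longrightarrow> ?q c = l + cnt L c" for c
    by (rule strict_mono_counting[of L ?q]; use binary(1) qr \<open>finite L\<close> in blast)+
  have s: "card R \<le> Suc b - k" "card R = Suc b - k \<Longrightarrow> a \<in> R \<Longrightarrow> ?s a = k + cnt R a" for a
    by (rule strict_mono_counting[of R ?s]; use binary(2) sr \<open>finite R\<close> in blast)+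
  have "L \<subseteq> {l..b}" by (auto simp: L_def)
  then have "card R = Suc b - l - card L" "card L \<le> Suc b - l"
    using card_mono[of "{l..b}" L] \<open>finite L\<close> unfolding R_def by (simp_all add: card_Diff_subset)
  then have cards: "card L = k - l" "card R = Suc b - k" using q(1) s(1) assms by auto
  have "L \<subseteq> {l<..b}" using \<open>l \<notin> L\<close> by (auto simp: L_def le_less)
  moreover have "crossing_ok (a + cnt L c - cnt L a) a c" if a: "a \<in> {l..b} - L" and c: "c \<in> L" and ac: "a < c" for a c
  proof -
    have aR: "a \<in> R" using a by (simp add: R_def)
    have "cnt R a = a - l - cnt L a" unfolding R_def
      by (rule cnt_Diff_interval) (use a in \<open>auto simp: L_def\<close>)
    moreover have "cnt L l = 0" by (auto simp: cnt_def L_def)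
    then have "cnt L a \<le> a - l" using cnt_le_add[of l a L] a by simp
    \<comment> \<open>Expressing the rank of \<open>a\<close> among the right movers through
      \<open>cnt L a\<close> turns the edge given by the goals into the one used in
      \<open>crossing_plan\<close>.\<close>
    ultimately have "?q c + ?s a - k = a + cnt L c - cnt L a"
      using q(2)[OF cards(1) c] s(2)[OF cards(2) aR] assms a by auto
    then show ?thesis using binary(3)[OF aR c ac] by simp
  qed
  ultimately have "crossing_plan k l b L"
    unfolding crossing_plan_def using assms \<open>b \<in> L\<close> cards by auto
  then show ?thesis by (simp add: L_def)
qed

text \<open>Backwards, a choice yields an executable plan. Forwards, the positions after the last
  crossings of an extracted plan are the goals: consent to the crossing makes them candidates, and
  the preferences of the agents passed before make them extremal.\<close>

theorem line_reachable_iff_direction_choice: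
  assumes lk: "l < k" and kn: "k < n"
  shows "line_reachable k l \<longleftrightarrow> (\<exists>b A. k \<le> b \<and> b < n \<and> direction_choice k l b A)"
proof
  assume "\<exists>b A. k \<le> b \<and> b < n \<and> direction_choice k l b A"
  then show "line_reachable k l"
    using direction_choice_crossing_plan[OF lk] crossing_plan_execute by blast
next
  assume "line_reachable k l"
  then obtain \<sigma> where \<sigma>: "line_step\<^sup>*\<^sup>* id \<sigma>" "\<sigma> k = l" by (auto simp: line_reachable_def)
  then obtain T where "(line_step ^^ T) id \<sigma>" by (auto simp: rtranclp_power)
  then obtain f where "f 0 = id" "f T = \<sigma>" "\<And>t. t < T \<Longrightarrow> line_step (f t) (f (Suc t))"
    by (auto simp: relpowp_fun_conv)
  then obtain b L where kb: "k \<le> b" and plan: "crossing_plan k l b L"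
    and q_max: "\<And>c i. c \<in> L \<Longrightarrow> l + cnt L c < i \<Longrightarrow> i < c \<Longrightarrow> i < k \<Longrightarrow> P i l c"
    and s_min: "\<And>a i. a \<in> {l..b} - L \<Longrightarrow> a < i \<Longrightarrow> k \<le> i \<Longrightarrow> i \<le> a + cnt L b - cnt L a \<Longrightarrow> P i b a"
    using run_crossing_plan[of f T k l] \<sigma>(2) lk kn by metis
  from plan have b: "b < n" "L \<subseteq> {l<..b}" "b \<in> L" "k = l + card L"
    and ok: "\<And>a c. a \<in> {l..b} - L \<Longrightarrow> c \<in> L \<Longrightarrow> a < c \<Longrightarrow> crossing_ok (a + cnt L c - cnt L a) a c"
    by (auto simp: crossing_plan_def)
  have "finite L" using b(2) finite_subset by blast
  have cnt0: "cnt L l = 0" using b(2) by (auto simp: cnt_def)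
  have "L \<inter> {..<Suc b} = L" using b(2) by auto
  \<comment> \<open>\<open>b\<close> is the largest element of \<open>L\<close>, so
    \<open>cnt L b\<close> misses exactly \<open>b\<close> itself.\<close>
  then have cntb: "k = l + cnt L b + 1" using b(3,4) cnt_Suc[of L b] by (simp add: cnt_def)
  have lR: "l \<in> {l..b} - L" using b lk kb by auto
  have q: "left_goal k l c = l + cnt L c" if c: "c \<in> L" for c
  proof (rule left_goal_eqI)
    have lc: "l < c" "c \<le> b" using b(2) c by auto
    then show "l + cnt L c < c" using cnt_less_add[of l L c] cnt0 lR by auto
    show "l + cnt L c < k" using cntb cnt_mono[OF lc(2), of L] by simp
    show "P (l + cnt L c) c l" using ok[OF lR c lc(1)] cnt0 by (simp add: crossing_ok_def)
    show "\<not> P j c l" if "l + cnt L c < j" "j < c" "j < k" for j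
      using q_max[OF c that] P_asym that kn by auto
  qed simp
  have s: "right_goal k b a = Suc (a + cnt L b - cnt L a)" if a: "a \<in> {l..b} - L" for a
  proof (rule right_goal_eqI)
    have ab: "a < b" using a b(3) by (auto simp: le_less)
    have le: "cnt L a \<le> cnt L b" using ab by (intro cnt_mono) simp
    then show "a < Suc (a + cnt L b - cnt L a)" by simp
    show "Suc (a + cnt L b - cnt L a) \<le> b" using cnt_less_add[of a L b] a ab le by auto
    have "cnt L a \<le> a - l" using cnt_le_add[of l a L] cnt0 a by simp
    then show "k \<le> Suc (a + cnt L b - cnt L a)" using cntb a by auto
    show "P (Suc (a + cnt L b - cnt L a)) a b" using ok[OF a b(3) ab] by (simp add: crossing_ok_def)
    show "\<not> P j a b" if "a < j" "k \<le> j" "j < Suc (a + cnt L b - cnt L a)" for j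
      using s_min[OF a that(1,2)] that P_asym[of j b a] \<open>Suc (a + cnt L b - cnt L a) \<le> b\<close> b(1) by auto
  qed
  have "direction_choice k l b (\<lambda>c. c \<in> L)"
    unfolding direction_choice_def
  proof (intro conjI ballI impI)
    fix c assume "c \<in> {l..b}" "c \<in> L"
    then show "left_goal k l c < k" using q cntb cnt_mono[of c b L] by auto
  next
    fix a assume "a \<in> {l..b}" "a \<notin> L"
    then show "k \<le> right_goal k b a"
      using s[of a] cntb cnt_le_add[of l a L] cnt0 cnt_mono[of a b L] by auto
  next
    fix c d assume "c < d" "c \<in> L \<and> d \<in> L"
    then show "left_goal k l c < left_goal k l d" using q cnt_less[of c L d] by auto
  next
    fix c d assume *: "c \<in> {l..b}" "d \<in> {l..b}" "c < d" "c \<notin> L \<and> d \<notin> L"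
    then have "right_goal k b c = Suc (c + cnt L b - cnt L c)" "right_goal k b d = Suc (d + cnt L b - cnt L d)"
      by (auto intro!: s)
    then show "right_goal k b c < right_goal k b d"
      using * cnt_less_add[of c L d] cnt_mono[of d b L] cnt_mono[of c d L] by auto
  next
    fix c d assume *: "c \<in> {l..b}" "d \<in> {l..b}" "c < d" "c \<notin> L \<and> d \<in> L"
    then have "right_goal k b c = Suc (c + cnt L b - cnt L c)" "left_goal k l d = l + cnt L d"
      using q s by auto
    then have "left_goal k l d + right_goal k b c - k = c + cnt L d - cnt L c"
      using cntb cnt_mono[of c d L] cnt_mono[of c b L] * by auto
    then show "crossing_ok (left_goal k l d + right_goal k b c - k) c d" using ok * by simp
  qed
  then show "\<exists>b A. k \<le> b \<and> b < n \<and> direction_choice k l b A" using kb b(1) by blast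
qed

end

subsection \<open>Two-satisfiability\<close>

text \<open>The literals over the variables \<open>0, \<dots>, n - 1\<close> are \<open>v\<close> (positive) and \<open>n + v\<close> (negative).\<close>

definition neg_lit :: "nat \<Rightarrow> nat \<Rightarrow> nat" where
  "neg_lit n u = (if u < n then n + u else u - n)"

definition lit_true :: "nat \<Rightarrow> (nat \<Rightarrow> bool) \<Rightarrow> nat \<Rightarrow> bool" where
  "lit_true n A u = (if u < n then A u else \<not> A (u - n))"

lemma neg_lit_simps [simp]:
  "u < 2 * n \<Longrightarrow> neg_lit n (neg_lit n u) = u" "u < 2 * n \<Longrightarrow> neg_lit n u < 2 * n"
  "u < 2 * n \<Longrightarrow> neg_lit n u \<noteq> u"
  "u < 2 * n \<Longrightarrow> lit_true n A (neg_lit n u) \<longleftrightarrow> \<not> lit_true n A u"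
  by (auto simp: neg_lit_def lit_true_def)

text \<open>For satisfiability, take a maximal consistent set of literals closed under implication.
  If a variable were unset, one of its two literals would not reach its negation, and adding
  everything implied by that literal would stay consistent by contraposition
  (\<open>skew\<close>).\<close>

theorem two_sat:
  assumes E: "E \<subseteq> {..<2 * n} \<times> {..<2 * n}"
    and skew: "\<And>u v. (u, v) \<in> E \<Longrightarrow> (neg_lit n v, neg_lit n u) \<in> E"
  shows "(\<exists>A. \<forall>(u, v)\<in>E. lit_true n A u \<longrightarrow> lit_true n A v) \<longleftrightarrow>
    \<not> (\<exists>u<n. (u, n + u) \<in> E\<^sup>+ \<and> (n + u, u) \<in> E\<^sup>+)"
proof
  assume "\<exists>A. \<forall>(u, v)\<in>E. lit_true n A u \<longrightarrow> lit_true n A v"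
  then obtain A where A: "\<And>u v. (u, v) \<in> E \<Longrightarrow> lit_true n A u \<Longrightarrow> lit_true n A v" by blast
  have imp: "lit_true n A u \<longrightarrow> lit_true n A v" if "(u, v) \<in> E\<^sup>+" for u v
    using that by induction (use A in blast)+
  show "\<not> (\<exists>u<n. (u, n + u) \<in> E\<^sup>+ \<and> (n + u, u) \<in> E\<^sup>+)"
  proof
    assume "\<exists>u<n. (u, n + u) \<in> E\<^sup>+ \<and> (n + u, u) \<in> E\<^sup>+"
    then obtain u where "u < n" "(u, n + u) \<in> E\<^sup>+" "(n + u, u) \<in> E\<^sup>+" by blast
    then show False using imp[of u "n + u"] imp[of "n + u" u] by (simp add: lit_true_def)
  qed
next
  assume ncyc: "\<not> (\<exists>u<n. (u, n + u) \<in> E\<^sup>+ \<and> (n + u, u) \<in> E\<^sup>+)"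
  have skew': "(neg_lit n v, neg_lit n u) \<in> E\<^sup>*" if "(u, v) \<in> E\<^sup>*" for u v
    using that by induction (auto intro: skew converse_rtrancl_into_rtrancl)
  have in_lits: "v < 2 * n" if "(u, v) \<in> E\<^sup>*" "u < 2 * n" for u v
    using that by induction (use E in auto)
  have ncyc': "\<not> ((u, neg_lit n u) \<in> E\<^sup>* \<and> (neg_lit n u, u) \<in> E\<^sup>*)" if "u < 2 * n" for u
  proof
    assume *: "(u, neg_lit n u) \<in> E\<^sup>* \<and> (neg_lit n u, u) \<in> E\<^sup>*"
    then have "(u, neg_lit n u) \<in> E\<^sup>+ \<and> (neg_lit n u, u) \<in> E\<^sup>+"
      using that by (metis neg_lit_simps(3) rtranclD)
    moreover have "\<exists>v<n. u = v \<and> neg_lit n u = n + v \<or> u = n + v \<and> neg_lit n u = v"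
      using that by (intro exI[of _ "if u < n then u else u - n"]) (auto simp: neg_lit_def)
    ultimately show False using ncyc by auto
  qed
  define ok where "ok S \<longleftrightarrow> S \<subseteq> {..<2 * n} \<and> E `` S \<subseteq> S \<and> (\<forall>u\<in>S. neg_lit n u \<notin> S)" for S
  have "finite {S. ok S}" by (rule finite_subset[of _ "Pow {..<2 * n}"]) (auto simp: ok_def)
  moreover have "ok {}" by (simp add: ok_def)
  ultimately obtain S where S: "ok S" and max: "\<And>S'. ok S' \<Longrightarrow> S \<subseteq> S' \<Longrightarrow> S' = S"
    using finite_has_maximal[of "{S. ok S}"] by auto
  have closed: "v \<in> S" if "(u, v) \<in> E\<^sup>*" "u \<in> S" for u v
    using that by induction (use S in \<open>auto simp: ok_def\<close>)
  have total: "u \<in> S \<or> neg_lit n u \<in> S" if u: "u < 2 * n" for u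
  proof (rule ccontr)
    assume unset: "\<not> (u \<in> S \<or> neg_lit n u \<in> S)"
    obtain x where x: "x < 2 * n" "x \<notin> S" "neg_lit n x \<notin> S" "(x, neg_lit n x) \<notin> E\<^sup>*"
      using ncyc'[OF u] unset u by (metis neg_lit_simps(1,2))
    let ?S = "S \<union> E\<^sup>* `` {x}"
    have "ok ?S"
      unfolding ok_def
    proof (intro conjI ballI)
      show "?S \<subseteq> {..<2 * n}" using S x in_lits by (auto simp: ok_def)
      show "E `` ?S \<subseteq> ?S" using S by (auto simp: ok_def intro: rtrancl_into_rtrancl)
      fix y assume y: "y \<in> ?S"
      have y2: "y < 2 * n" using y S x in_lits by (auto simp: ok_def)
      show "neg_lit n y \<notin> ?S"
      proof
        assume ny: "neg_lit n y \<in> ?S"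
        \<comment> \<open>If \<open>x\<close> implied the negation of a literal in \<open>S\<close>,
          then that literal would imply the negation of \<open>x\<close>, which would then belong to
          the closed set \<open>S\<close>.\<close>
        have conflict: False if "z \<in> S" "(x, neg_lit n z) \<in> E\<^sup>*" "z < 2 * n" for z
          using skew'[OF that(2)] closed[of z "neg_lit n x"] that x by simp
        consider "y \<in> S" "neg_lit n y \<in> S" | "y \<in> S" "(x, neg_lit n y) \<in> E\<^sup>*"
          | "(x, y) \<in> E\<^sup>*" "neg_lit n y \<in> S" | "(x, y) \<in> E\<^sup>*" "(x, neg_lit n y) \<in> E\<^sup>*"
          using y ny by auto
        then show False
        proof cases
          case 1
          then show ?thesis using S by (auto simp: ok_def)
        next
          case 2
          then show ?thesis using conflict y2 by blast
        next
          case 3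
          then show ?thesis using conflict[of "neg_lit n y"] y2 by simp
        next
          case 4
          have "(y, neg_lit n x) \<in> E\<^sup>*" using skew'[OF 4(2)] y2 by simp
          then show ?thesis using 4(1) x(4) by (meson rtrancl_trans)
        qed
      qed
    qed
    then have "?S = S" by (rule max) simp
    then show False using x(2) by auto
  qed
  have lit: "lit_true n (\<lambda>v. v \<in> S) u \<longleftrightarrow> u \<in> S" if "u < 2 * n" for u
  proof (cases "u < n")
    case False
    then have "neg_lit n (u - n) = u" "u - n < 2 * n" using that by (auto simp: neg_lit_def)
    then show ?thesis using False total[of "u - n"] S by (auto simp: lit_true_def ok_def)
  qed (simp add: lit_true_def)
  have "lit_true n (\<lambda>v. v \<in> S) v" if "(u, v) \<in> E" "lit_true n (\<lambda>v. v \<in> S) u" for u v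
    using that lit[of u] lit[of v] E closed[of u v] by auto
  then show "\<exists>A. \<forall>(u, v)\<in>E. lit_true n A u \<longrightarrow> lit_true n A v" by blast
qed

subsection \<open>Warshall's algorithm\<close>

fun warshall :: "(nat \<Rightarrow> nat \<Rightarrow> bool) \<Rightarrow> nat \<Rightarrow> nat \<Rightarrow> nat \<Rightarrow> bool" where
  "warshall E 0 u v = E u v"
| "warshall E (Suc m) u v = (warshall E m u v \<or> warshall E m u m \<and> warshall E m m v)"

text \<open>With closure under composition at every processed vertex, completeness follows edge by
  edge, and no path has to be split at its largest inner vertex.\<close>

lemma warshall_trans:
  "x < m \<Longrightarrow> warshall E m u x \<Longrightarrow> warshall E m x v \<Longrightarrow> warshall E m u v"
proof (induction m arbitrary: u v x)
  case (Suc m)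
  show ?case
  proof (cases "x = m")
    case True
    then show ?thesis using Suc.prems by auto
  next
    case False
    then have "x < m" using Suc.prems(1) by simp
    then show ?thesis using Suc.IH[of x] Suc.prems(2,3) unfolding warshall.simps by blast
  qed
qed simp

lemma warshall_iff_trancl:
  assumes "E \<subseteq> {..<m} \<times> {..<m}"
  shows "warshall (\<lambda>u v. (u, v) \<in> E) m u v \<longleftrightarrow> (u, v) \<in> E\<^sup>+"
proof
  have "warshall (\<lambda>u v. (u, v) \<in> E) j u v \<Longrightarrow> (u, v) \<in> E\<^sup>+" for j
    by (induction j arbitrary: u v) (auto intro: trancl_trans)
  then show "warshall (\<lambda>u v. (u, v) \<in> E) m u v \<Longrightarrow> (u, v) \<in> E\<^sup>+" .
next
  have edge: "warshall (\<lambda>u v. (u, v) \<in> E) j u v" if "(u, v) \<in> E" for j u v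
    by (induction j) (use that in auto)
  assume "(u, v) \<in> E\<^sup>+"
  then show "warshall (\<lambda>u v. (u, v) \<in> E) m u v"
  proof induction
    case (base y)
    then show ?case by (rule edge)
  next
    case (step y z)
    have "y < m" using step.hyps assms by auto
    then show ?case using step.IH edge[OF step.hyps(2)] by (rule warshall_trans)
  qed
qed

section \<open>Programs with bounded loops\<close>

text \<open>The number of rounds of a loop is fixed by a register on entry, so every program
  terminates and has a functional semantics; \<open>compile\<close> translates it into the while
  language.\<close>

datatype fcom =
    FSkip
  | FAssign string aexp
  | FStore string aexp aexp
  | FSeq fcom fcom (infixr ";;" 60)
  | FIf bexp fcom fcom
  | FFor string string fcom

abbreviation set_reg :: "string \<Rightarrow> nat \<Rightarrow> ram_state \<Rightarrow> ram_state" where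
  "set_reg x v s \<equiv> s\<lparr>reg := (reg s)(x := v)\<rparr>"

abbreviation set_arr :: "string \<Rightarrow> nat \<Rightarrow> nat \<Rightarrow> ram_state \<Rightarrow> ram_state" where
  "set_arr x i v s \<equiv> s\<lparr>arr := (arr s)(x := (arr s x)(i := v))\<rparr>"

text \<open>A loop overwrites its counter with \<open>Suc i\<close>, whereas the compiled code
  increments it. The two agree if the body leaves the counter alone, as \<open>fsafe\<close>
  demands.\<close>

primrec sem :: "fcom \<Rightarrow> ram_state \<Rightarrow> ram_state" where
  "sem FSkip s = s"
| "sem (FAssign x a) s = set_reg x (aval a s) s"
| "sem (FStore x i a) s = set_arr x (aval i s) (aval a s) s"
| "sem (FSeq c d) s = sem d (sem c s)"
| "sem (FIf b c d) s = (if bval b s then sem c s else sem d s)"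
| "sem (FFor x y c) s = fold (\<lambda>i t. set_reg x (Suc i) (sem c t)) [0..<reg s y] (set_reg x 0 s)"

primrec compile :: "fcom \<Rightarrow> com" where
  "compile FSkip = Skip"
| "compile (FAssign x a) = Assign x a"
| "compile (FStore x i a) = Store x i a"
| "compile (FSeq c d) = Seq (compile c) (compile d)"
| "compile (FIf b c d) = If b (compile c) (compile d)"
| "compile (FFor x y c) = Seq (Assign x (Const 0))
     (While (Less (Reg x) (Reg y)) (Seq (compile c) (Assign x (Add (Reg x) (Const 1)))))"

primrec written_regs :: "fcom \<Rightarrow> string set" where
  "written_regs FSkip = {}"
| "written_regs (FAssign x a) = {x}"
| "written_regs (FStore x i a) = {}"
| "written_regs (FSeq c d) = written_regs c \<union> written_regs d"
| "written_regs (FIf b c d) = written_regs c \<union> written_regs d"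
| "written_regs (FFor x y c) = insert x (written_regs c)"

primrec written_arrs :: "fcom \<Rightarrow> string set" where
  "written_arrs FSkip = {}"
| "written_arrs (FAssign x a) = {}"
| "written_arrs (FStore x i a) = {x}"
| "written_arrs (FSeq c d) = written_arrs c \<union> written_arrs d"
| "written_arrs (FIf b c d) = written_arrs c \<union> written_arrs d"
| "written_arrs (FFor x y c) = written_arrs c"

definition unchanged :: "string set \<Rightarrow> string set \<Rightarrow> ram_state \<Rightarrow> ram_state \<Rightarrow> bool" where
  "unchanged X Y s t \<longleftrightarrow> (\<forall>z. z \<notin> X \<longrightarrow> reg t z = reg s z) \<and> (\<forall>z. z \<notin> Y \<longrightarrow> arr t z = arr s z)"

lemma fold_upt_invariant:
  assumes "I 0 s" "\<And>i t. i < m \<Longrightarrow> I i t \<Longrightarrow> I (Suc i) (f i t)"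
  shows "I m (fold f [0..<m] s)"
  using assms(2)
proof (induction m)
  case (Suc m)
  then have "I m (fold f [0..<m] s)" by simp
  then show ?case using Suc.prems[of m] by simp
qed (simp add: assms(1))

lemma sem_unchanged: "unchanged (written_regs c) (written_arrs c) s (sem c s)"
proof (induction c arbitrary: s)
  case (FFor x y c)
  have "unchanged (insert x (written_regs c)) (written_arrs c) s
      (fold (\<lambda>i t. set_reg x (Suc i) (sem c t)) [0..<reg s y] (set_reg x 0 s))"
    by (rule fold_upt_invariant) (use FFor in \<open>auto simp: unchanged_def\<close>)
  then show ?case by simp
qed (fastforce simp: unchanged_def)+

lemma reg_sem [simp]: "z \<notin> written_regs c \<Longrightarrow> reg (sem c s) z = reg s z"
  using sem_unchanged[of c s] by (simp add: unchanged_def)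

lemma arr_sem [simp]: "z \<notin> written_arrs c \<Longrightarrow> arr (sem c s) z = arr s z"
  using sem_unchanged[of c s] by (simp add: unchanged_def)

text \<open>Besides the invariant, every round may use the value of the counter and a frame
  condition relative to the state before the loop, both obtained from what the body writes.\<close>

lemma sem_For_rule:
  assumes "x \<notin> written_regs c" "I 0 (set_reg x 0 s)"
    and "\<And>i t. i < reg s y \<Longrightarrow> I i t \<Longrightarrow> reg t x = i \<Longrightarrow>
      unchanged (insert x (written_regs c)) (written_arrs c) s t \<Longrightarrow> I (Suc i) (set_reg x (Suc i) (sem c t))"
  shows "I (reg s y) (sem (FFor x y c) s)"
proof -
  have "I (reg s y) (sem (FFor x y c) s) \<and> reg (sem (FFor x y c) s) x = reg s y \<and>
      unchanged (insert x (written_regs c)) (written_arrs c) s (sem (FFor x y c) s)"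
    unfolding sem.simps
    by (rule fold_upt_invariant) (use assms sem_unchanged[of c] in \<open>auto simp: unchanged_def\<close>)
  then show ?thesis by blast
qed

declare sem.simps(6) [simp del]

text \<open>An exponent \<open>d\<close> for which the value is at most \<open>B ^ d\<close> when
  memory is bounded by \<open>B\<close>. A sum costs one extra power because
  \<open>2 \<le> B\<close>; a value read from memory is again at most \<open>B\<close>.\<close>

primrec adeg :: "aexp \<Rightarrow> nat" where
  "adeg (Const c) = 1"
| "adeg (Reg x) = 1"
| "adeg (Read x a) = 1"
| "adeg (Add a b) = Suc (max (adeg a) (adeg b))"
| "adeg (Sub a b) = adeg a"
| "adeg (Mul a b) = adeg a + adeg b"

primrec asafe :: "nat \<Rightarrow> aexp \<Rightarrow> bool" where
  "asafe D (Const c) \<longleftrightarrow> c \<le> 2 \<and> 1 \<le> D"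
| "asafe D (Reg x) \<longleftrightarrow> 1 \<le> D"
| "asafe D (Read x a) \<longleftrightarrow> asafe D a"
| "asafe D (Add a b) \<longleftrightarrow> asafe D a \<and> asafe D b \<and> adeg (Add a b) \<le> D"
| "asafe D (Sub a b) \<longleftrightarrow> asafe D a \<and> asafe D b"
| "asafe D (Mul a b) \<longleftrightarrow> asafe D a \<and> asafe D b \<and> adeg (Mul a b) \<le> D"

primrec bsafe :: "nat \<Rightarrow> bexp \<Rightarrow> bool" where
  "bsafe D (Less a b) \<longleftrightarrow> asafe D a \<and> asafe D b"
| "bsafe D (Equal a b) \<longleftrightarrow> asafe D a \<and> asafe D b"
| "bsafe D (Neg p) \<longleftrightarrow> bsafe D p"
| "bsafe D (Conj p q) \<longleftrightarrow> bsafe D p \<and> bsafe D q"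

primrec non_growing :: "aexp \<Rightarrow> bool" where
  "non_growing (Const c) \<longleftrightarrow> c \<le> 2"
| "non_growing (Reg x) \<longleftrightarrow> True"
| "non_growing (Read x a) \<longleftrightarrow> True"
| "non_growing (Add a b) \<longleftrightarrow> False"
| "non_growing (Sub a b) \<longleftrightarrow> non_growing a"
| "non_growing (Mul a b) \<longleftrightarrow> False"

text \<open>Only non-growing values are stored, so a bound on the memory contents persists and it bounds
  the running time of the loops as well.\<close>

primrec fsafe :: "nat \<Rightarrow> fcom \<Rightarrow> bool" where
  "fsafe D FSkip \<longleftrightarrow> True"
| "fsafe D (FAssign x a) \<longleftrightarrow> asafe D a \<and> non_growing a"
| "fsafe D (FStore x i a) \<longleftrightarrow> asafe D i \<and> asafe D a \<and> non_growing a"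
| "fsafe D (FSeq c d) \<longleftrightarrow> fsafe D c \<and> fsafe D d"
| "fsafe D (FIf b c d) \<longleftrightarrow> bsafe D b \<and> fsafe D c \<and> fsafe D d"
| "fsafe D (FFor x y c) \<longleftrightarrow> fsafe D c \<and> x \<noteq> y \<and> x \<notin> written_regs c \<and> y \<notin> written_regs c"

text \<open>A loop pays 2 for resetting the counter and 4 for the final test, and in each of at most
  \<open>B\<close> rounds 4 for the test and 4 for the increment. A conditional is charged for both
  branches.\<close>

primrec fcost :: "nat \<Rightarrow> fcom \<Rightarrow> nat" where
  "fcost B FSkip = 1"
| "fcost B (FAssign x a) = acost a + 1"
| "fcost B (FStore x i a) = acost i + acost a + 1"
| "fcost B (FSeq c d) = fcost B c + fcost B d"
| "fcost B (FIf b c d) = bcost b + 1 + (fcost B c + fcost B d)"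
| "fcost B (FFor x y c) = 6 + B * (8 + fcost B c)"

primrec loop_depth :: "fcom \<Rightarrow> nat" where
  "loop_depth FSkip = 0"
| "loop_depth (FAssign x a) = 0"
| "loop_depth (FStore x i a) = 0"
| "loop_depth (FSeq c d) = max (loop_depth c) (loop_depth d)"
| "loop_depth (FIf b c d) = max (loop_depth c) (loop_depth d)"
| "loop_depth (FFor x y c) = Suc (loop_depth c)"

lemma fcost_le_power: "\<exists>C. \<forall>B\<ge>1. fcost B c \<le> C * B ^ loop_depth c"
proof (induction c)
  case (FSeq c d)
  then obtain C D where C: "\<And>B. B \<ge> 1 \<Longrightarrow> fcost B c \<le> C * B ^ loop_depth c"
    and D: "\<And>B. B \<ge> 1 \<Longrightarrow> fcost B d \<le> D * B ^ loop_depth d" by blast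
  have "fcost B (FSeq c d) \<le> (C + D) * B ^ loop_depth (FSeq c d)" if B: "B \<ge> 1" for B
  proof -
    have "C * B ^ loop_depth c \<le> C * B ^ loop_depth (FSeq c d)" "D * B ^ loop_depth d \<le> D * B ^ loop_depth (FSeq c d)"
      using B by (auto intro!: mult_le_mono2 power_increasing)
    then show ?thesis using C[OF B] D[OF B] unfolding fcost.simps add_mult_distrib by linarith
  qed
  then show ?case by blast
next
  case (FIf b c d)
  then obtain C D where C: "\<And>B. B \<ge> 1 \<Longrightarrow> fcost B c \<le> C * B ^ loop_depth c"
    and D: "\<And>B. B \<ge> 1 \<Longrightarrow> fcost B d \<le> D * B ^ loop_depth d" by blast
  have "fcost B (FIf b c d) \<le> (bcost b + 1 + C + D) * B ^ loop_depth (FIf b c d)" if B: "B \<ge> 1" for B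
  proof -
    have "C * B ^ loop_depth c \<le> C * B ^ loop_depth (FIf b c d)" "D * B ^ loop_depth d \<le> D * B ^ loop_depth (FIf b c d)"
      using B by (auto intro!: mult_le_mono2 power_increasing)
    moreover have "(bcost b + 1) * 1 \<le> (bcost b + 1) * B ^ loop_depth (FIf b c d)"
      using B by (intro mult_le_mono2) simp
    ultimately show ?thesis using C[OF B] D[OF B] unfolding fcost.simps add_mult_distrib by linarith
  qed
  then show ?case by blast
next
  case (FFor x y c)
  then obtain C where C: "\<And>B. B \<ge> 1 \<Longrightarrow> fcost B c \<le> C * B ^ loop_depth c" by blast
  have "fcost B (FFor x y c) \<le> (14 + C) * B ^ Suc (loop_depth c)" if B: "B \<ge> 1" for B
  proof -
    let ?p = "B ^ loop_depth c"
    have "1 \<le> ?p" using B by simp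
    then have "B * (8 + fcost B c) \<le> B * ((8 + C) * ?p)"
      using C[OF B] by (intro mult_le_mono2) (simp add: add_mult_distrib)
    moreover have "6 * 1 \<le> 6 * (B * ?p)" using B by (intro mult_le_mono2) simp
    moreover have "(14 + C) * B ^ Suc (loop_depth c) = B * ((8 + C) * ?p) + 6 * (B * ?p)"
      by (simp add: algebra_simps)
    ultimately show ?thesis unfolding fcost.simps by linarith
  qed
  then show ?case by auto
qed auto

definition mem_bounded :: "nat \<Rightarrow> ram_state \<Rightarrow> bool" where
  "mem_bounded B s \<longleftrightarrow> (\<forall>x. reg s x \<le> B) \<and> (\<forall>x i. arr s x i \<le> B)"

lemma aval_le_power:
  assumes "mem_bounded B s" "2 \<le> B" "asafe D a"
  shows "aval a s \<le> B ^ adeg a"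
  using assms(3)
proof (induction a)
  case (Add a b)
  let ?m = "max (adeg a) (adeg b)"
  have "B ^ adeg a \<le> B ^ ?m" "B ^ adeg b \<le> B ^ ?m" using assms(2) by (auto intro!: power_increasing)
  then have "aval a s + aval b s \<le> 2 * B ^ ?m" using Add by simp
  also have "\<dots> \<le> B * B ^ ?m" using assms(2) by (rule mult_le_mono1)
  finally show ?case by simp
next
  case (Sub a b)
  then have "aval a s \<le> B ^ adeg a" by simp
  then show ?case by simp
next
  case (Mul a b)
  then show ?case by (simp add: power_add mult_le_mono)
qed (use assms(1,2) in \<open>auto simp: mem_bounded_def\<close>)

lemma afitsI:
  assumes "mem_bounded B s" "2 \<le> B" "asafe D a" "B ^ D < 2 ^ w"
  shows "afits w a s"
proof -
  have D: "B ^ i < 2 ^ w" if "i \<le> D" for i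
    using power_increasing[OF that, of B] assms(2,4) by linarith
  have B: "1 \<le> D \<Longrightarrow> B < 2 ^ w" using D[of 1] by simp
  have deg: "1 \<le> D" using assms(3) by (induction a) auto
  show ?thesis using assms(3)
  proof (induction a)
    case (Add a b)
    have "aval (Add a b) s \<le> B ^ adeg (Add a b)" by (rule aval_le_power[OF assms(1,2) Add.prems])
    then show ?case using Add D[of "adeg (Add a b)"] by auto
  next
    case (Mul a b)
    have "aval (Mul a b) s \<le> B ^ adeg (Mul a b)" by (rule aval_le_power[OF assms(1,2) Mul.prems])
    then show ?case using Mul D[of "adeg (Mul a b)"] by auto
  qed (use B[OF deg] assms(1,2) in \<open>auto simp: mem_bounded_def intro: le_less_trans\<close>)
qed

lemma bfitsI:
  assumes "mem_bounded B s" "2 \<le> B" "bsafe D b" "B ^ D < 2 ^ w"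
  shows "bfits w b s"
  using assms(3) by (induction b) (auto intro: afitsI[OF assms(1,2) _ assms(4)])

lemma aval_le_bound:
  assumes "mem_bounded B s" "2 \<le> B" "non_growing a"
  shows "aval a s \<le> B"
  using assms(3) by (induction a) (use assms(1,2) in \<open>auto simp: mem_bounded_def intro: le_trans[OF diff_le_self]\<close>)

text \<open>\<open>J\<close> ties the counter to the round number, so the loop unrolls into a
  \<open>fold\<close>; each 4 is one evaluation of the test.\<close>

lemma exec_While_count:
  assumes b: "b = Less (Reg x) (Reg y)"
    and body: "\<And>i t. i < m \<Longrightarrow> J i t \<Longrightarrow> \<exists>u\<le>C. exec w d t u (g i t) \<and> J (Suc i) (g i t)"
    and J: "\<And>i t. J i t \<Longrightarrow> reg t x = i \<and> reg t y = m \<and> bfits w b t"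
    and "J i s" "i \<le> m"
  shows "\<exists>u \<le> 4 + (m - i) * (4 + C). exec w (While b d) s u (fold g [i..<m] s)"
  using assms(4,5)
proof (induction "m - i" arbitrary: i s)
  case 0
  then have im: "i = m" by simp
  then have "exec w (While b d) s (bcost b + 1) s"
    using J[OF 0(2)] b by (intro exec.WhileFalse) auto
  moreover have "bcost b + 1 = 4" using b by simp
  ultimately show ?case using im by (intro exI[of _ 4]) simp
next
  case (Suc j)
  then have "i < m" by simp
  from body[OF this Suc.prems(1)] obtain u where u: "u \<le> C" "exec w d s u (g i s)" "J (Suc i) (g i s)" by blast
  have "j = m - Suc i" using Suc.hyps(2) by simp
  from Suc.hyps(1)[OF this u(3)] \<open>i < m\<close> obtain v where
    v: "v \<le> 4 + (m - Suc i) * (4 + C)" "exec w (While b d) (g i s) v (fold g [Suc i..<m] (g i s))" by auto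
  have "exec w (While b d) s (bcost b + 1 + u + v) (fold g [Suc i..<m] (g i s))"
    using J[OF Suc.prems(1)] b \<open>i < m\<close> u(2) v(2) by (intro exec.WhileTrue) auto
  moreover have "bcost b + 1 + u + v \<le> 4 + (m - i) * (4 + C)"
  proof -
    have "m - i = Suc (m - Suc i)" using \<open>i < m\<close> by simp
    then show ?thesis using u(1) v(1) b by simp
  qed
  ultimately show ?case
    using \<open>i < m\<close> by (intro exI[of _ "bcost b + 1 + u + v"]) (simp add: upt_conv_Cons)
qed

text \<open>The bound \<open>B\<close> on memory is invariant. It limits the rounds of each loop
  and, together with \<open>B ^ D < 2 ^ w\<close>, keeps all intermediate values within a word.
  \<open>2 \<le> D\<close> accommodates the increment of a counter.\<close>

theorem exec_compile:
  assumes "fsafe D c" "mem_bounded B s" "2 \<le> B" "2 \<le> D" "B ^ D < 2 ^ w"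
  shows "\<exists>t\<le>fcost B c. exec w (compile c) s t (sem c s) \<and> mem_bounded B (sem c s)"
  using assms(1,2)
proof (induction c arbitrary: s)
  case FSkip
  then show ?case using exec.Skip[of w s] by auto
next
  case (FAssign x a)
  have "afits w a s" "aval a s \<le> B" using FAssign assms afitsI aval_le_bound by auto
  then show ?case using exec.Assign[of w a s x] FAssign by (auto simp: mem_bounded_def)
next
  case (FStore x i a)
  have "afits w i s" "afits w a s" "aval a s \<le> B" using FStore assms afitsI aval_le_bound by auto
  then show ?case using exec.Store[of w i s a x] FStore by (auto simp: mem_bounded_def)
next
  case (FSeq c d)
  then obtain t where t: "t \<le> fcost B c" "exec w (compile c) s t (sem c s)" "mem_bounded B (sem c s)" by fastforce
  then obtain u where "u \<le> fcost B d" "exec w (compile d) (sem c s) u (sem d (sem c s))" "mem_bounded B (sem d (sem c s))"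
    using FSeq by fastforce
  then show ?case using t exec.Seq by (intro exI[of _ "t + u"]) auto
next
  case (FIf b c d)
  then have fits: "bfits w b s" using assms bfitsI by auto
  show ?case
  proof (cases "bval b s")
    case True
    obtain t where "t \<le> fcost B c" "exec w (compile c) s t (sem c s)" "mem_bounded B (sem c s)"
      using FIf by fastforce
    then show ?thesis using True fits exec.IfTrue by (intro exI[of _ "bcost b + 1 + t"]) auto
  next
    case False
    obtain t where "t \<le> fcost B d" "exec w (compile d) s t (sem d s)" "mem_bounded B (sem d s)"
      using FIf by fastforce
    then show ?thesis using False fits exec.IfFalse by (intro exI[of _ "bcost b + 1 + t"]) auto
  qed
next
  case (FFor x y c)
  let ?m = "reg s y" and ?d = "Seq (compile c) (Assign x (Add (Reg x) (Const 1)))"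
  let ?g = "\<lambda>i t. set_reg x (Suc i) (sem c t)"
  define J where "J i t \<longleftrightarrow> reg t x = i \<and> reg t y = ?m \<and> mem_bounded B t" for i t
  have safe: "fsafe D c" "x \<noteq> y" "x \<notin> written_regs c" "y \<notin> written_regs c" using FFor.prems by auto
  have mB: "?m \<le> B" using FFor.prems by (simp add: mem_bounded_def)
  have J0: "J 0 (set_reg x 0 s)" using FFor.prems safe by (auto simp: J_def mem_bounded_def)
  have body: "\<exists>u\<le>fcost B c + 4. exec w ?d t u (?g i t) \<and> J (Suc i) (?g i t)"
    if "i < ?m" "J i t" for i t
  proof -
    have "mem_bounded B t" using that by (simp add: J_def)
    from FFor.IH[OF safe(1) this] obtain u where
      u: "u \<le> fcost B c" "exec w (compile c) t u (sem c t)" "mem_bounded B (sem c t)" by blast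
    have "afits w (Add (Reg x) (Const 1)) (sem c t)"
      by (rule afitsI[OF u(3) assms(3) _ assms(5)]) (use assms in auto)
    then have "exec w (Assign x (Add (Reg x) (Const 1))) (sem c t) 4 (?g i t)"
      using exec.Assign[of w "Add (Reg x) (Const 1)" "sem c t" x] that safe by (simp add: J_def eval_nat_numeral)
    then have "exec w ?d t (u + 4) (?g i t)" using u(2) exec.Seq by blast
    \<comment> \<open>The increment is the only sum that is ever stored. It respects
      \<open>B\<close> because the counter never exceeds the loop bound, itself the content of a
      register.\<close>
    moreover have "J (Suc i) (?g i t)" using u(3) that safe mB by (auto simp: J_def mem_bounded_def)
    ultimately show ?thesis using u(1) by (intro exI[of _ "u + 4"]) auto
  qed
  have fits: "reg t x = i \<and> reg t y = ?m \<and> bfits w (Less (Reg x) (Reg y)) t" if "J i t" for i t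
    using that bfitsI[of B t D "Less (Reg x) (Reg y)" w] assms by (auto simp: J_def)
  obtain u where u: "u \<le> 4 + (?m - 0) * (4 + (fcost B c + 4))"
    "exec w (While (Less (Reg x) (Reg y)) ?d) (set_reg x 0 s) u (fold ?g [0..<?m] (set_reg x 0 s))"
    using exec_While_count[OF refl body fits J0] by blast
  have "exec w (Assign x (Const 0)) s 2 (set_reg x 0 s)"
    using exec.Assign[of w "Const 0" s x] by (simp add: numeral_2_eq_2)
  then have "exec w (compile (FFor x y c)) s (2 + u) (sem (FFor x y c) s)"
    unfolding compile.simps sem.simps using u(2) by (rule exec.Seq)
  moreover have "2 + u \<le> fcost B (FFor x y c)"
  proof -
    have "?m * (8 + fcost B c) \<le> B * (8 + fcost B c)" using mB by (rule mult_le_mono1)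
    then show ?thesis using u(1) by (simp add: algebra_simps)
  qed
  moreover have "J ?m (fold ?g [0..<?m] (set_reg x 0 s))"
    by (rule fold_upt_invariant) (use J0 body in blast)+
  then have "mem_bounded B (sem (FFor x y c) s)" by (simp add: J_def sem.simps(6))
  ultimately show ?case by blast
qed

section \<open>Direction choices as a 2-SAT instance\<close>

context line_market begin

text \<open>The case \<open>c = d\<close> expresses a unary constraint as a clause with a repeated
  literal. Both orders of \<open>c\<close> and \<open>d\<close> are covered to make the relation
  symmetric, as contraposition requires.\<close>

definition conflict_ll :: "nat \<Rightarrow> nat \<Rightarrow> nat \<Rightarrow> nat \<Rightarrow> nat \<Rightarrow> bool" where
  "conflict_ll k l b c d \<longleftrightarrow> l \<le> c \<and> c \<le> b \<and> l \<le> d \<and> d \<le> b \<and>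
     (c < d \<and> \<not> left_goal k l c < left_goal k l d \<or> d < c \<and> \<not> left_goal k l d < left_goal k l c \<or>
      c = d \<and> \<not> left_goal k l c < k)"

definition conflict_rr :: "nat \<Rightarrow> nat \<Rightarrow> nat \<Rightarrow> nat \<Rightarrow> nat \<Rightarrow> bool" where
  "conflict_rr k l b c d \<longleftrightarrow> l \<le> c \<and> c \<le> b \<and> l \<le> d \<and> d \<le> b \<and>
     (c < d \<and> \<not> right_goal k b c < right_goal k b d \<or> d < c \<and> \<not> right_goal k b d < right_goal k b c \<or>
      c = d \<and> right_goal k b c < k)"

definition conflict_rl :: "nat \<Rightarrow> nat \<Rightarrow> nat \<Rightarrow> nat \<Rightarrow> nat \<Rightarrow> bool" where
  "conflict_rl k l b c d \<longleftrightarrow> l \<le> c \<and> c \<le> b \<and> l \<le> d \<and> d \<le> b \<and>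
     c < d \<and> \<not> crossing_ok (left_goal k l d + right_goal k b c - k) c d"

text \<open>The positive literal of an object says that it moves left; a pair of conflicting literals
  \<open>u, v\<close> is the implication from \<open>u\<close> to the negation of \<open>v\<close>.\<close>

definition implication :: "nat \<Rightarrow> nat \<Rightarrow> nat \<Rightarrow> nat \<Rightarrow> nat \<Rightarrow> bool" where
  "implication k l b u v \<longleftrightarrow>
     (if u < n then if v < n then conflict_rl k l b v u else conflict_ll k l b u (v - n)
      else if v < n then conflict_rr k l b (u - n) v else conflict_rl k l b (u - n) (v - n))"

lemma implication_bounds: "implication k l b u v \<Longrightarrow> b < n \<Longrightarrow> u < 2 * n \<and> v < 2 * n"
  by (auto simp: implication_def conflict_ll_def conflict_rr_def conflict_rl_def split: if_splits)

text \<open>Contraposition exchanges the two branches that test \<open>conflict_rl\<close> and maps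
  each of the other two to itself by symmetry.\<close>

lemma implication_skew:
  "implication k l b u v \<Longrightarrow> b < n \<Longrightarrow> implication k l b (neg_lit n v) (neg_lit n u)"
  using implication_bounds[of k l b u v]
  by (auto simp: implication_def neg_lit_def conflict_ll_def conflict_rr_def split: if_splits)

lemma direction_choice_iff_implications:
  assumes "b < n"
  shows "direction_choice k l b A \<longleftrightarrow>
    (\<forall>u v. implication k l b u v \<longrightarrow> lit_true n A u \<longrightarrow> lit_true n A v)" (is "?D \<longleftrightarrow> ?I")
proof
  assume ?D
  then have D1: "l \<le> c \<Longrightarrow> c \<le> b \<Longrightarrow> (A c \<longrightarrow> left_goal k l c < k) \<and> (\<not> A c \<longrightarrow> k \<le> right_goal k b c)"
    and D2: "l \<le> c \<Longrightarrow> d \<le> b \<Longrightarrow> c < d \<Longrightarrow>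
        (A c \<and> A d \<longrightarrow> left_goal k l c < left_goal k l d) \<and>
        (\<not> A c \<and> \<not> A d \<longrightarrow> right_goal k b c < right_goal k b d) \<and>
        (\<not> A c \<and> A d \<longrightarrow> crossing_ok (left_goal k l d + right_goal k b c - k) c d)" for c d
    by (auto simp: direction_choice_def)
  have ll: "\<not> (A c \<and> A d)" if "conflict_ll k l b c d" for c d
    using that D1[of c] D2[of c d] D2[of d c] unfolding conflict_ll_def by blast
  have rr: "A c \<or> A d" if "conflict_rr k l b c d" for c d
    using that D1[of c] D2[of c d] D2[of d c] unfolding conflict_rr_def by (meson not_less)
  have rl: "A c \<or> \<not> A d" if "conflict_rl k l b c d" for c d
    using that D2[of c d] unfolding conflict_rl_def by blast
  show ?I
  proof (intro allI impI)
    fix u v assume "implication k l b u v" "lit_true n A u"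
    then show "lit_true n A v"
      using ll[of u "v - n"] rr[of "u - n" v] rl[of v u] rl[of "u - n" "v - n"]
      by (auto simp: implication_def lit_true_def split: if_splits)
  qed
next
  assume I: ?I
  have ll: "\<not> (A c \<and> A d)" if "conflict_ll k l b c d" for c d
  proof -
    have "c < n" using that assms by (simp add: conflict_ll_def)
    then show ?thesis using I[rule_format, of c "n + d"] that by (auto simp: implication_def lit_true_def)
  qed
  have rr: "A c \<or> A d" if "conflict_rr k l b c d" for c d
  proof -
    have "d < n" using that assms by (simp add: conflict_rr_def)
    then show ?thesis using I[rule_format, of "n + c" d] that by (auto simp: implication_def lit_true_def)
  qed
  have rl: "A c \<or> \<not> A d" if "conflict_rl k l b c d" for c d
    using I[rule_format, of "n + c" "n + d"] that by (auto simp: implication_def lit_true_def)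
  show ?D
    unfolding direction_choice_def
  proof (intro conjI ballI impI)
    fix c assume "c \<in> {l..b}" "A c"
    then show "left_goal k l c < k" using ll[of c c] by (auto simp: conflict_ll_def)
  next
    fix c assume "c \<in> {l..b}" "\<not> A c"
    then show "k \<le> right_goal k b c" using rr[of c c] by (auto intro!: leI simp: conflict_rr_def)
  next
    fix c d assume "c \<in> {l..b}" "d \<in> {l..b}" "c < d" "A c \<and> A d"
    then show "left_goal k l c < left_goal k l d" using ll[of c d] by (auto simp: conflict_ll_def)
  next
    fix c d assume "c \<in> {l..b}" "d \<in> {l..b}" "c < d" "\<not> A c \<and> \<not> A d"
    then show "right_goal k b c < right_goal k b d" using rr[of c d] by (auto simp: conflict_rr_def)
  next
    fix c d assume "c \<in> {l..b}" "d \<in> {l..b}" "c < d" "\<not> A c \<and> A d"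
    then show "crossing_ok (left_goal k l d + right_goal k b c - k) c d"
      using rl[of c d] by (auto simp: conflict_rl_def)
  qed
qed

lemma direction_choice_iff_warshall:
  assumes "b < n"
  shows "(\<exists>A. direction_choice k l b A) \<longleftrightarrow>
    \<not> (\<exists>c<n. warshall (implication k l b) (2 * n) c (n + c) \<and> warshall (implication k l b) (2 * n) (n + c) c)"
proof -
  define E where "E = {(u, v). implication k l b u v}"
  have E: "E \<subseteq> {..<2 * n} \<times> {..<2 * n}" using implication_bounds assms by (auto simp: E_def)
  have "warshall (implication k l b) (2 * n) u v \<longleftrightarrow> (u, v) \<in> E\<^sup>+" for u v
    using warshall_iff_trancl[OF E, of u v] by (simp add: E_def)
  moreover have "(\<exists>A. direction_choice k l b A) \<longleftrightarrow> (\<exists>A. \<forall>(u, v)\<in>E. lit_true n A u \<longrightarrow> lit_true n A v)"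
    unfolding direction_choice_iff_implications[OF assms] by (simp add: E_def)
  ultimately show ?thesis
    using two_sat[OF E] implication_skew assms by (simp add: E_def)
qed

end

section \<open>The program\<close>

definition rank_less :: "nat \<Rightarrow> (nat \<Rightarrow> nat) \<Rightarrow> nat \<Rightarrow> nat \<Rightarrow> nat \<Rightarrow> bool" where
  "rank_less n f i x y \<longleftrightarrow> f (i * n + x) < f (i * n + y)"

text \<open>Comparison of numbers is irreflexive and transitive whatever the array contains, so the
  search can be analysed before the ranks are known to be correct.\<close>

lemma line_market_rank_less: "line_market n (rank_less n f)"
  by unfold_locales (auto simp: rank_less_def)

text \<open>Models an upward scan that overwrites its result, so that the last hit survives.\<close>

primrec latest :: "nat \<Rightarrow> (nat \<Rightarrow> bool) \<Rightarrow> nat \<Rightarrow> nat" where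
  "latest k C 0 = k"
| "latest k C (Suc i) = (if C i then i else latest k C i)"

text \<open>Here 0 also marks that nothing has been found yet. This is sound because the condition
  scanned for contains \<open>a < i\<close> and so fails at 0.\<close>

primrec earliest :: "(nat \<Rightarrow> bool) \<Rightarrow> nat \<Rightarrow> nat" where
  "earliest C 0 = 0"
| "earliest C (Suc i) = (if earliest C i = 0 \<and> C i then i else earliest C i)"

lemma less_Suc_Collect:
  "{i. i < Suc m \<and> C i} = (if C m then insert m {i. i < m \<and> C i} else {i. i < m \<and> C i})"
  by (auto simp: less_Suc_eq)

lemma latest_eq: "latest k C m = (let I = {i. i < m \<and> C i} in if I = {} then k else Max I)"
proof (induction m)
  case (Suc m)
  have "Max (insert m {i. i < m \<and> C i}) = m"
    by (intro Max_eqI) auto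
  then show ?case
    using Suc unfolding less_Suc_Collect latest.simps Let_def
    by (cases "C m") (simp_all only: if_True if_False insert_not_empty simp_thms)
qed simp

lemma earliest_eq:
  assumes "\<not> C 0"
  shows "earliest C m = (let I = {i. i < m \<and> C i} in if I = {} then 0 else Min I)"
proof (induction m)
  case (Suc m)
  let ?I = "{i. i < m \<and> C i}"
  show ?case
  proof (cases "?I = {}")
    case True
    have "earliest C m = 0" using Suc unfolding True by simp
    then show ?thesis unfolding less_Suc_Collect True by (simp add: Let_def)
  next
    case False
    have "Min ?I \<in> ?I" using False by (intro Min_in) auto
    then have "Min ?I \<noteq> 0" using assms by (metis (no_types, lifting) mem_Collect_eq)
    moreover have "Min (insert m ?I) = Min ?I"
      using \<open>Min ?I \<in> ?I\<close> False by (subst Min_insert) auto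
    moreover have "earliest C m = Min ?I" using Suc False unfolding Let_def by metis
    ultimately show ?thesis
      using False unfolding less_Suc_Collect earliest.simps Let_def
      by (cases "C m") (simp_all only: if_True if_False insert_not_empty simp_thms)
  qed
qed simp

context line_market begin

lemma left_goal_eq_latest:
  "k \<le> n \<Longrightarrow> left_goal k l c = latest k (\<lambda>i. l \<le> i \<and> i < c \<and> i < k \<and> P i c l) n"
proof -
  assume "k \<le> n"
  then have "{i. i < n \<and> l \<le> i \<and> i < c \<and> i < k \<and> P i c l} = {i. l \<le> i \<and> i < c \<and> i < k \<and> P i c l}" by auto
  then show ?thesis unfolding latest_eq left_goal_def by (simp only:)
qed

lemma right_goal_eq_earliest:
  "b < n \<Longrightarrow> right_goal k b a = earliest (\<lambda>i. a < i \<and> k \<le> i \<and> i \<le> b \<and> P i a b) n"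
proof -
  assume "b < n"
  then have "{i. i < n \<and> a < i \<and> k \<le> i \<and> i \<le> b \<and> P i a b} = {i. a < i \<and> k \<le> i \<and> i \<le> b \<and> P i a b}" by auto
  then show ?thesis unfolding right_goal_def by (subst earliest_eq) (simp_all only: not_less0 simp_thms)
qed

end

abbreviation Disj :: "bexp \<Rightarrow> bexp \<Rightarrow> bexp" where
  "Disj p q \<equiv> Neg (Conj (Neg p) (Neg q))"

abbreviation Le :: "aexp \<Rightarrow> aexp \<Rightarrow> bexp" where
  "Le a b \<equiv> Neg (Less b a)"

abbreviation FWhen :: "bexp \<Rightarrow> fcom \<Rightarrow> fcom" where
  "FWhen b c \<equiv> FIf b c FSkip"

definition Prefers :: "aexp \<Rightarrow> aexp \<Rightarrow> aexp \<Rightarrow> bexp" where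
  "Prefers i x y = Less (Read ''rk'' (Add (Mul i (Reg ''n'')) x)) (Read ''rk'' (Add (Mul i (Reg ''n'')) y))"

definition goal_step :: fcom where
  "goal_step =
     FWhen (Conj (Le (Reg ''L'') (Reg ''i'')) (Conj (Less (Reg ''i'') (Reg ''c''))
         (Conj (Less (Reg ''i'') (Reg ''K'')) (Prefers (Reg ''i'') (Reg ''c'') (Reg ''L'')))))
       (FStore ''Q'' (Reg ''c'') (Reg ''i'')) ;;
     FWhen (Conj (Equal (Read ''S'' (Reg ''c'')) (Const 0)) (Conj (Less (Reg ''c'') (Reg ''i''))
         (Conj (Le (Reg ''K'') (Reg ''i'')) (Conj (Le (Reg ''i'') (Reg ''b''))
         (Prefers (Reg ''i'') (Reg ''c'') (Reg ''b''))))))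
       (FStore ''S'' (Reg ''c'') (Reg ''i''))"

definition goals :: fcom where
  "goals = FFor ''c'' ''n'' (FStore ''Q'' (Reg ''c'') (Reg ''K'') ;; FStore ''S'' (Reg ''c'') (Const 0) ;;
     FFor ''i'' ''n'' goal_step)"

definition In_Range :: "aexp \<Rightarrow> bexp \<Rightarrow> bexp" where
  "In_Range c p = Conj (Le (Reg ''L'') c) (Conj (Le c (Reg ''b'')) p)"

definition Conflict_LL :: "aexp \<Rightarrow> aexp \<Rightarrow> bexp" where
  "Conflict_LL c d = In_Range c (In_Range d
     (Disj (Conj (Less c d) (Le (Read ''Q'' d) (Read ''Q'' c)))
     (Disj (Conj (Less d c) (Le (Read ''Q'' c) (Read ''Q'' d)))
           (Conj (Equal c d) (Le (Reg ''K'') (Read ''Q'' c))))))"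

definition Conflict_RR :: "aexp \<Rightarrow> aexp \<Rightarrow> bexp" where
  "Conflict_RR c d = In_Range c (In_Range d
     (Disj (Conj (Less c d) (Le (Read ''S'' d) (Read ''S'' c)))
     (Disj (Conj (Less d c) (Le (Read ''S'' c) (Read ''S'' d)))
           (Conj (Equal c d) (Less (Read ''S'' c) (Reg ''K''))))))"

definition Conflict_RL :: "aexp \<Rightarrow> aexp \<Rightarrow> bexp" where
  "Conflict_RL c d = In_Range c (In_Range d (Conj (Less c d)
     (let p = Sub (Add (Read ''Q'' d) (Read ''S'' c)) (Reg ''K'')
      in Neg (Conj (Prefers p d c) (Prefers (Add p (Const 1)) c d)))))"

text \<open>Zeros are stored explicitly because \<open>M\<close> is reused for every candidate
  \<open>b\<close>.\<close>

definition set_entry :: "bexp \<Rightarrow> fcom" where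
  "set_entry p = (let i = Add (Mul (Reg ''u'') (Reg ''N2'')) (Reg ''v'')
     in FIf p (FStore ''M'' i (Const 1)) (FStore ''M'' i (Const 0)))"

definition implications :: fcom where
  "implications = FFor ''u'' ''N2'' (FFor ''v'' ''N2'' (
     let u = Reg ''u''; v = Reg ''v''; nu = Sub u (Reg ''n''); nv = Sub v (Reg ''n'') in
     FIf (Less u (Reg ''n''))
       (FIf (Less v (Reg ''n'')) (set_entry (Conflict_RL v u)) (set_entry (Conflict_LL u nv)))
       (FIf (Less v (Reg ''n'')) (set_entry (Conflict_RR nu v)) (set_entry (Conflict_RL nu nv)))))"

definition Entry :: "aexp \<Rightarrow> aexp \<Rightarrow> bexp" where
  "Entry u v = Equal (Read ''M'' (Add (Mul u (Reg ''N2'')) v)) (Const 1)"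

definition closure :: fcom where
  "closure = FFor ''m'' ''N2'' (FFor ''u'' ''N2'' (FFor ''v'' ''N2''
     (FWhen (Conj (Entry (Reg ''u'') (Reg ''m'')) (Entry (Reg ''m'') (Reg ''v'')))
       (FStore ''M'' (Add (Mul (Reg ''u'') (Reg ''N2'')) (Reg ''v'')) (Const 1)))))"

text \<open>\<open>out\<close> is only ever raised to 1, so success for one \<open>b\<close>
  survives the later candidates.\<close>

definition check_cycles :: fcom where
  "check_cycles = FAssign ''ok'' (Const 1) ;;
     FFor ''c'' ''n'' (FWhen (Conj (Entry (Reg ''c'') (Add (Reg ''n'') (Reg ''c'')))
         (Entry (Add (Reg ''n'') (Reg ''c'')) (Reg ''c'')))
       (FAssign ''ok'' (Const 0))) ;;
     FWhen (Equal (Reg ''ok'') (Const 1)) (FAssign ''out'' (Const 1))"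

definition search :: fcom where
  "search = FFor ''b'' ''n'' (FWhen (Le (Reg ''K'') (Reg ''b''))
     (goals ;; implications ;; closure ;; check_cycles))"

text \<open>Keeps the last vertex with fewer than two neighbours. The degree saturates at 2 by
  assigning constants, since storing a sum would violate \<open>non_growing\<close>.\<close>

definition end_point :: fcom where
  "end_point = FFor ''e'' ''n'' (FAssign ''d'' (Const 0) ;;
     FFor ''j'' ''n'' (FWhen
       (Equal (Read ''adj'' (Add (Mul (Add (Reg ''e'') (Const 1)) (Reg ''n'')) (Reg ''j''))) (Const 1))
       (FIf (Equal (Reg ''d'') (Const 0)) (FAssign ''d'' (Const 1)) (FAssign ''d'' (Const 2)))) ;;
     FWhen (Less (Reg ''d'') (Const 2)) (FAssign ''start'' (Reg ''e'')))"

text \<open>Vertices are numbered from 0, agents from 1. \<open>prev\<close> starts as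
  \<open>n\<close>, which is no vertex, so the first step excludes no neighbour.\<close>

definition walk :: fcom where
  "walk = FAssign ''cur'' (Reg ''start'') ;; FAssign ''prev'' (Reg ''n'') ;;
     FFor ''t'' ''n'' (FStore ''X'' (Reg ''t'') (Reg ''cur'') ;;
       FWhen (Equal (Add (Reg ''cur'') (Const 1)) (Reg ''k'')) (FAssign ''K'' (Reg ''t'')) ;;
       FWhen (Equal (Add (Reg ''cur'') (Const 1)) (Reg ''l'')) (FAssign ''L'' (Reg ''t'')) ;;
       FFor ''j'' ''n'' (FWhen
         (Conj (Equal (Read ''adj'' (Add (Mul (Add (Reg ''cur'') (Const 1)) (Reg ''n'')) (Reg ''j''))) (Const 1))
           (Neg (Equal (Reg ''j'') (Reg ''prev''))))
         (FAssign ''nxt'' (Reg ''j''))) ;;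
       FAssign ''prev'' (Reg ''cur'') ;; FAssign ''cur'' (Reg ''nxt''))"

definition ranks :: fcom where
  "ranks = FFor ''i'' ''n'' (FFor ''x'' ''n'' (FFor ''r'' ''n'' (FWhen
     (Equal (Read ''pref'' (Add (Mul (Add (Read ''X'' (Reg ''i'')) (Const 1)) (Reg ''n'')) (Reg ''r'')))
        (Add (Read ''X'' (Reg ''x'')) (Const 1)))
     (FStore ''rk'' (Add (Mul (Reg ''i'') (Reg ''n'')) (Reg ''x'')) (Reg ''r'')))))"

text \<open>If \<open>l\<close> lies to the right of \<open>k\<close>, a second walk from the other
  end reverses the numbering, so that \<open>search\<close> only has to handle motion to the
  right.\<close>

definition decide :: fcom where
  "decide = end_point ;; walk ;;
     FWhen (Less (Reg ''K'') (Reg ''L''))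
       (FAssign ''start'' (Read ''X'' (Sub (Reg ''n'') (Const 1))) ;; walk) ;;
     ranks ;; FWhen (Equal (Reg ''K'') (Reg ''L'')) (FAssign ''out'' (Const 1)) ;; search"

lemmas program_defs = goal_step_def goals_def implications_def closure_def check_cycles_def search_def
  end_point_def walk_def ranks_def decide_def Prefers_def In_Range_def Conflict_LL_def Conflict_RR_def
  Conflict_RL_def set_entry_def Entry_def Let_def

text \<open>The largest addresses occur in \<open>Conflict_RL\<close>: there a sum of two entries,
  plus 1, times \<open>n\<close>, plus an object index, has degree 5.\<close>

lemma fsafe_decide: "fsafe 6 decide"
  by (simp add: program_defs)

text \<open>The four levels are the candidates \<open>b\<close> and the three nested loops of
  \<open>closure\<close>.\<close>

lemma loop_depth_decide: "loop_depth decide = 4"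
  by (simp add: program_defs)

subsection \<open>Correctness of the search\<close>

lemma written_search_parts [simp]:
  "written_regs goals = {''c'', ''i''}" "written_arrs goals = {''Q'', ''S''}"
  "written_regs implications = {''u'', ''v''}" "written_arrs implications = {''M''}"
  "written_regs closure = {''m'', ''u'', ''v''}" "written_arrs closure = {''M''}"
  "written_regs check_cycles = {''ok'', ''c'', ''out''}" "written_arrs check_cycles = {}"
  by (auto simp: program_defs)

lemma bval_Prefers [simp]:
  "bval (Prefers i x y) s = rank_less (reg s ''n'') (arr s ''rk'') (aval i s) (aval x s) (aval y s)"
  by (simp add: Prefers_def rank_less_def)

lemma sem_goal_loop:
  fixes s :: ram_state
  defines "c \<equiv> reg s ''c''" and "lt \<equiv> rank_less (reg s ''n'') (arr s ''rk'')"
  assumes "arr s ''S'' c = 0"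
  shows "arr (sem (FFor ''i'' ''n'' goal_step) s) ''Q'' = (arr s ''Q'')(c := latest (arr s ''Q'' c)
      (\<lambda>i. reg s ''L'' \<le> i \<and> i < c \<and> i < reg s ''K'' \<and> lt i c (reg s ''L'')) (reg s ''n''))"
    and "arr (sem (FFor ''i'' ''n'' goal_step) s) ''S'' = (arr s ''S'')(c := earliest
      (\<lambda>i. c < i \<and> reg s ''K'' \<le> i \<and> i \<le> reg s ''b'' \<and> lt i c (reg s ''b'')) (reg s ''n''))"
proof -
  define CQ where "CQ = (\<lambda>i. reg s ''L'' \<le> i \<and> i < c \<and> i < reg s ''K'' \<and> lt i c (reg s ''L''))"
  define CS where "CS = (\<lambda>i. c < i \<and> reg s ''K'' \<le> i \<and> i \<le> reg s ''b'' \<and> lt i c (reg s ''b''))"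
  have "(\<lambda>i t. arr t ''Q'' = (arr s ''Q'')(c := latest (arr s ''Q'' c) CQ i) \<and>
      arr t ''S'' = (arr s ''S'')(c := earliest CS i)) (reg s ''n'') (sem (FFor ''i'' ''n'' goal_step) s)"
  proof (rule sem_For_rule, goal_cases)
    case 1
    then show ?case by (simp add: goal_step_def)
  next
    case 2
    then show ?case using assms(3) by (auto simp: fun_eq_iff)
  next
    case (3 i t)
    have [simp]: "reg t ''c'' = c" "reg t ''i'' = i" "reg t ''L'' = reg s ''L''" "reg t ''K'' = reg s ''K''"
      "reg t ''b'' = reg s ''b''" "rank_less (reg t ''n'') (arr t ''rk'') = lt"
      using 3(3,4) by (auto simp: unchanged_def goal_step_def c_def lt_def)
    have CQ: "CQ i \<longleftrightarrow> reg s ''L'' \<le> i \<and> i < c \<and> i < reg s ''K'' \<and> lt i c (reg s ''L'')"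
      and CS: "CS i \<longleftrightarrow> c < i \<and> reg s ''K'' \<le> i \<and> i \<le> reg s ''b'' \<and> lt i c (reg s ''b'')"
      by (simp_all add: CQ_def CS_def)
    show ?case using 3(2) by (auto simp: goal_step_def CQ CS)
  qed
  then show "arr (sem (FFor ''i'' ''n'' goal_step) s) ''Q'' = (arr s ''Q'')(c := latest (arr s ''Q'' c)
      (\<lambda>i. reg s ''L'' \<le> i \<and> i < c \<and> i < reg s ''K'' \<and> lt i c (reg s ''L'')) (reg s ''n''))"
    "arr (sem (FFor ''i'' ''n'' goal_step) s) ''S'' = (arr s ''S'')(c := earliest
      (\<lambda>i. c < i \<and> reg s ''K'' \<le> i \<and> i \<le> reg s ''b'' \<and> lt i c (reg s ''b'')) (reg s ''n''))"
    unfolding CQ_def CS_def by blast+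
qed

lemma sem_goals:
  fixes s :: ram_state
  defines "lt \<equiv> rank_less (reg s ''n'') (arr s ''rk'')"
  assumes "c < reg s ''n''"
  shows "arr (sem goals s) ''Q'' c =
      latest (reg s ''K'') (\<lambda>i. reg s ''L'' \<le> i \<and> i < c \<and> i < reg s ''K'' \<and> lt i c (reg s ''L'')) (reg s ''n'')"
    and "arr (sem goals s) ''S'' c =
      earliest (\<lambda>i. c < i \<and> reg s ''K'' \<le> i \<and> i \<le> reg s ''b'' \<and> lt i c (reg s ''b'')) (reg s ''n'')"
proof -
  define q where "q = (\<lambda>c. latest (reg s ''K'')
    (\<lambda>i. reg s ''L'' \<le> i \<and> i < c \<and> i < reg s ''K'' \<and> lt i c (reg s ''L'')) (reg s ''n''))"
  define r where "r = (\<lambda>c. earliest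
    (\<lambda>i. c < i \<and> reg s ''K'' \<le> i \<and> i \<le> reg s ''b'' \<and> lt i c (reg s ''b'')) (reg s ''n''))"
  have "(\<lambda>m t. \<forall>c<m. arr t ''Q'' c = q c \<and> arr t ''S'' c = r c) (reg s ''n'') (sem goals s)"
    unfolding goals_def
  proof (rule sem_For_rule, goal_cases)
    case 1
    then show ?case by (simp add: goal_step_def)
  next
    case 2
    then show ?case by simp
  next
    case (3 m t)
    have *: "reg t ''c'' = m" "reg t ''L'' = reg s ''L''" "reg t ''K'' = reg s ''K''"
      "reg t ''n'' = reg s ''n''" "reg t ''b'' = reg s ''b''" "arr t ''rk'' = arr s ''rk''"
      using 3(3,4) by (auto simp: unchanged_def goal_step_def)
    show ?case
      using 3(2) by (simp add: sem_goal_loop * q_def r_def lt_def[symmetric] less_Suc_eq)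
  qed
  then show "arr (sem goals s) ''Q'' c =
      latest (reg s ''K'') (\<lambda>i. reg s ''L'' \<le> i \<and> i < c \<and> i < reg s ''K'' \<and> lt i c (reg s ''L'')) (reg s ''n'')"
    "arr (sem goals s) ''S'' c =
      earliest (\<lambda>i. c < i \<and> reg s ''K'' \<le> i \<and> i \<le> reg s ''b'' \<and> lt i c (reg s ''b'')) (reg s ''n'')"
    using assms(2) by (simp_all add: q_def r_def)
qed

lemma row_col_inject:
  fixes u v u' v' N :: nat
  assumes "v < N" "v' < N"
  shows "u * N + v = u' * N + v' \<longleftrightarrow> u = u' \<and> v = v'"
proof
  assume *: "u * N + v = u' * N + v'"
  have "(u * N + v) div N = u" "(u' * N + v') div N = u'" using assms by auto
  then show "u = u' \<and> v = v'" using * by auto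
qed auto

text \<open>Serves both the implication matrix and the rank table. Each round changes one cell of
  \<open>A\<close>, and distinct cells have distinct row-major addresses, so no entry is overwritten
  later.\<close>

lemma sem_fill:
  fixes F :: "nat \<Rightarrow> nat \<Rightarrow> nat"
  assumes reg: "x \<noteq> y" "x \<noteq> z" "y \<noteq> z" "x \<notin> written_regs c" "y \<notin> written_regs c" "z \<notin> written_regs c"
    and fill: "\<And>t u v. u < reg s z \<Longrightarrow> v < reg s z \<Longrightarrow> reg t x = u \<Longrightarrow> reg t y = v \<Longrightarrow>
      unchanged (insert x (insert y (written_regs c))) (written_arrs c) s t \<Longrightarrow>
      arr (sem c t) A = (arr t A)(u * reg s z + v := F u v)"
    and uv: "u < reg s z" "v < reg s z"
  shows "arr (sem (FFor x z (FFor y z c)) s) A (u * reg s z + v) = F u v"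
proof -
  define N where "N = reg s z"
  have "(\<lambda>m t. \<forall>u v. u < m \<longrightarrow> v < N \<longrightarrow> arr t A (u * N + v) = F u v) (reg s z) (sem (FFor x z (FFor y z c)) s)"
  proof (rule sem_For_rule, goal_cases)
    case 1
    then show ?case using reg by auto
  next
    case 2
    then show ?case by simp
  next
    case (3 m t)
    have tz: "reg t z = N" using 3(4) reg by (simp add: unchanged_def N_def)
    have "(\<lambda>j t'. \<forall>u v. v < N \<longrightarrow> u < m \<or> u = m \<and> v < j \<longrightarrow> arr t' A (u * N + v) = F u v)
       (reg t z) (sem (FFor y z c) t)"
    proof (rule sem_For_rule, goal_cases)
      case 1
      then show ?case using reg by auto
    next
      case 2
      then show ?case using 3(2) by simp
    next
      case (3 j t')
      note inner = 3
      have "unchanged (insert x (insert y (written_regs c))) (written_arrs c) s t'"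
        using \<open>unchanged (insert x (written_regs (FFor y z c))) (written_arrs (FFor y z c)) s t\<close> inner(4)
        by (auto simp: unchanged_def)
      moreover have "reg t' x = m"
        using \<open>reg t x = m\<close> inner(4) reg by (auto simp: unchanged_def)
      ultimately have "arr (sem c t') A = (arr t' A)(m * N + j := F m j)"
        using fill[of m j t'] \<open>m < reg s z\<close> inner(1,3) tz by (simp add: N_def)
      moreover have "j < N" using inner(1) tz by simp
      ultimately show ?case using inner(2) row_col_inject[of _ N j _ m] by (auto simp: less_Suc_eq)
    qed
    then show ?case using tz by (simp add: less_Suc_eq)
  qed
  then show ?thesis using uv by (simp add: N_def)
qed

lemma sem_implications:
  fixes s :: ram_state
  defines "n \<equiv> reg s ''n''" and "lt \<equiv> rank_less (reg s ''n'') (arr s ''rk'')"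
  assumes N2: "reg s ''N2'' = 2 * n" and b: "reg s ''b'' < n"
    and Q: "\<And>c. c < n \<Longrightarrow> arr s ''Q'' c = line_market.left_goal lt (reg s ''K'') (reg s ''L'') c"
    and S: "\<And>c. c < n \<Longrightarrow> arr s ''S'' c = line_market.right_goal lt (reg s ''K'') (reg s ''b'') c"
    and uv: "u < 2 * n" "v < 2 * n"
  shows "arr (sem implications s) ''M'' (u * (2 * n) + v) =
    (if line_market.implication n lt (reg s ''K'') (reg s ''L'') (reg s ''b'') u v then 1 else 0)"
proof -
  interpret line_market n lt unfolding n_def lt_def by (rule line_market_rank_less)
  let ?k = "reg s ''K''" and ?l = "reg s ''L''" and ?b = "reg s ''b''"
  define F :: "nat \<Rightarrow> nat \<Rightarrow> nat" where "F u v = (if implication ?k ?l ?b u v then 1 else 0)" for u v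
  have "arr (sem implications s) ''M'' (u * reg s ''N2'' + v) = F u v"
    unfolding implications_def
  proof (rule sem_fill, goal_cases)
    case (7 t u v)
    have *: "reg t ''K'' = ?k" "reg t ''L'' = ?l" "reg t ''b'' = ?b" "reg t ''n'' = n" "reg t ''N2'' = 2 * n"
      "reg t ''u'' = u" "reg t ''v'' = v" "arr t ''rk'' = arr s ''rk''" "arr t ''Q'' = arr s ''Q''" "arr t ''S'' = arr s ''S''"
      "rank_less n (arr s ''rk'') = lt"
      using 7(3,4,5) N2 by (auto simp: unchanged_def program_defs n_def lt_def)
    \<comment> \<open>\<open>Q\<close> and \<open>S\<close> are known only below \<open>n\<close>;
      the range tests confine both indices to at most \<open>b\<close>.\<close>
    have ll: "bval (Conflict_LL c d) t \<longleftrightarrow> conflict_ll ?k ?l ?b (aval c t) (aval d t)" for c d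
      using b by (auto simp: Conflict_LL_def In_Range_def conflict_ll_def * Q)
    have rr: "bval (Conflict_RR c d) t \<longleftrightarrow> conflict_rr ?k ?l ?b (aval c t) (aval d t)" for c d
      using b by (auto simp: Conflict_RR_def In_Range_def conflict_rr_def * S)
    have rl: "bval (Conflict_RL c d) t \<longleftrightarrow> conflict_rl ?k ?l ?b (aval c t) (aval d t)" for c d
      using b by (auto simp: Conflict_RL_def In_Range_def conflict_rl_def crossing_ok_def Let_def * Q S)
    have entry: "arr (sem (set_entry p) t) ''M'' =
        (arr t ''M'')(u * reg s ''N2'' + v := (if bval p t then 1 else 0))" for p
      by (simp add: set_entry_def Let_def * N2)
    show ?case by (simp add: Let_def entry ll rr rl * F_def implication_def)
  qed (use uv N2 in \<open>auto simp: set_entry_def Let_def\<close>)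
  then show ?thesis by (simp add: N2 F_def)
qed

text \<open>The program updates \<open>M\<close> in place, while \<open>warshall\<close> computes
  each round from the previous one. During round \<open>m\<close> the matrix stays between the two
  rounds, and these agree on row and column \<open>m\<close>, the only entries read.\<close>

lemma sem_closure:
  fixes s :: ram_state
  defines "N \<equiv> reg s ''N2''"
  assumes uv: "u < N" "v < N"
  shows "arr (sem closure s) ''M'' (u * N + v) = 1 \<longleftrightarrow> warshall (\<lambda>u v. arr s ''M'' (u * N + v) = 1 \<and> u < N \<and> v < N) N u v"
proof -
  define W where "W = warshall (\<lambda>u v. arr s ''M'' (u * N + v) = 1 \<and> u < N \<and> v < N)"
  define R where "R t u v \<longleftrightarrow> arr t ''M'' (u * N + v) = 1" for t :: ram_state and u v
  have W_Suc: "W (Suc m) u v \<longleftrightarrow> W m u v \<or> W m u m \<and> W m m v" for m u v by (simp add: W_def)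
  have "(\<lambda>m t. \<forall>u<N. \<forall>v<N. R t u v \<longleftrightarrow> W m u v) (reg s ''N2'') (sem closure s)"
    unfolding closure_def
  proof (rule sem_For_rule, goal_cases)
    case 1
    then show ?case by simp
  next
    case 2
    then show ?case by (simp add: R_def W_def)
  next
    case (3 m t1)
    note s1 = 3
    have m: "m < N" using s1(1) by (simp add: N_def)
    have N1: "reg t1 ''N2'' = N" using s1(4) by (simp add: unchanged_def N_def)
    \<comment> \<open>Cells before \<open>(p, q)\<close> in row-major order have reached round
      \<open>Suc m\<close>; the others may lie anywhere between the two rounds.\<close>
    define J where "J t p q \<longleftrightarrow> (\<forall>u<N. \<forall>v<N. (W m u v \<longrightarrow> R t u v) \<and> (R t u v \<longrightarrow> W (Suc m) u v) \<and>
      (u < p \<or> u = p \<and> v < q \<longrightarrow> W (Suc m) u v \<longrightarrow> R t u v))" for t p q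
    have "(\<lambda>p t. J t p 0) (reg t1 ''N2'') (sem (FFor ''u'' ''N2'' (FFor ''v'' ''N2''
     (FWhen (Conj (Entry (Reg ''u'') (Reg ''m'')) (Entry (Reg ''m'') (Reg ''v'')))
       (FStore ''M'' (Add (Mul (Reg ''u'') (Reg ''N2'')) (Reg ''v'')) (Const 1))))) t1)"
    proof (rule sem_For_rule, goal_cases)
      case 1
      then show ?case by simp
    next
      case 2
      then show ?case using s1(2) by (auto simp: J_def R_def W_Suc)
    next
      case (3 p t2)
      note s2 = 3
      have N2: "reg t2 ''N2'' = N" "reg t2 ''m'' = m"
        using s2(4) s1(3) N1 by (simp_all add: unchanged_def)
      have "(\<lambda>q t. J t p q) (reg t2 ''N2'') (sem (FFor ''v'' ''N2''
       (FWhen (Conj (Entry (Reg ''u'') (Reg ''m'')) (Entry (Reg ''m'') (Reg ''v'')))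
         (FStore ''M'' (Add (Mul (Reg ''u'') (Reg ''N2'')) (Reg ''v'')) (Const 1)))) t2)"
      proof (rule sem_For_rule, goal_cases)
        case 1
        then show ?case by simp
      next
        case 2
        then show ?case using s2(2) by (simp add: J_def R_def)
      next
        case (3 q t)
        have r: "reg t ''N2'' = N" "reg t ''m'' = m" "reg t ''u'' = p" "reg t ''v'' = q"
          using 3(3,4) N2 s2(3) by (simp_all add: unchanged_def)
        have pq: "p < N" "q < N" using s2(1) N1 3(1) N2 by auto
        let ?t = "sem (FWhen (Conj (Entry (Reg ''u'') (Reg ''m'')) (Entry (Reg ''m'') (Reg ''v'')))
         (FStore ''M'' (Add (Mul (Reg ''u'') (Reg ''N2'')) (Reg ''v'')) (Const 1))) t"
        have J: "J t p q" using 3(2) .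
        have "R t p m \<longleftrightarrow> W m p m" "R t m q \<longleftrightarrow> W m m q"
          using J m pq by (auto simp: J_def W_Suc)
        then have new: "R ?t u v \<longleftrightarrow> R t u v \<or> u = p \<and> v = q \<and> W m p m \<and> W m m q" if "u < N" "v < N" for u v
          using row_col_inject[of v N q u p] that pq by (auto simp: R_def Entry_def r)
        have "J ?t p (Suc q)"
          unfolding J_def
        proof (intro allI impI)
          fix u v assume uv: "u < N" "v < N"
          have "(W m u v \<longrightarrow> R t u v) \<and> (R t u v \<longrightarrow> W (Suc m) u v) \<and>
            (u < p \<or> u = p \<and> v < q \<longrightarrow> W (Suc m) u v \<longrightarrow> R t u v)"
            using J uv by (simp add: J_def)
          then show "(W m u v \<longrightarrow> R ?t u v) \<and> (R ?t u v \<longrightarrow> W (Suc m) u v) \<and>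
            (u < p \<or> u = p \<and> v < Suc q \<longrightarrow> W (Suc m) u v \<longrightarrow> R ?t u v)"
            unfolding new[OF uv] W_Suc less_Suc_eq by blast
        qed
        then show ?case by (simp add: J_def R_def)
      qed
      then show ?case using N2(1) by (auto simp: J_def R_def less_Suc_eq)
    qed
    then show ?case using N1 by (auto simp: J_def R_def)
  qed
  then show ?thesis using uv unfolding R_def W_def N_def by blast
qed

lemma sem_check_cycles:
  fixes s :: ram_state
  defines "n \<equiv> reg s ''n''"
  shows "reg (sem check_cycles s) ''out'' =
    (if \<exists>c<n. arr s ''M'' (c * reg s ''N2'' + (n + c)) = 1 \<and> arr s ''M'' ((n + c) * reg s ''N2'' + c) = 1
     then reg s ''out'' else 1)"
proof -
  let ?s = "set_reg ''ok'' 1 s"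
  let ?c = "FFor ''c'' ''n'' (FWhen (Conj (Entry (Reg ''c'') (Add (Reg ''n'') (Reg ''c'')))
         (Entry (Add (Reg ''n'') (Reg ''c'')) (Reg ''c''))) (FAssign ''ok'' (Const 0)))"
  define C where "C c \<longleftrightarrow> arr s ''M'' (c * reg s ''N2'' + (n + c)) = 1 \<and> arr s ''M'' ((n + c) * reg s ''N2'' + c) = 1" for c
  have "(\<lambda>m t. reg t ''ok'' = (if \<exists>c<m. C c then 0 else 1)) (reg ?s ''n'') (sem ?c ?s)"
  proof (rule sem_For_rule, goal_cases)
    case (3 m t)
    have "reg t ''n'' = n" "reg t ''N2'' = reg s ''N2''" "reg t ''c'' = m" "arr t ''M'' = arr s ''M''"
      using 3(3,4) by (simp_all add: unchanged_def n_def)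
    then show ?case using 3(2) by (auto simp: Entry_def C_def less_Suc_eq)
  qed simp_all
  then have "reg (sem ?c ?s) ''ok'' = (if \<exists>c<n. C c then 0 else 1)" by (simp add: n_def)
  then show ?thesis unfolding check_cycles_def by (auto simp: C_def)
qed

lemma warshall_cong:
  assumes "\<And>u v. u < N \<Longrightarrow> v < N \<Longrightarrow> E u v \<longleftrightarrow> E' u v" "m \<le> N" "u < N" "v < N"
  shows "warshall E m u v \<longleftrightarrow> warshall E' m u v"
  using assms(2-4) by (induction m arbitrary: u v) (auto simp: assms(1))

lemma sem_search_body:
  fixes s :: ram_state
  defines "n \<equiv> reg s ''n''" and "lt \<equiv> rank_less (reg s ''n'') (arr s ''rk'')"
  assumes N2: "reg s ''N2'' = 2 * n" and b: "reg s ''b'' < n" and K: "reg s ''K'' < n"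
  shows "reg (sem (goals ;; implications ;; closure ;; check_cycles) s) ''out'' =
    (if \<exists>A. line_market.direction_choice lt (reg s ''K'') (reg s ''L'') (reg s ''b'') A then 1 else reg s ''out'')"
proof -
  interpret line_market n lt unfolding n_def lt_def by (rule line_market_rank_less)
  let ?k = "reg s ''K''" and ?l = "reg s ''L''" and ?b = "reg s ''b''"
  define s1 where "s1 = sem goals s"
  define s2 where "s2 = sem implications s1"
  define s3 where "s3 = sem closure s2"
  have r1: "reg s1 ''n'' = n" "reg s1 ''N2'' = 2 * n" "reg s1 ''K'' = ?k" "reg s1 ''L'' = ?l" "reg s1 ''b'' = ?b"
    "arr s1 ''rk'' = arr s ''rk''" "reg s1 ''out'' = reg s ''out''" "rank_less n (arr s ''rk'') = lt"
    by (simp_all add: s1_def n_def lt_def N2)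
  have r2: "reg s2 ''n'' = n" "reg s2 ''N2'' = 2 * n" "reg s2 ''out'' = reg s ''out''"
    by (simp_all add: s2_def r1)
  have r3: "reg s3 ''n'' = n" "reg s3 ''N2'' = 2 * n" "reg s3 ''out'' = reg s ''out''"
    by (simp_all add: s3_def r2)
  have Q: "arr s1 ''Q'' c = left_goal ?k ?l c" if "c < n" for c
    unfolding s1_def using sem_goals(1)[of c s] that K left_goal_eq_latest[of ?k ?l c] by (simp add: n_def lt_def)
  have S: "arr s1 ''S'' c = right_goal ?k ?b c" if "c < n" for c
    unfolding s1_def using sem_goals(2)[of c s] that b right_goal_eq_earliest[of ?b ?k c] by (simp add: n_def lt_def)
  have M: "arr s2 ''M'' (u * (2 * n) + v) = 1 \<longleftrightarrow> implication ?k ?l ?b u v" if "u < 2 * n" "v < 2 * n" for u v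
    using sem_implications[of s1 u v] that b by (simp add: r1 Q S s2_def)
  have C: "arr s3 ''M'' (u * (2 * n) + v) = 1 \<longleftrightarrow> warshall (implication ?k ?l ?b) (2 * n) u v"
    if "u < 2 * n" "v < 2 * n" for u v
  proof -
    have "arr s3 ''M'' (u * (2 * n) + v) = 1 \<longleftrightarrow>
        warshall (\<lambda>u v. arr s2 ''M'' (u * (2 * n) + v) = 1 \<and> u < 2 * n \<and> v < 2 * n) (2 * n) u v"
      using sem_closure[of u s2 v] that by (simp add: r2 s3_def)
    also have "\<dots> \<longleftrightarrow> warshall (implication ?k ?l ?b) (2 * n) u v"
      by (rule warshall_cong[of "2 * n"]) (use M that in auto)
    finally show ?thesis .
  qed
  have "reg (sem check_cycles s3) ''out'' = (if \<exists>A. direction_choice ?k ?l ?b A then 1 else reg s ''out'')"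
    unfolding sem_check_cycles direction_choice_iff_warshall[OF b] r3
    using C[of _ "n + _"] C[of "n + _" _] by auto
  then show ?thesis by (simp add: s1_def s2_def s3_def)
qed

lemma sem_search:
  fixes s :: ram_state
  defines "n \<equiv> reg s ''n''" and "lt \<equiv> rank_less (reg s ''n'') (arr s ''rk'')"
  assumes N2: "reg s ''N2'' = 2 * n" and K: "reg s ''K'' < n"
  shows "reg (sem search s) ''out'' =
    (if \<exists>b A. reg s ''K'' \<le> b \<and> b < n \<and> line_market.direction_choice lt (reg s ''K'') (reg s ''L'') b A
     then 1 else reg s ''out'')"
proof -
  define D where "D b \<longleftrightarrow> reg s ''K'' \<le> b \<and> (\<exists>A. line_market.direction_choice lt (reg s ''K'') (reg s ''L'') b A)" for b
  define J where "J m t \<longleftrightarrow> reg t ''out'' = (if \<exists>b<m. D b then 1 else reg s ''out'')" for m and t :: ram_state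
  have "J (reg s ''n'') (sem search s)"
    unfolding search_def
  proof (rule sem_For_rule, goal_cases)
    case (3 m t)
    have t: "reg t ''n'' = n" "reg t ''N2'' = 2 * n" "reg t ''K'' = reg s ''K''" "reg t ''L'' = reg s ''L''"
      "reg t ''b'' = m" "arr t ''rk'' = arr s ''rk''" "rank_less n (arr s ''rk'') = lt"
      using 3(3,4) N2 by (simp_all add: unchanged_def n_def lt_def)
    have "m < n" using 3(1) by (simp add: n_def)
    then have "reg (sem (goals ;; implications ;; closure ;; check_cycles) t) ''out'' =
      (if \<exists>A. line_market.direction_choice lt (reg s ''K'') (reg s ''L'') m A then 1 else reg t ''out'')"
      using sem_search_body[of t] K by (simp add: t del: sem.simps)
    then have "reg (sem (FWhen (Le (Reg ''K'') (Reg ''b'')) (goals ;; implications ;; closure ;; check_cycles)) t) ''out'' =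
      (if D m then 1 else reg t ''out'')"
      by (auto simp: t D_def simp del: sem.simps(4))
    moreover have "(\<exists>b<Suc m. D b) \<longleftrightarrow> D m \<or> (\<exists>b<m. D b)" by (auto simp: less_Suc_eq)
    ultimately show ?case using 3(2) by (auto simp: J_def simp del: sem.simps)
  qed (simp_all add: J_def)
  then show ?thesis by (auto simp: D_def J_def n_def)
qed

subsection \<open>Reading the path and the ranks\<close>

definition path_of :: "swap_instance \<Rightarrow> (nat \<Rightarrow> nat) \<Rightarrow> bool" where
  "path_of I X \<longleftrightarrow> bij_betw X {..<num I} {..<num I} \<and>
     edges I = {{Suc (X i), Suc (X (Suc i))} | i. Suc i < num I}"

lemma path_network_path_of:
  assumes "path_network I"
  obtains X where "path_of I X"
proof -
  from assms obtain xs where xs: "distinct xs" "set xs = {1..num I}"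
    "edges I = {{xs ! i, xs ! Suc i} | i. Suc i < length xs}"
    by (auto simp: path_network_def agents_def)
  have len: "length xs = num I" using distinct_card[OF xs(1)] xs(2) by simp
  define X where "X = (\<lambda>i. xs ! i - 1)"
  have Suc_X: "Suc (X i) = xs ! i" if "i < num I" for i
    using nth_mem[of i xs] that xs(2) len by (simp add: X_def)
  have "bij_betw (\<lambda>i. xs ! i) {..<num I} {1..num I}"
    using bij_betw_nth[OF xs(1), of "{..<num I}" "{1..num I}"] xs(2) len by simp
  moreover have "bij_betw (\<lambda>x. x - 1) {1..num I} {..<num I}"
    by (rule bij_betw_byWitness[where f' = Suc]) auto
  ultimately have "bij_betw ((\<lambda>x. x - 1) \<circ> (\<lambda>i. xs ! i)) {..<num I} {..<num I}"
    by (rule bij_betw_trans)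
  then have "bij_betw X {..<num I} {..<num I}" by (simp add: X_def comp_def)
  moreover have "edges I = {{Suc (X i), Suc (X (Suc i))} | i. Suc i < num I}"
    unfolding xs(3) len using Suc_X by (intro Collect_cong) (metis Suc_lessD)
  ultimately show thesis by (intro that[of X]) (simp add: path_of_def)
qed

text \<open>Used twice: \<open>end_point\<close> may find either end of the path, and
  \<open>l\<close> may lie on either side of \<open>k\<close>.\<close>

lemma path_of_reverse:
  assumes "path_of I X"
  shows "path_of I (\<lambda>i. X (num I - 1 - i))"
proof -
  let ?n = "num I"
  have "bij_betw (\<lambda>i. ?n - 1 - i) {..<?n} {..<?n}"
    by (rule bij_betw_byWitness[where f' = "\<lambda>i. ?n - 1 - i"]) auto
  from bij_betw_trans[OF this, of X "{..<?n}"] assms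
  have "bij_betw (\<lambda>i. X (?n - 1 - i)) {..<?n} {..<?n}" by (simp add: path_of_def comp_def)
  moreover have "{{Suc (X i), Suc (X (Suc i))} | i. Suc i < ?n} =
      {{Suc (X (?n - 1 - i)), Suc (X (?n - 1 - Suc i))} | i. Suc i < ?n}" (is "?A = ?B")
  proof -
    have rev: "{Suc (X i), Suc (X (Suc i))} =
        {Suc (X (?n - 1 - (?n - 2 - i))), Suc (X (?n - 1 - Suc (?n - 2 - i)))}" "Suc (?n - 2 - i) < ?n"
      if "Suc i < ?n" for i
    proof -
      have "?n - 1 - (?n - 2 - i) = Suc i" "?n - 1 - Suc (?n - 2 - i) = i" using that by auto
      then show "{Suc (X i), Suc (X (Suc i))} =
        {Suc (X (?n - 1 - (?n - 2 - i))), Suc (X (?n - 1 - Suc (?n - 2 - i)))}" by (simp add: insert_commute)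
      show "Suc (?n - 2 - i) < ?n" using that by auto
    qed
    have rev': "{Suc (X (?n - 1 - i)), Suc (X (?n - 1 - Suc i))} = {Suc (X (?n - 2 - i)), Suc (X (Suc (?n - 2 - i)))}"
      if "Suc i < ?n" for i
    proof -
      have "Suc (?n - 2 - i) = ?n - 1 - i" "?n - 1 - Suc i = ?n - 2 - i" using that by auto
      then show ?thesis by (simp add: insert_commute)
    qed
    show ?thesis
    proof (intro subset_antisym subsetI)
      fix e assume "e \<in> ?A"
      then obtain i where "Suc i < ?n" "e = {Suc (X i), Suc (X (Suc i))}" by blast
      then show "e \<in> ?B" using rev[of i] by (intro CollectI exI[of _ "?n - 2 - i"] conjI) simp_all
    next
      fix e assume "e \<in> ?B"
      then obtain i where i: "Suc i < ?n" "e = {Suc (X (?n - 1 - i)), Suc (X (?n - 1 - Suc i))}" by blast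
      then show "e \<in> ?A" using rev'[of i] by (intro CollectI exI[of _ "?n - 2 - i"] conjI) auto
    qed
  qed
  ultimately show ?thesis using assms by (simp add: path_of_def)
qed

lemma path_of_less: "path_of I X \<Longrightarrow> i < num I \<Longrightarrow> X i < num I"
  by (auto simp: path_of_def bij_betw_def)

lemma path_of_inj: "path_of I X \<Longrightarrow> i < num I \<Longrightarrow> j < num I \<Longrightarrow> X i = X j \<longleftrightarrow> i = j"
  by (auto simp: path_of_def bij_betw_def inj_on_def)

lemma path_of_surj:
  assumes "path_of I X" "a < num I"
  obtains i where "i < num I" "X i = a"
proof -
  have "a \<in> X ` {..<num I}" using assms by (simp add: path_of_def bij_betw_def)
  then show thesis using that by auto
qed

lemma path_of_edge:
  assumes "path_of I X" "p < num I" "i < num I"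
  shows "{Suc (X p), Suc (X i)} \<in> edges I \<longleftrightarrow> i = Suc p \<or> p = Suc i"
proof
  assume "{Suc (X p), Suc (X i)} \<in> edges I"
  then obtain j where j: "Suc j < num I" "{Suc (X p), Suc (X i)} = {Suc (X j), Suc (X (Suc j))}"
    using assms(1) by (auto simp: path_of_def)
  then show "i = Suc p \<or> p = Suc i"
    using path_of_inj[OF assms(1)] assms(2,3) by (auto simp: doubleton_eq_iff Suc_lessD)
next
  assume "i = Suc p \<or> p = Suc i"
  then show "{Suc (X p), Suc (X i)} \<in> edges I"
    using assms by (auto simp: path_of_def insert_commute)
qed

lemma adj_array_path_of:
  assumes "path_of I X" "p < num I" "i < num I"
  shows "adj_array I (Suc (X p) * num I + X i) = 1 \<longleftrightarrow> i = Suc p \<or> p = Suc i"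
proof -
  have "X i < num I" "X p < num I" using path_of_less[OF assms(1)] assms by auto
  moreover have "(Suc (X p) * num I + X i) div num I = Suc (X p)" "(Suc (X p) * num I + X i) mod num I = X i"
    using \<open>X i < num I\<close> by (auto simp del: mult_Suc)
  ultimately show ?thesis using path_of_edge[OF assms] by (simp add: adj_array_def agents_def del: mult_Suc)
qed

text \<open>\<open>X 0\<close> has at most one neighbour, so the scan finds a vertex of degree below
  2; inner vertices have two distinct neighbours and are excluded.\<close>

lemma sem_end_point:
  assumes path: "path_of I X" and n: "0 < num I"
    and s: "reg s ''n'' = num I" "arr s ''adj'' = adj_array I"
  shows "reg (sem end_point s) ''start'' = X 0 \<or> reg (sem end_point s) ''start'' = X (num I - 1)"
proof -
  define A where "A e j \<longleftrightarrow> adj_array I (Suc e * num I + j) = 1" for e j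
  define deg where "deg e m = card {j. j < m \<and> A e j}" for e m
  have deg_Suc: "deg e (Suc m) = deg e m + (if A e m then 1 else 0)" for e m
  proof -
    have "{j. j < Suc m \<and> A e j} = (if A e m then insert m {j. j < m \<and> A e j} else {j. j < m \<and> A e j})"
      by (rule less_Suc_Collect)
    then show ?thesis by (simp add: deg_def)
  qed
  let ?d = "FFor ''j'' ''n'' (FWhen
       (Equal (Read ''adj'' (Add (Mul (Add (Reg ''e'') (Const 1)) (Reg ''n'')) (Reg ''j''))) (Const 1))
       (FIf (Equal (Reg ''d'') (Const 0)) (FAssign ''d'' (Const 1)) (FAssign ''d'' (Const 2))))"
  have inner: "reg (sem ?d t) ''d'' = min 2 (deg (reg t ''e'') (num I))"
    if t: "reg t ''n'' = num I" "arr t ''adj'' = adj_array I" "reg t ''d'' = 0" for t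
  proof -
    define J where "J m u \<longleftrightarrow> reg u ''d'' = min 2 (deg (reg t ''e'') m)" for m and u :: ram_state
    have "J (reg t ''n'') (sem ?d t)"
    proof (rule sem_For_rule, goal_cases)
      case (3 m u)
      have "reg u ''n'' = num I" "reg u ''e'' = reg t ''e''" "arr u ''adj'' = adj_array I"
        using 3(4) t by (simp_all add: unchanged_def)
      then show ?case using 3(2,3) by (auto simp: J_def deg_Suc A_def)
    qed (simp_all add: J_def deg_def t)
    then show ?thesis by (simp add: J_def t)
  qed
  define J where "J m t \<longleftrightarrow> ((\<exists>e<m. deg e (num I) < 2) \<longrightarrow> reg t ''start'' < m \<and> deg (reg t ''start'') (num I) < 2)"
    for m and t :: ram_state
  have "J (reg s ''n'') (sem end_point s)"
    unfolding end_point_def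
  proof (rule sem_For_rule, goal_cases)
    case (3 m t)
    have "reg t ''n'' = num I" "arr t ''adj'' = adj_array I"
      using 3(4) s by (simp_all add: unchanged_def)
    then show ?case using 3(2,3) inner[of "set_reg ''d'' 0 t"] by (auto simp: J_def less_Suc_eq)
  qed (simp_all add: J_def)
  moreover have "deg (X 0) (num I) < 2"
  proof -
    have "{j. j < num I \<and> A (X 0) j} \<subseteq> {X 1}"
    proof
      fix j assume "j \<in> {j. j < num I \<and> A (X 0) j}"
      then obtain i where "i < num I" "X i = j" "A (X 0) (X i)" using path_of_surj[OF path] by blast
      then show "j \<in> {X 1}" using adj_array_path_of[OF path n] by (auto simp: A_def)
    qed
    then have "deg (X 0) (num I) \<le> card {X 1}" unfolding deg_def by (intro card_mono) auto
    then show ?thesis by simp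
  qed
  ultimately have start: "reg (sem end_point s) ''start'' < num I" "deg (reg (sem end_point s) ''start'') (num I) < 2"
    using path_of_less[OF path n] by (auto simp: J_def s)
  obtain p where p: "p < num I" "X p = reg (sem end_point s) ''start''" using path_of_surj[OF path start(1)] by blast
  have "p = 0 \<or> p = num I - 1"
  proof (rule ccontr)
    assume "\<not> (p = 0 \<or> p = num I - 1)"
    then have p': "0 < p" "Suc p < num I" using p by auto
    then have "A (X p) (X (p - 1))" "A (X p) (X (Suc p))"
      using adj_array_path_of[OF path p(1)] by (auto simp: A_def)
    then have "{X (p - 1), X (Suc p)} \<subseteq> {j. j < num I \<and> A (X p) j}"
      using path_of_less[OF path] p' by auto
    then have "card {X (p - 1), X (Suc p)} \<le> deg (X p) (num I)" unfolding deg_def by (intro card_mono) auto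
    moreover have "X (p - 1) \<noteq> X (Suc p)" using path_of_inj[OF path] p' by auto
    ultimately show False using start(2) p(2) by simp
  qed
  then show ?thesis using p(2) by auto
qed

lemma sem_walk:
  assumes path: "path_of I X" and K: "K < num I" "reg s ''k'' = Suc (X K)" and L: "L < num I" "reg s ''l'' = Suc (X L)"
    and s: "reg s ''n'' = num I" "arr s ''adj'' = adj_array I" "reg s ''start'' = X 0"
  shows "\<And>i. i < num I \<Longrightarrow> arr (sem walk s) ''X'' i = X i" "reg (sem walk s) ''K'' = K" "reg (sem walk s) ''L'' = L"
proof -
  let ?n = "num I"
  let ?w = "FFor ''j'' ''n'' (FWhen
         (Conj (Equal (Read ''adj'' (Add (Mul (Add (Reg ''cur'') (Const 1)) (Reg ''n'')) (Reg ''j''))) (Const 1))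
           (Neg (Equal (Reg ''j'') (Reg ''prev''))))
         (FAssign ''nxt'' (Reg ''j'')))"
  have inner: "reg (sem ?w t) ''nxt'' = X (Suc m)"
    if t: "reg t ''n'' = ?n" "arr t ''adj'' = adj_array I" "reg t ''cur'' = X m"
      "reg t ''prev'' = (if m = 0 then ?n else X (m - 1))" and m: "Suc m < ?n" for t m
  proof -
    define J where "J q u \<longleftrightarrow> (X (Suc m) < q \<longrightarrow> reg u ''nxt'' = X (Suc m))" for q and u :: ram_state
    have "J (reg t ''n'') (sem ?w t)"
    proof (rule sem_For_rule, goal_cases)
      case (3 q u)
      have u: "reg u ''n'' = ?n" "reg u ''cur'' = X m" "reg u ''prev'' = reg t ''prev''" "arr u ''adj'' = adj_array I"
        using 3(4) t by (simp_all add: unchanged_def)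
      have "q < ?n" using 3(1) t by simp
      then obtain i where i: "i < ?n" "X i = q" using path_of_surj[OF path] by blast
      \<comment> \<open>The neighbours of \<open>X m\<close> are its predecessor and its successor
        on the path; excluding \<open>prev\<close> leaves the successor.\<close>
      have "adj_array I (Suc (X m) * ?n + q) = 1 \<and> q \<noteq> reg t ''prev'' \<longleftrightarrow> q = X (Suc m)"
      proof -
        have "adj_array I (Suc (X m) * ?n + q) = 1 \<longleftrightarrow> i = Suc m \<or> m = Suc i"
          unfolding i(2)[symmetric] by (rule adj_array_path_of[OF path]) (use m i in auto)
        moreover have "q = X (Suc m) \<longleftrightarrow> i = Suc m" using path_of_inj[OF path i(1) m] i(2) by simp
        moreover have "q = reg t ''prev'' \<longleftrightarrow> m \<noteq> 0 \<and> i = m - 1"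
          using path_of_inj[OF path i(1), of "m - 1"] i(2) t(4) m \<open>q < ?n\<close> by (cases "m = 0") simp_all
        ultimately show ?thesis by auto
      qed
      then show ?case using 3(2,3) by (auto simp: J_def u less_Suc_eq)
    qed (simp_all add: J_def)
    then show ?thesis using path_of_less[OF path m] by (simp add: J_def t)
  qed
  define s' where "s' = set_reg ''prev'' ?n (set_reg ''cur'' (X 0) s)"
  \<comment> \<open>Nothing is claimed about \<open>cur\<close> and \<open>prev\<close> after the
    last vertex, where no successor exists to refresh \<open>nxt\<close>.\<close>
  define J where "J m t \<longleftrightarrow> (\<forall>i<m. arr t ''X'' i = X i) \<and> (K < m \<longrightarrow> reg t ''K'' = K) \<and> (L < m \<longrightarrow> reg t ''L'' = L) \<and>
    (m < ?n \<longrightarrow> reg t ''cur'' = X m \<and> reg t ''prev'' = (if m = 0 then ?n else X (m - 1)))" for m and t :: ram_state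
  let ?f = "FFor ''t'' ''n'' (FStore ''X'' (Reg ''t'') (Reg ''cur'') ;;
       FWhen (Equal (Add (Reg ''cur'') (Const 1)) (Reg ''k'')) (FAssign ''K'' (Reg ''t'')) ;;
       FWhen (Equal (Add (Reg ''cur'') (Const 1)) (Reg ''l'')) (FAssign ''L'' (Reg ''t'')) ;;
       ?w ;; FAssign ''prev'' (Reg ''cur'') ;; FAssign ''cur'' (Reg ''nxt''))"
  have "J (reg s' ''n'') (sem ?f s')"
  proof (rule sem_For_rule, goal_cases)
    case (3 m t)
    have t: "reg t ''n'' = ?n" "arr t ''adj'' = adj_array I" "reg t ''k'' = Suc (X K)" "reg t ''l'' = Suc (X L)"
      using 3(4) s K L by (simp_all add: unchanged_def s'_def)
    have m: "m < ?n" using 3(1) s by (simp add: s'_def)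
    define t1 where "t1 = sem (FStore ''X'' (Reg ''t'') (Reg ''cur'') ;;
       FWhen (Equal (Add (Reg ''cur'') (Const 1)) (Reg ''k'')) (FAssign ''K'' (Reg ''t'')) ;;
       FWhen (Equal (Add (Reg ''cur'') (Const 1)) (Reg ''l'')) (FAssign ''L'' (Reg ''t''))) t"
    have cur: "reg t ''cur'' = X m" "reg t ''prev'' = (if m = 0 then ?n else X (m - 1))" "reg t ''t'' = m"
      using 3(2,3) m by (simp_all add: J_def)
    have t1: "reg t1 ''n'' = ?n" "arr t1 ''adj'' = adj_array I" "reg t1 ''cur'' = X m"
      "reg t1 ''prev'' = (if m = 0 then ?n else X (m - 1))"
      "arr t1 ''X'' = (arr t ''X'')(m := X m)" "reg t1 ''K'' = (if m = K then m else reg t ''K'')"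
      "reg t1 ''L'' = (if m = L then m else reg t ''L'')"
      using path_of_inj[OF path m] path_of_inj[OF path K(1) L(1)] K L by (auto simp: t1_def t cur)
    have "reg (sem ?w t1) ''nxt'' = X (Suc m)" if "Suc m < ?n" using inner[of t1 m] t1 that by simp
    moreover have "sem (FStore ''X'' (Reg ''t'') (Reg ''cur'') ;;
       FWhen (Equal (Add (Reg ''cur'') (Const 1)) (Reg ''k'')) (FAssign ''K'' (Reg ''t'')) ;;
       FWhen (Equal (Add (Reg ''cur'') (Const 1)) (Reg ''l'')) (FAssign ''L'' (Reg ''t'')) ;;
       ?w ;; FAssign ''prev'' (Reg ''cur'') ;; FAssign ''cur'' (Reg ''nxt'')) t =
       sem (?w ;; FAssign ''prev'' (Reg ''cur'') ;; FAssign ''cur'' (Reg ''nxt'')) t1"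
      by (simp only: t1_def sem.simps(4))
    ultimately show ?case using 3(2) by (auto simp: J_def t1 less_Suc_eq)
  qed (simp_all add: J_def s'_def s)
  moreover have "sem walk s = sem ?f s'" unfolding walk_def s'_def by (simp add: s)
  moreover have "reg s' ''n'' = ?n" by (simp add: s'_def s)
  ultimately have "J ?n (sem walk s)" by simp
  then show "\<And>i. i < num I \<Longrightarrow> arr (sem walk s) ''X'' i = X i" "reg (sem walk s) ''K'' = K" "reg (sem walk s) ''L'' = L"
    using K L by (simp_all add: J_def)
qed

lemma sem_ranks:
  assumes X: "\<And>i. i < reg s ''n'' \<Longrightarrow> arr s ''X'' i = X i"
    and f: "\<And>i x. i < reg s ''n'' \<Longrightarrow> x < reg s ''n'' \<Longrightarrow> f i x < reg s ''n''"
      "\<And>i x r. i < reg s ''n'' \<Longrightarrow> x < reg s ''n'' \<Longrightarrow> r < reg s ''n'' \<Longrightarrow>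
        arr s ''pref'' (Suc (X i) * reg s ''n'' + r) = Suc (X x) \<longleftrightarrow> r = f i x"
    and ix: "i < reg s ''n''" "x < reg s ''n''"
  shows "arr (sem ranks s) ''rk'' (i * reg s ''n'' + x) = f i x"
  unfolding ranks_def
proof (rule sem_fill, goal_cases)
  case (7 t i x)
  define n where "n = reg s ''n''"
  have t: "reg t ''n'' = n" "arr t ''X'' = arr s ''X''" "arr t ''pref'' = arr s ''pref''" "reg t ''i'' = i" "reg t ''x'' = x"
    using 7(3-5) by (simp_all add: unchanged_def n_def)
  define J where "J m u \<longleftrightarrow> arr u ''rk'' = (if f i x < m then (arr t ''rk'')(i * n + x := f i x) else arr t ''rk'')"
    for m and u :: ram_state
  let ?r = "FFor ''r'' ''n'' (FWhen
     (Equal (Read ''pref'' (Add (Mul (Add (Read ''X'' (Reg ''i'')) (Const 1)) (Reg ''n'')) (Reg ''r'')))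
        (Add (Read ''X'' (Reg ''x'')) (Const 1)))
     (FStore ''rk'' (Add (Mul (Reg ''i'') (Reg ''n'')) (Reg ''x'')) (Reg ''r'')))"
  have "J (reg t ''n'') (sem ?r t)"
  proof (rule sem_For_rule, goal_cases)
    case (3 m u)
    have u: "reg u ''n'' = n" "arr u ''X'' = arr s ''X''" "arr u ''pref'' = arr s ''pref''"
      "reg u ''i'' = i" "reg u ''x'' = x" "reg u ''r'' = m"
      using 3(3,4) t by (simp_all add: unchanged_def)
    have "m < n" using 3(1) t by simp
    then have "arr s ''pref'' (Suc (X i) * n + m) = Suc (X x) \<longleftrightarrow> m = f i x"
      using f(2)[of i x m] 7(1,2) by (simp add: n_def)
    then show ?case using 3(2) X 7(1,2) by (auto simp: J_def u less_Suc_eq)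
  qed (simp_all add: J_def)
  then show ?case using f(1)[OF 7(1,2)] by (simp add: J_def t n_def)
qed (use ix in auto)

section \<open>Ranks of objects in the preference lists\<close>

definition rank_of :: "swap_instance \<Rightarrow> nat \<Rightarrow> nat \<Rightarrow> nat" where
  "rank_of I i x = card {y \<in> objects I. (y, x) \<in> pref I i}"

lemma rank_of_less_iff:
  assumes "strict_preferences I" "i \<in> agents I" "x \<in> objects I" "y \<in> objects I"
  shows "rank_of I i x < rank_of I i y \<longleftrightarrow> (x, y) \<in> pref I i"
proof -
  have lin: "trans (pref I i)" "irrefl (pref I i)" "total_on (objects I) (pref I i)"
    using assms by (auto simp: strict_preferences_def strict_linear_order_on_def)
  have fin: "finite {y \<in> objects I. (y, x) \<in> pref I i}" for x by (simp add: objects_def)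
  have mono: "rank_of I i x < rank_of I i y" if "(x, y) \<in> pref I i" "x \<in> objects I" for x y
    unfolding rank_of_def
  proof (rule psubset_card_mono[OF fin])
    have "x \<notin> {z \<in> objects I. (z, x) \<in> pref I i}" using lin(2) by (auto simp: irrefl_def)
    moreover have "x \<in> {z \<in> objects I. (z, y) \<in> pref I i}" using that by auto
    moreover have "{z \<in> objects I. (z, x) \<in> pref I i} \<subseteq> {z \<in> objects I. (z, y) \<in> pref I i}"
      using lin(1) that(1) by (auto dest: transD)
    ultimately show "{z \<in> objects I. (z, x) \<in> pref I i} \<subset> {z \<in> objects I. (z, y) \<in> pref I i}" by blast
  qed
  show ?thesis
  proof
    assume less: "rank_of I i x < rank_of I i y"
    then have "x \<noteq> y" "(y, x) \<notin> pref I i" using mono[of y x] assms(4) by auto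
    then show "(x, y) \<in> pref I i" using lin(3) assms(3,4) by (auto simp: total_on_def)
  qed (use mono assms in blast)
qed

lemma rank_of_less_num:
  assumes "strict_preferences I" "i \<in> agents I" "x \<in> objects I"
  shows "rank_of I i x < num I"
proof -
  have "irrefl (pref I i)" using assms by (auto simp: strict_preferences_def strict_linear_order_on_def)
  then have "{y \<in> objects I. (y, x) \<in> pref I i} \<subset> objects I" using assms(3) by (auto simp: irrefl_def)
  then have "rank_of I i x < card (objects I)"
    unfolding rank_of_def by (intro psubset_card_mono) (simp_all add: objects_def)
  then show ?thesis by (simp add: objects_def)
qed

text \<open>\<open>rank_of\<close> is injective from \<open>objects I\<close> into
  \<open>{..<num I}\<close>, a set of the same size, hence onto; so each rank describes exactly one
  object.\<close>

lemma object_at_rank: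
  assumes "strict_preferences I" "i \<in> agents I" "r < num I"
  shows "object_at_rank I i r \<in> objects I \<and> rank_of I i (object_at_rank I i r) = r"
    and "x \<in> objects I \<Longrightarrow> object_at_rank I i r = x \<longleftrightarrow> rank_of I i x = r"
proof -
  have inj: "inj_on (rank_of I i) (objects I)"
  proof (rule inj_onI)
    fix x y assume *: "x \<in> objects I" "y \<in> objects I" "rank_of I i x = rank_of I i y"
    then have "(x, y) \<notin> pref I i" "(y, x) \<notin> pref I i"
      using rank_of_less_iff[OF assms(1,2)] by (metis less_irrefl)+
    moreover have "total_on (objects I) (pref I i)"
      using assms by (auto simp: strict_preferences_def strict_linear_order_on_def)
    ultimately show "x = y" using * by (auto simp: total_on_def)
  qed
  have "rank_of I i ` objects I = {..<num I}"
    using rank_of_less_num[OF assms(1,2)]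
    by (intro card_subset_eq) (auto simp: card_image[OF inj], simp add: objects_def)
  then obtain z where z: "z \<in> objects I" "rank_of I i z = r" using assms(3) by (metis imageE lessThan_iff)
  have "object_at_rank I i r = z"
    unfolding object_at_rank_def rank_of_def[symmetric]
    by (rule the_equality) (use z inj in \<open>auto dest: inj_onD\<close>)
  then show "object_at_rank I i r \<in> objects I \<and> rank_of I i (object_at_rank I i r) = r"
    "x \<in> objects I \<Longrightarrow> object_at_rank I i r = x \<longleftrightarrow> rank_of I i x = r"
    using z inj by (auto dest: inj_onD)
qed

lemma pref_array_eq:
  assumes "strict_preferences I" "i < num I" "r < num I" "x < num I"
  shows "pref_array I (Suc i * num I + r) = Suc x \<longleftrightarrow> r = rank_of I (Suc i) (Suc x)"
proof -
  have "(Suc i * num I + r) div num I = Suc i" "(Suc i * num I + r) mod num I = r"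
    using assms by (auto simp del: mult_Suc)
  moreover have "Suc i \<in> agents I" "Suc x \<in> objects I" using assms by (auto simp: agents_def objects_def)
  ultimately show ?thesis
    using object_at_rank(2)[OF assms(1) _ assms(3), of "Suc i" "Suc x"]
    by (auto simp: pref_array_def simp del: mult_Suc)
qed

subsection \<open>Relabelling along the path\<close>

lemma swap_assignment: "swap I \<sigma> \<sigma>' \<Longrightarrow> assignment I \<sigma>'"
proof -
  assume "swap I \<sigma> \<sigma>'"
  then obtain i j where ij: "assignment I \<sigma>" "i \<in> agents I" "j \<in> agents I" "\<sigma>' = \<sigma>(i := \<sigma> j, j := \<sigma> i)"
    by (auto simp: swap_def)
  have "\<sigma>' = \<sigma> \<circ> transpose i j" by (auto simp: ij(4) fun_eq_iff transpose_def)
  moreover have "bij_betw (transpose i j) (agents I) (agents I)" using ij by simp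
  ultimately show ?thesis using ij(1) by (auto simp: assignment_def intro: bij_betw_trans)
qed

text \<open>\<open>rel\<close> is a bisimulation between assignments of agents and of positions. It
  carries the bound \<open>\<sigma> p < num I\<close>, under which \<open>P\<close> is known to
  reflect the preferences.\<close>

lemma reachable_iff_line_reachable:
  assumes path: "path_of I X" and strict: "strict_preferences I"
    and mkt: "line_market (num I) P"
    and P: "\<And>i x y. i < num I \<Longrightarrow> x < num I \<Longrightarrow> y < num I \<Longrightarrow>
      P i x y \<longleftrightarrow> (Suc (X x), Suc (X y)) \<in> pref I (Suc (X i))"
    and k: "k < num I" and l: "l < num I"
  shows "reachable I (Suc (X k)) (Suc (X l)) \<longleftrightarrow> line_market.line_reachable (num I) P k l"
proof -
  interpret line_market "num I" P by (rule mkt)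
  let ?n = "num I" and ?a = "\<lambda>i. Suc (X i)"
  have agent: "?a i \<in> agents I" if "i < ?n" for i using path_of_less[OF path that] by (simp add: agents_def)
  have inj: "?a i = ?a j \<longleftrightarrow> i = j" if "i < ?n" "j < ?n" for i j using path_of_inj[OF path that] by simp
  define rel where "rel \<tau> \<sigma> \<longleftrightarrow> assignment I \<tau> \<and> (\<forall>p<?n. \<sigma> p < ?n \<and> \<tau> (?a p) = ?a (\<sigma> p))" for \<tau> \<sigma> :: "nat \<Rightarrow> nat"
  have rel_upd: "rel (\<tau>(?a p := \<tau> (?a (Suc p)), ?a (Suc p) := \<tau> (?a p))) (\<sigma>(p := \<sigma> (Suc p), Suc p := \<sigma> p))"
    if "rel \<tau> \<sigma>" "Suc p < ?n" "assignment I (\<tau>(?a p := \<tau> (?a (Suc p)), ?a (Suc p) := \<tau> (?a p)))" for \<tau> \<sigma> p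
    using that inj[of _ p] inj[of _ "Suc p"] by (auto simp: rel_def)
  have pref_iff: "P i (\<sigma> p) (\<sigma> q) \<longleftrightarrow> (\<tau> (?a p), \<tau> (?a q)) \<in> pref I (?a i)"
    if "rel \<tau> \<sigma>" "i < ?n" "p < ?n" "q < ?n" for \<tau> \<sigma> i p q
    using that P by (simp add: rel_def)
  have init: "rel initial_assignment id"
    by (auto simp: rel_def assignment_def initial_assignment_def agents_def objects_def bij_betw_def inj_on_def image_def)
  have forward: "\<exists>\<sigma>'. line_step \<sigma> \<sigma>' \<and> rel \<tau>' \<sigma>'" if sw: "swap I \<tau> \<tau>'" and r: "rel \<tau> \<sigma>" for \<tau> \<tau>' \<sigma>
  proof -
    from sw obtain i j where ij: "assignment I \<tau>" "i \<in> agents I" "j \<in> agents I" "i \<noteq> j" "{i, j} \<in> edges I"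
      "weakly_prefers I i (\<tau> j) (\<tau> i)" "weakly_prefers I j (\<tau> i) (\<tau> j)" "\<tau>' = \<tau>(i := \<tau> j, j := \<tau> i)"
      by (auto simp: swap_def)
    \<comment> \<open>Injectivity of the assignment makes the weak preferences of a swap
      strict.\<close>
    have "\<tau> i \<noteq> \<tau> j" using ij by (auto simp: assignment_def bij_betw_def inj_on_def)
    then have pr: "(\<tau> j, \<tau> i) \<in> pref I i" "(\<tau> i, \<tau> j) \<in> pref I j" using ij by (auto simp: weakly_prefers_def)
    obtain p where p: "Suc p < ?n" "{i, j} = {?a p, ?a (Suc p)}"
      using ij(5) path by (auto simp: path_of_def)
    then have "i = ?a p \<and> j = ?a (Suc p) \<or> i = ?a (Suc p) \<and> j = ?a p" by (simp add: doubleton_eq_iff)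
    then have "(\<tau> (?a (Suc p)), \<tau> (?a p)) \<in> pref I (?a p) \<and> (\<tau> (?a p), \<tau> (?a (Suc p))) \<in> pref I (?a (Suc p)) \<and>
        \<tau>' = \<tau>(?a p := \<tau> (?a (Suc p)), ?a (Suc p) := \<tau> (?a p))"
      using pr ij(4,8) by (auto simp: fun_upd_twist)
    then show ?thesis
      using p(1) pref_iff[OF r, of p "Suc p" p] pref_iff[OF r, of "Suc p" p "Suc p"] rel_upd[OF r p(1)] swap_assignment[OF sw]
      by (intro exI[of _ "\<sigma>(p := \<sigma> (Suc p), Suc p := \<sigma> p)"]) (auto simp: line_step_def)
  qed
  have backward: "\<exists>\<tau>'. swap I \<tau> \<tau>' \<and> rel \<tau>' \<sigma>'" if st: "line_step \<sigma> \<sigma>'" and r: "rel \<tau> \<sigma>" for \<tau> \<sigma> \<sigma>'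
  proof -
    from st obtain p where p: "Suc p < ?n" "P p (\<sigma> (Suc p)) (\<sigma> p)" "P (Suc p) (\<sigma> p) (\<sigma> (Suc p))"
      "\<sigma>' = \<sigma>(p := \<sigma> (Suc p), Suc p := \<sigma> p)" by (auto simp: line_step_def)
    let ?\<tau> = "\<tau>(?a p := \<tau> (?a (Suc p)), ?a (Suc p) := \<tau> (?a p))"
    have "swap I \<tau> ?\<tau>"
      unfolding swap_def
    proof (intro conjI bexI)
      show "assignment I \<tau>" using r by (simp add: rel_def)
      show "?a p \<noteq> ?a (Suc p)" using inj[of p "Suc p"] p(1) by simp
      show "{?a p, ?a (Suc p)} \<in> edges I" using path_of_edge[OF path, of p "Suc p"] p(1) by simp
      show "weakly_prefers I (?a p) (\<tau> (?a (Suc p))) (\<tau> (?a p))"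
        using pref_iff[OF r, of p "Suc p" p] p by (simp add: weakly_prefers_def)
      show "weakly_prefers I (?a (Suc p)) (\<tau> (?a p)) (\<tau> (?a (Suc p)))"
        using pref_iff[OF r, of "Suc p" p "Suc p"] p by (simp add: weakly_prefers_def)
    qed (use agent p(1) in auto)
    then show ?thesis using rel_upd[OF r p(1)] swap_assignment p(4) by blast
  qed
  have "\<exists>\<sigma>. line_step\<^sup>*\<^sup>* id \<sigma> \<and> rel \<tau> \<sigma>" if "(swap I)\<^sup>*\<^sup>* initial_assignment \<tau>" for \<tau>
    using that
  proof induction
    case base
    then show ?case using init by blast
  next
    case (step \<tau> \<tau>')
    then show ?case using forward by (meson rtranclp.rtrancl_into_rtrancl)
  qed
  moreover have "\<exists>\<tau>. (swap I)\<^sup>*\<^sup>* initial_assignment \<tau> \<and> rel \<tau> \<sigma>" if "line_step\<^sup>*\<^sup>* id \<sigma>" for \<sigma>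
    using that
  proof induction
    case base
    then show ?case using init by blast
  next
    case (step \<sigma> \<sigma>')
    then show ?case using backward by (meson rtranclp.rtrancl_into_rtrancl)
  qed
  moreover have "\<tau> (?a k) = ?a l \<longleftrightarrow> \<sigma> k = l" if "rel \<tau> \<sigma>" for \<tau> \<sigma>
    using that inj[of "\<sigma> k" l] k l by (auto simp: rel_def)
  ultimately show ?thesis unfolding reachable_def line_reachable_def by metis
qed

lemma sem_decide:
  assumes strict: "strict_preferences I" and net: "path_network I" and k: "k \<in> agents I" and l: "l \<in> objects I"
    and s: "reg s ''n'' = num I" "reg s ''k'' = k" "reg s ''l'' = l" "reg s ''N2'' = 2 * num I" "reg s ''out'' = 0"
      "arr s ''pref'' = pref_array I" "arr s ''adj'' = adj_array I"
  shows "reg (sem decide s) ''out'' = (if reachable I k l then 1 else 0)"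
proof -
  let ?n = "num I"
  have n: "0 < ?n" using k by (auto simp: agents_def)
  define s1 where "s1 = sem end_point s"
  define s2 where "s2 = sem walk s1"
  define s3 where "s3 = sem (FWhen (Less (Reg ''K'') (Reg ''L''))
       (FAssign ''start'' (Read ''X'' (Sub (Reg ''n'') (Const 1))) ;; walk)) s2"
  define s4 where "s4 = sem ranks s3"
  define s5 where "s5 = sem (FWhen (Equal (Reg ''K'') (Reg ''L'')) (FAssign ''out'' (Const 1))) s4"
  \<comment> \<open>The orientation of the enumeration is chosen to start at the end that was
    found.\<close>
  obtain X where X: "path_of I X" "reg s1 ''start'' = X 0"
  proof -
    obtain X where X: "path_of I X" using path_network_path_of[OF net] .
    show thesis
      using sem_end_point[OF X n s(1,7)] that[OF X] that[OF path_of_reverse[OF X]] by (auto simp: s1_def)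
  qed
  have s1: "reg s1 ''n'' = ?n" "reg s1 ''k'' = k" "reg s1 ''l'' = l" "reg s1 ''N2'' = 2 * ?n" "reg s1 ''out'' = 0"
    "arr s1 ''pref'' = pref_array I" "arr s1 ''adj'' = adj_array I"
    unfolding s1_def by (simp_all add: s end_point_def)
  have kl: "k - 1 < ?n" "l - 1 < ?n" "0 < k" "0 < l" using k l by (auto simp: agents_def objects_def)
  obtain K where "K < ?n" "X K = k - 1" using path_of_surj[OF X(1) kl(1)] .
  then have K: "K < ?n" "k = Suc (X K)" using kl by auto
  obtain L where "L < ?n" "X L = l - 1" using path_of_surj[OF X(1) kl(2)] .
  then have L: "L < ?n" "l = Suc (X L)" using kl by auto
  have w: "reg s2 ''n'' = ?n" "reg s2 ''k'' = k" "reg s2 ''l'' = l" "reg s2 ''N2'' = 2 * ?n" "reg s2 ''out'' = 0"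
    "arr s2 ''pref'' = pref_array I" "arr s2 ''adj'' = adj_array I"
    unfolding s2_def by (simp_all add: s1 walk_def)
  have s2: "\<And>i. i < ?n \<Longrightarrow> arr s2 ''X'' i = X i" "reg s2 ''K'' = K" "reg s2 ''L'' = L"
    using sem_walk[OF X(1) K(1) _ L(1), of s1] K L X(2) s1 by (simp_all add: s2_def)
  have s3: "reg s3 ''n'' = ?n" "reg s3 ''N2'' = 2 * ?n" "reg s3 ''out'' = 0" "arr s3 ''pref'' = pref_array I"
    unfolding s3_def by (simp_all add: w walk_def)
  have "\<exists>Y K' L'. path_of I Y \<and> (\<forall>i<?n. arr s3 ''X'' i = Y i) \<and> reg s3 ''K'' = K' \<and> reg s3 ''L'' = L' \<and>
      L' \<le> K' \<and> K' < ?n \<and> k = Suc (Y K') \<and> l = Suc (Y L')"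
  proof (cases "K < L")
    case False
    then have "s3 = s2" by (simp add: s3_def s2)
    then show ?thesis using False X K L s2 by (intro exI[of _ X] exI[of _ K] exI[of _ L]) simp
  next
    case True
    let ?Y = "\<lambda>i. X (?n - 1 - i)"
    have "s3 = sem walk (set_reg ''start'' (X (?n - 1)) s2)" using True n by (simp add: s3_def s2 w)
    moreover have "?n - 1 - (?n - 1 - K) = K" "?n - 1 - (?n - 1 - L) = L" using K L by auto
    ultimately have "\<And>i. i < ?n \<Longrightarrow> arr s3 ''X'' i = ?Y i" "reg s3 ''K'' = ?n - 1 - K" "reg s3 ''L'' = ?n - 1 - L"
      using sem_walk[OF path_of_reverse[OF X(1)], of "?n - 1 - K" "set_reg ''start'' (X (?n - 1)) s2" "?n - 1 - L"] K L n w
      by simp_all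
    then show ?thesis
      using path_of_reverse[OF X(1)] K L True n
      by (intro exI[of _ ?Y] exI[of _ "?n - 1 - K"] exI[of _ "?n - 1 - L"]) auto
  qed
  then obtain Y K' L' where Y: "path_of I Y" "\<And>i. i < ?n \<Longrightarrow> arr s3 ''X'' i = Y i"
    and KL: "reg s3 ''K'' = K'" "reg s3 ''L'' = L'" "L' \<le> K'" "K' < ?n" "k = Suc (Y K')" "l = Suc (Y L')" by blast
  have s4: "reg s4 ''n'' = ?n" "reg s4 ''N2'' = 2 * ?n" "reg s4 ''out'' = 0" "reg s4 ''K'' = K'" "reg s4 ''L'' = L'"
    unfolding s4_def by (simp_all add: s3 KL ranks_def)
  have Yn: "Y i < ?n" if "i < ?n" for i using path_of_less[OF Y(1) that] .
  have ag: "Suc (Y i) \<in> agents I" "Suc (Y i) \<in> objects I" if "i < ?n" for i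
    using Yn[OF that] by (simp_all add: agents_def objects_def)
  define lt where "lt = rank_less ?n (arr s4 ''rk'')"
  have rk: "arr s4 ''rk'' (i * ?n + x) = rank_of I (Suc (Y i)) (Suc (Y x))" if "i < ?n" "x < ?n" for i x
    unfolding s4_def s3(1)[symmetric]
    by (rule sem_ranks[where X = Y])
      (use Y(2) that ag Yn in \<open>auto simp: s3 rank_of_less_num[OF strict] pref_array_eq[OF strict] simp del: mult_Suc\<close>)
  have lt: "lt i x y \<longleftrightarrow> (Suc (Y x), Suc (Y y)) \<in> pref I (Suc (Y i))" if "i < ?n" "x < ?n" "y < ?n" for i x y
    using that rank_of_less_iff[OF strict ag(1) ag(2) ag(2)] by (simp add: lt_def rank_less_def rk)
  interpret line_market ?n lt unfolding lt_def by (rule line_market_rank_less)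
  have reach: "reachable I k l \<longleftrightarrow> line_reachable K' L'"
    unfolding KL using reachable_iff_line_reachable[OF Y(1) strict line_market_axioms lt] KL by simp
  have s5: "reg s5 ''n'' = ?n" "reg s5 ''N2'' = 2 * ?n" "reg s5 ''K'' = K'" "reg s5 ''L'' = L'"
    "arr s5 ''rk'' = arr s4 ''rk''" "reg s5 ''out'' = (if K' = L' then 1 else 0)"
    unfolding s5_def by (simp_all add: s4)
  define D where "D \<longleftrightarrow> (\<exists>b A. K' \<le> b \<and> b < ?n \<and> direction_choice K' L' b A)"
  have "reg s5 ''N2'' = 2 * reg s5 ''n''" "reg s5 ''K'' < reg s5 ''n''" by (simp_all add: s5 KL)
  from sem_search[OF this] have "reg (sem search s5) ''out'' = (if D then 1 else if K' = L' then 1 else 0)"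
    unfolding s5 D_def lt_def .
  also have "\<dots> = (if reachable I k l then 1 else 0)"
  proof (cases "K' = L'")
    case True
    have "line_reachable K' K'" unfolding line_reachable_def by (intro exI[of _ id]) simp
    then show ?thesis using True reach by simp
  next
    case False
    then have "line_reachable K' L' \<longleftrightarrow> D"
      unfolding D_def using KL by (intro line_reachable_iff_direction_choice) auto
    then show ?thesis using False reach by simp
  qed
  finally show ?thesis
    unfolding s5_def s4_def s3_def s2_def s1_def decide_def sem.simps(4) .
qed

theorem theorem1:
  shows "\<exists>(P :: com) (T :: nat \<Rightarrow> nat) (w :: nat \<Rightarrow> nat).
    (\<lambda>n. real (T n)) \<in> O(\<lambda>n. real n ^ 4) \<and>
    (\<lambda>n. real (w n)) \<in> O(\<lambda>n. ln (real n)) \<and>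
    (\<forall>(I :: swap_instance) k l.
       strict_preferences I \<longrightarrow> path_network I \<longrightarrow> k \<in> agents I \<longrightarrow> l \<in> objects I \<longrightarrow>
       (\<exists>t s. exec (w (num I)) P (input_state I k l) t s \<and>
              t \<le> T (num I) \<and>
              reg s ''out'' = (if reachable I k l then 1 else 0)))"
proof -
  obtain C where C: "\<And>B. B \<ge> 1 \<Longrightarrow> fcost B decide \<le> C * B ^ 4"
    using fcost_le_power[of decide] by (auto simp: loop_depth_decide)
  \<comment> \<open>Doubling \<open>n\<close> stores a sum, which \<open>fsafe\<close> forbids, so
    it happens in a prelude outside \<open>decide\<close>; its cost is the 4 in
    \<open>T\<close>.\<close>
  define P where "P = Seq (Assign ''N2'' (Add (Reg ''n'') (Reg ''n''))) (compile decide)"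
  \<comment> \<open>\<open>2 * n + 2\<close> bounds the memory, including \<open>N2\<close>, and is
    at least 2 as \<open>exec_compile\<close> requires.\<close>
  define T where "T n = 4 + C * (2 * n + 2) ^ 4" for n :: nat
  \<comment> \<open>Six copies of the rounded logarithm give the sixth power, for degree 6; the
    seventh makes the inequality strict.\<close>
  define w where "w n = 7 * nat \<lceil>log 2 (real (2 * n + 2))\<rceil>" for n :: nat
  have w: "(2 * n + 2) ^ 6 < (2::nat) ^ w n" for n
  proof -
    let ?k = "nat \<lceil>log 2 (real (2 * n + 2))\<rceil>"
    have "1 \<le> log 2 (real (2 * n + 2))" by (simp add: le_log_iff)
    then have k: "1 \<le> ?k" by linarith
    have "real (2 * n + 2) = 2 powr log 2 (real (2 * n + 2))" by simp
    also have "\<dots> \<le> 2 powr real ?k" by (intro powr_mono real_nat_ceiling_ge) simp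
    also have "\<dots> = real (2 ^ ?k)" by (subst powr_realpow) simp_all
    finally have "2 * n + 2 \<le> 2 ^ ?k" by (simp only: of_nat_le_iff)
    then have "(2 * n + 2) ^ 6 \<le> (2 ^ ?k) ^ 6" by (intro power_mono) simp_all
    also have "\<dots> = 2 ^ (6 * ?k)" by (simp add: power_mult[symmetric] mult.commute)
    also have "\<dots> < 2 ^ w n" using k by (simp add: w_def)
    finally show ?thesis .
  qed
  have "(\<lambda>n. real ((2 * n + 2) ^ 4)) \<in> O(\<lambda>n. real n ^ 4)" by real_asymp
  then have "(\<lambda>n. real C * real ((2 * n + 2) ^ 4)) \<in> O(\<lambda>n. real n ^ 4)" by (cases "C = 0") simp_all
  moreover have "(\<lambda>n. 4) \<in> O(\<lambda>n. real n ^ 4)" by real_asymp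
  ultimately have "(\<lambda>n. 4 + real C * real ((2 * n + 2) ^ 4)) \<in> O(\<lambda>n. real n ^ 4)" by (rule sum_in_bigo(1)[rotated])
  then have T_bigo: "(\<lambda>n. real (T n)) \<in> O(\<lambda>n. real n ^ 4)" by (simp add: T_def)
  have "(\<lambda>n. real (w n)) \<in> O(\<lambda>n. 7 * (log 2 (real (2 * n + 2)) + 1))"
  proof (rule landau_o.big_mono, intro always_eventually allI)
    fix n
    have "0 \<le> log 2 (real (2 * n + 2))" by (simp add: le_log_iff)
    then have "real (nat \<lceil>log 2 (real (2 * n + 2))\<rceil>) \<le> log 2 (real (2 * n + 2)) + 1"
      using ceiling_correct[of "log 2 (real (2 * n + 2))"] by linarith
    then have "real (w n) \<le> 7 * (log 2 (real (2 * n + 2)) + 1)" unfolding w_def of_nat_mult of_nat_numeral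
      by (rule mult_left_mono) simp
    then show "norm (real (w n)) \<le> norm (7 * (log 2 (real (2 * n + 2)) + 1))"
      using \<open>0 \<le> log 2 (real (2 * n + 2))\<close> by simp
  qed
  also have "(\<lambda>n::nat. 7 * (log 2 (real (2 * n + 2)) + 1)) \<in> O(\<lambda>n. ln (real n))" by real_asymp
  finally have w_bigo: "(\<lambda>n. real (w n)) \<in> O(\<lambda>n. ln (real n))" .
  have "\<exists>t s. exec (w (num I)) P (input_state I k l) t s \<and> t \<le> T (num I) \<and>
      reg s ''out'' = (if reachable I k l then 1 else 0)"
    if I: "strict_preferences I" "path_network I" "k \<in> agents I" "l \<in> objects I" for I k l
  proof -
    let ?n = "num I" and ?w = "w (num I)" and ?s = "input_state I k l"
    let ?B = "2 * ?n + 2"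
    have kl: "k \<le> ?n" "l \<le> ?n" "0 < ?n" using I(3,4) by (auto simp: agents_def objects_def)
    have pref: "pref_array I p \<le> ?B" for p
    proof (cases "p div ?n \<in> agents I")
      case True
      then show ?thesis
        using object_at_rank(1)[OF I(1) True, of "p mod ?n"] kl(3) by (simp add: pref_array_def objects_def)
    qed (simp add: pref_array_def)
    have bound: "mem_bounded ?B (set_reg ''N2'' (2 * ?n) ?s)"
      using pref kl by (auto simp: mem_bounded_def input_state_def adj_array_def)
    have "2 * ?n < 2 ^ ?w"
    proof -
      have "2 * ?n < ?B ^ 1" by simp
      also have "\<dots> \<le> ?B ^ 6" by (rule power_increasing) auto
      finally show ?thesis using w[of ?n] by linarith
    qed
    then have "afits ?w (Add (Reg ''n'') (Reg ''n'')) ?s" by (simp add: input_state_def)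
    from exec.Assign[OF this, of "''N2''"]
    have N2: "exec ?w (Assign ''N2'' (Add (Reg ''n'') (Reg ''n''))) ?s 4 (set_reg ''N2'' (2 * ?n) ?s)"
      by (simp add: input_state_def mult_2 eval_nat_numeral)
    have "\<exists>t\<le>fcost ?B decide. exec ?w (compile decide) (set_reg ''N2'' (2 * ?n) ?s) t (sem decide (set_reg ''N2'' (2 * ?n) ?s)) \<and>
      mem_bounded ?B (sem decide (set_reg ''N2'' (2 * ?n) ?s))"
      by (rule exec_compile[OF fsafe_decide bound]) (use w in auto)
    then obtain t where t: "t \<le> fcost ?B decide"
      "exec ?w (compile decide) (set_reg ''N2'' (2 * ?n) ?s) t (sem decide (set_reg ''N2'' (2 * ?n) ?s))" by blast
    have "exec ?w P ?s (4 + t) (sem decide (set_reg ''N2'' (2 * ?n) ?s))"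
      unfolding P_def using N2 t(2) by (rule exec.Seq)
    moreover have "4 + t \<le> T ?n" using t(1) C[of ?B] by (simp add: T_def)
    moreover have "reg (sem decide (set_reg ''N2'' (2 * ?n) ?s)) ''out'' = (if reachable I k l then 1 else 0)"
      by (rule sem_decide[OF I]) (simp_all add: input_state_def)
    ultimately show ?thesis by blast
  qed
  then show ?thesis using T_bigo w_bigo by blast
qed

end
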